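(* The functor $\bar R:\mathrm{Fin}^{\mathrm{op}}\to\mathrm{Span}$, which is the identity on objects and sends a map of finite sets $f:X\to Y$ to the span $Y\xleftarrow{f}X\xrightarrow{=}X$, makes the quasicategory $\mathrm{Span}$ into an algebraic theory.
   Context: An algebraic theory is a quasicategory $T$ together with an essentially surjective functor $\mathrm{Fin}^{\mathrm{op}}\to T$ that takes finite product diagrams to finite product diagrams. $\mathrm{Fin}$ is the category of finite sets (categories are identified with their nerves). $\mathrm{Span}$ is the quasicategory defined as follows. Let $C_n$ be the poset of nonempty subintervals $(i,\dots,j)$ of $(0,\dots,n)$ ordered by reverse inclusion (a morphism $I\to J$ exists when $J\subseteq I$). An $n$-simplex of $\mathrm{Span}$ is a functor $F:C_n\to\mathrm{Fin}$ such that whenever $I\cap J\ne\emptyset$ the square formed by $F(I\cup J)\to F(I)\to F(I\cap J)$ and $F(I\cup J)\to F(J)\to F(I\cap J)$ is a pullback; a monotone map $\alpha$ acts by precomposition with $(i,\dots,j)\mapsto(\alpha(i),\dots,\alpha(j))$. On a chain $X_n\to\cdots\to X_0$ of maps of finite sets (an $n$-simplex of $\mathrm{Fin}^{\mathrm{op}}$), $\bar R$ gives the functor $(i,\dots,j)\mapsto X_j$. *)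

theory Defs
  imports "HOL-Library.FuncSet" "HOL-Library.Infinite_Typeclass"
begin

section \<open>Simplicial sets\<close>

text \<open>The object \<open>[n]\<close> of the simplex category is \<open>{..n}\<close>. All maps between sets (in particular
  monotone maps and the components of simplicial maps) are extensional in the sense of
  \<^theory>\<open>HOL-Library.FuncSet\<close>, so that equality of maps is equality in HOL.\<close>

definition Delta :: "nat \<Rightarrow> nat \<Rightarrow> (nat \<Rightarrow> nat) set" where
  "Delta m n = {\<alpha> \<in> {..m} \<rightarrow>\<^sub>E {..n}. mono_on {..m} \<alpha>}"

text \<open>\<open>act X m n \<alpha>\<close> is the action \<open>X\<^sub>n \<rightarrow> X\<^sub>m\<close> of \<open>\<alpha> : [m] \<rightarrow> [n]\<close>.\<close>

record 'a sset =
  simplices :: "nat \<Rightarrow> 'a set"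
  act :: "nat \<Rightarrow> nat \<Rightarrow> (nat \<Rightarrow> nat) \<Rightarrow> 'a \<Rightarrow> 'a"

definition simplicial_set :: "'a sset \<Rightarrow> bool" where
  "simplicial_set X \<longleftrightarrow>
     (\<forall>m n. \<forall>\<alpha>\<in>Delta m n. \<forall>x\<in>simplices X n. act X m n \<alpha> x \<in> simplices X m) \<and>
     (\<forall>n. \<forall>x\<in>simplices X n. act X n n (\<lambda>i\<in>{..n}. i) x = x) \<and>
     (\<forall>k m n. \<forall>\<beta>\<in>Delta k m. \<forall>\<alpha>\<in>Delta m n. \<forall>x\<in>simplices X n.
        act X k n (compose {..k} \<alpha> \<beta>) x = act X k m \<beta> (act X m n \<alpha> x))"

definition smap :: "'a sset \<Rightarrow> 'b sset \<Rightarrow> (nat \<Rightarrow> 'a \<Rightarrow> 'b) set" where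
  "smap X Y = {f.
     (\<forall>n. f n \<in> simplices X n \<rightarrow>\<^sub>E simplices Y n) \<and>
     (\<forall>m n. \<forall>\<alpha>\<in>Delta m n. \<forall>x\<in>simplices X n. f m (act X m n \<alpha> x) = act Y m n \<alpha> (f n x))}"

definition scomp :: "'a sset \<Rightarrow> (nat \<Rightarrow> 'b \<Rightarrow> 'c) \<Rightarrow> (nat \<Rightarrow> 'a \<Rightarrow> 'b) \<Rightarrow> nat \<Rightarrow> 'a \<Rightarrow> 'c" where
  "scomp X g f = (\<lambda>n. compose (simplices X n) (g n) (f n))"

text \<open>\<open>w\<close> restricts to \<open>u\<close> on the simplicial subset \<open>A\<close> of the domain of \<open>w\<close>.\<close>

definition extends_on :: "'a sset \<Rightarrow> (nat \<Rightarrow> 'a \<Rightarrow> 'b) \<Rightarrow> (nat \<Rightarrow> 'a \<Rightarrow> 'b) \<Rightarrow> bool" where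
  "extends_on A w u \<longleftrightarrow> (\<forall>m. \<forall>x\<in>simplices A m. w m x = u m x)"

definition simplex :: "nat \<Rightarrow> (nat \<Rightarrow> nat) sset" where
  "simplex n = \<lparr> simplices = (\<lambda>m. Delta m n),
                 act = (\<lambda>k m \<alpha> \<beta>. compose {..k} \<beta> \<alpha>) \<rparr>"

definition boundary :: "nat \<Rightarrow> (nat \<Rightarrow> nat) sset" where
  "boundary n = \<lparr> simplices = (\<lambda>m. {\<beta> \<in> Delta m n. \<beta> ` {..m} \<noteq> {..n}}),
                  act = act (simplex n) \<rparr>"

definition horn :: "nat \<Rightarrow> nat \<Rightarrow> (nat \<Rightarrow> nat) sset" where
  "horn n k = \<lparr> simplices = (\<lambda>m. {\<beta> \<in> Delta m n. \<not> {..n} - {k} \<subseteq> \<beta> ` {..m}}),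
                act = act (simplex n) \<rparr>"

definition discrete :: "'i set \<Rightarrow> 'i sset" where
  "discrete I = \<lparr> simplices = (\<lambda>n. I), act = (\<lambda>m n \<alpha> i. i) \<rparr>"

definition vertex_map :: "'a sset \<Rightarrow> 'a \<Rightarrow> nat \<Rightarrow> (nat \<Rightarrow> nat) \<Rightarrow> 'a" where
  "vertex_map X x = (\<lambda>m. \<lambda>\<alpha>\<in>Delta m 0. act X m 0 \<alpha> x)"

definition coface :: "nat \<Rightarrow> nat \<Rightarrow> nat \<Rightarrow> nat" where
  "coface n k = (\<lambda>i\<in>{..n}. if i < k then i else Suc i)"

text \<open>\<open>face X n k\<close> is \<open>d\<^sub>k : X\<^bsub>n+1\<^esub> \<rightarrow> X\<^sub>n\<close>, omitting the \<open>k\<close>-th vertex.\<close>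

definition face :: "'a sset \<Rightarrow> nat \<Rightarrow> nat \<Rightarrow> 'a \<Rightarrow> 'a" where
  "face X n k = act X n (Suc n) (coface n k)"

definition source :: "'a sset \<Rightarrow> 'a \<Rightarrow> 'a" where
  "source X e = face X 0 1 e"

definition target :: "'a sset \<Rightarrow> 'a \<Rightarrow> 'a" where
  "target X e = face X 0 0 e"

definition identity_edge :: "'a sset \<Rightarrow> 'a \<Rightarrow> 'a" where
  "identity_edge X x = act X 1 0 (\<lambda>i\<in>{..1}. 0) x"


section \<open>Quasicategories\<close>

definition quasicategory :: "'a sset \<Rightarrow> bool" where
  "quasicategory X \<longleftrightarrow> simplicial_set X \<and>
     (\<forall>n k. 0 < k \<longrightarrow> k < n \<longrightarrow>
        (\<forall>u\<in>smap (horn n k) X. \<exists>w\<in>smap (simplex n) X. extends_on (horn n k) w u))"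

definition acyclic_kan_fibration :: "'a sset \<Rightarrow> 'b sset \<Rightarrow> (nat \<Rightarrow> 'a \<Rightarrow> 'b) \<Rightarrow> bool" where
  "acyclic_kan_fibration X Y p \<longleftrightarrow> p \<in> smap X Y \<and>
     (\<forall>n. \<forall>u\<in>smap (boundary n) X. \<forall>v\<in>smap (simplex n) Y.
        extends_on (boundary n) v (scomp (boundary n) p u) \<longrightarrow>
        (\<exists>w\<in>smap (simplex n) X. extends_on (boundary n) w u \<and> scomp (simplex n) p w = v))"

text \<open>\<open>h\<close> is a composite of \<open>f\<close> followed by \<open>g\<close>.\<close>

definition is_composite :: "'a sset \<Rightarrow> 'a \<Rightarrow> 'a \<Rightarrow> 'a \<Rightarrow> bool" where
  "is_composite X f g h \<longleftrightarrow>
     (\<exists>\<sigma>\<in>simplices X 2. face X 1 2 \<sigma> = f \<and> face X 1 0 \<sigma> = g \<and> face X 1 1 \<sigma> = h)"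

definition equivalence_edge :: "'a sset \<Rightarrow> 'a \<Rightarrow> bool" where
  "equivalence_edge X f \<longleftrightarrow> f \<in> simplices X 1 \<and>
     (\<exists>g\<in>simplices X 1.
        is_composite X f g (identity_edge X (source X f)) \<and>
        is_composite X g f (identity_edge X (target X f)))"

definition essentially_surjective :: "'a sset \<Rightarrow> 'b sset \<Rightarrow> (nat \<Rightarrow> 'a \<Rightarrow> 'b) \<Rightarrow> bool" where
  "essentially_surjective X Y f \<longleftrightarrow>
     (\<forall>y\<in>simplices Y 0. \<exists>x\<in>simplices X 0. \<exists>e.
        equivalence_edge Y e \<and> source Y e = f 0 x \<and> target Y e = y)"


section \<open>Joins, slices and limits\<close>

text \<open>An \<open>n\<close>-simplex of the join \<open>A * B\<close> is an \<open>n\<close>-simplex of \<open>A\<close>, an \<open>n\<close>-simplex of \<open>B\<close>, or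
  \<open>Mid i j a b\<close> with \<open>a \<in> A\<^sub>i\<close>, \<open>b \<in> B\<^sub>j\<close> and \<open>i + 1 + j = n\<close>.\<close>

datatype ('a, 'b) join_simplex = InL 'a | InR 'b | Mid nat nat 'a 'b

text \<open>In the last case below \<open>p\<close> is the number of elements of \<open>[m]\<close> that \<open>\<alpha>\<close> sends to the first
  block \<open>{0,\<dots>,i}\<close> of \<open>[n] = [i] \<star> [j]\<close>.\<close>

definition join_act ::
  "'a sset \<Rightarrow> 'b sset \<Rightarrow> nat \<Rightarrow> nat \<Rightarrow> (nat \<Rightarrow> nat) \<Rightarrow> ('a, 'b) join_simplex \<Rightarrow> ('a, 'b) join_simplex"
where
  "join_act A B m n \<alpha> z = (case z of
      InL a \<Rightarrow> InL (act A m n \<alpha> a)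
    | InR b \<Rightarrow> InR (act B m n \<alpha> b)
    | Mid i j a b \<Rightarrow>
        (let p = card {t \<in> {..m}. \<alpha> t \<le> i} in
         if p = 0 then InR (act B m j (\<lambda>t\<in>{..m}. \<alpha> t - Suc i) b)
         else if p = Suc m then InL (act A m i \<alpha> a)
         else Mid (p - 1) (m - p)
                (act A (p - 1) i (restrict \<alpha> {..p - 1}) a)
                (act B (m - p) j (\<lambda>t\<in>{..m - p}. \<alpha> (t + p) - Suc i) b)))"

definition join :: "'a sset \<Rightarrow> 'b sset \<Rightarrow> ('a, 'b) join_simplex sset" where
  "join A B = \<lparr>
     simplices = (\<lambda>n. InL ` simplices A n \<union> InR ` simplices B n \<union>
        {Mid i j a b | i j a b. i + 1 + j = n \<and> a \<in> simplices A i \<and> b \<in> simplices B j}),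
     act = join_act A B \<rparr>"

text \<open>The map \<open>\<alpha> * id : \<Delta>\<^sup>m * K \<rightarrow> \<Delta>\<^sup>n * K\<close> on \<open>k\<close>-simplices, for \<open>\<alpha> : [m] \<rightarrow> [n]\<close>.\<close>

definition join_simplex_map ::
  "(nat \<Rightarrow> nat) \<Rightarrow> nat \<Rightarrow> (nat \<Rightarrow> nat, 'k) join_simplex \<Rightarrow> (nat \<Rightarrow> nat, 'k) join_simplex"
where
  "join_simplex_map \<alpha> k z = (case z of
      InL \<beta> \<Rightarrow> InL (compose {..k} \<alpha> \<beta>)
    | InR x \<Rightarrow> InR x
    | Mid i j \<beta> x \<Rightarrow> Mid i j (compose {..i} \<alpha> \<beta>) x)"

text \<open>The slice \<open>X\<^bsub>/p\<^esub>\<close> over \<open>p : K \<rightarrow> X\<close>: its \<open>n\<close>-simplices are the maps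
  \<open>\<Delta>\<^sup>n * K \<rightarrow> X\<close> that restrict to \<open>p\<close> on \<open>K\<close>.\<close>

definition slice :: "'k sset \<Rightarrow> 'a sset \<Rightarrow> (nat \<Rightarrow> 'k \<Rightarrow> 'a)
    \<Rightarrow> (nat \<Rightarrow> (nat \<Rightarrow> nat, 'k) join_simplex \<Rightarrow> 'a) sset" where
  "slice K X p = \<lparr>
     simplices = (\<lambda>n. {\<sigma> \<in> smap (join (simplex n) K) X.
                        \<forall>m. \<forall>x\<in>simplices K m. \<sigma> m (InR x) = p m x}),
     act = (\<lambda>m n \<alpha> \<sigma>.
        \<lambda>k. \<lambda>z\<in>simplices (join (simplex m) K) k. \<sigma> k (join_simplex_map \<alpha> k z)) \<rparr>"

text \<open>The projection \<open>X\<^bsub>/p\<^esub> \<rightarrow> X\<close> is restriction along \<open>\<Delta>\<^sup>n \<subseteq> \<Delta>\<^sup>n * K\<close>; by Yoneda a map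
  \<open>\<Delta>\<^sup>n \<rightarrow> X\<close> is identified with its value at the identity of \<open>[n]\<close>.\<close>

definition slice_proj :: "'k sset \<Rightarrow> 'a sset \<Rightarrow> (nat \<Rightarrow> 'k \<Rightarrow> 'a)
    \<Rightarrow> nat \<Rightarrow> (nat \<Rightarrow> (nat \<Rightarrow> nat, 'k) join_simplex \<Rightarrow> 'a) \<Rightarrow> 'a" where
  "slice_proj K X p = (\<lambda>n. \<lambda>\<sigma>\<in>simplices (slice K X p) n. \<sigma> n (InL (\<lambda>i\<in>{..n}. i)))"

definition final_vertex :: "'a sset \<Rightarrow> 'a \<Rightarrow> bool" where
  "final_vertex X x \<longleftrightarrow> x \<in> simplices X 0 \<and>
     acyclic_kan_fibration (slice (simplex 0) X (vertex_map X x)) X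
       (slice_proj (simplex 0) X (vertex_map X x))"

text \<open>A cone over a diagram \<open>K \<rightarrow> X\<close> is a map \<open>c : \<Delta>\<^sup>0 * K \<rightarrow> X\<close>, i.e. a vertex of the slice
  over its base; it is a limit cone if this vertex is final.\<close>

definition cone_base :: "'k sset \<Rightarrow> (nat \<Rightarrow> (nat \<Rightarrow> nat, 'k) join_simplex \<Rightarrow> 'a)
    \<Rightarrow> nat \<Rightarrow> 'k \<Rightarrow> 'a" where
  "cone_base K c = (\<lambda>n. \<lambda>x\<in>simplices K n. c n (InR x))"

definition limit_cone :: "'k sset \<Rightarrow> 'a sset \<Rightarrow> (nat \<Rightarrow> (nat \<Rightarrow> nat, 'k) join_simplex \<Rightarrow> 'a) \<Rightarrow> bool"
where
  "limit_cone K X c \<longleftrightarrow> c \<in> smap (join (simplex 0) K) X \<and>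
     final_vertex (slice K X (cone_base K c)) c"

definition product_diagram ::
  "'i set \<Rightarrow> 'a sset \<Rightarrow> (nat \<Rightarrow> (nat \<Rightarrow> nat, 'i) join_simplex \<Rightarrow> 'a) \<Rightarrow> bool" where
  "product_diagram I X c \<longleftrightarrow> limit_cone (discrete I) X c"

text \<open>Every finite indexing set is in bijection with a finite set of natural numbers.\<close>

definition preserves_finite_products :: "'a sset \<Rightarrow> 'b sset \<Rightarrow> (nat \<Rightarrow> 'a \<Rightarrow> 'b) \<Rightarrow> bool" where
  "preserves_finite_products X Y f \<longleftrightarrow>
     (\<forall>I :: nat set. finite I \<longrightarrow> (\<forall>c. product_diagram I X c \<longrightarrow>
        product_diagram I Y (scomp (join (simplex 0) (discrete I)) f c)))"


section \<open>Finite sets and algebraic theories\<close>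

text \<open>The objects of \<open>Fin\<close> are the finite subsets of a type \<open>'u\<close>, which is required to be infinite
  in the definitions of the simplicial sets below. A diagram in \<open>Fin\<close> indexed by a poset
  \<open>(P, le)\<close> consists of the values on objects and on the morphisms \<open>p \<rightarrow> q\<close> (there is
  one whenever \<open>le p q\<close>).\<close>

type_synonym ('p, 'u) diagram = "('p \<Rightarrow> 'u set) \<times> ('p \<Rightarrow> 'p \<Rightarrow> 'u \<Rightarrow> 'u)"

definition fin_functors :: "'p set \<Rightarrow> ('p \<Rightarrow> 'p \<Rightarrow> bool) \<Rightarrow> ('p, 'u) diagram set" where
  "fin_functors P le = {(Ob, Mor).
     Ob \<in> P \<rightarrow>\<^sub>E {A. finite A} \<and>
     (\<forall>p q. if p \<in> P \<and> q \<in> P \<and> le p q then Mor p q \<in> Ob p \<rightarrow>\<^sub>E Ob q else Mor p q = undefined) \<and>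
     (\<forall>p\<in>P. Mor p p = (\<lambda>x\<in>Ob p. x)) \<and>
     (\<forall>p\<in>P. \<forall>q\<in>P. \<forall>r\<in>P. le p q \<longrightarrow> le q r \<longrightarrow>
        Mor p r = compose (Ob p) (Mor q r) (Mor p q))}"

text \<open>Precomposition with a monotone map \<open>a\<close> out of the poset \<open>(P, le)\<close>.\<close>

definition precompose ::
  "'p set \<Rightarrow> ('p \<Rightarrow> 'p \<Rightarrow> bool) \<Rightarrow> ('p \<Rightarrow> 'q) \<Rightarrow> ('q, 'u) diagram \<Rightarrow> ('p, 'u) diagram" where
  "precompose P le a F =
     ((\<lambda>p\<in>P. fst F (a p)),
      (\<lambda>p q. if p \<in> P \<and> q \<in> P \<and> le p q then snd F (a p) (a q) else undefined))"

text \<open>The nerve of \<open>Fin\<^sup>o\<^sup>p\<close>: an \<open>n\<close>-simplex is a functor \<open>[n] \<rightarrow> Fin\<^sup>o\<^sup>p\<close>, i.e. a functor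
  \<open>[n]\<^sup>o\<^sup>p \<rightarrow> Fin\<close>, or a chain \<open>X\<^sub>n \<rightarrow> \<dots> \<rightarrow> X\<^sub>0\<close> of maps of finite sets.\<close>

definition Fin_op :: "(nat, 'u::infinite) diagram sset" where
  "Fin_op = \<lparr> simplices = (\<lambda>n. fin_functors {..n} (\<ge>)),
              act = (\<lambda>m n \<alpha>. precompose {..m} (\<ge>) \<alpha>) \<rparr>"

definition algebraic_theory :: "'a sset \<Rightarrow> (nat \<Rightarrow> (nat, 'u::infinite) diagram \<Rightarrow> 'a) \<Rightarrow> bool" where
  "algebraic_theory T F \<longleftrightarrow>
     quasicategory T \<and> F \<in> smap Fin_op T \<and>
     essentially_surjective Fin_op T F \<and> preserves_finite_products Fin_op T F"


section \<open>Spans\<close>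

text \<open>The pair \<open>(i, j)\<close> with \<open>i \<le> j \<le> n\<close> stands for the subinterval \<open>(i,\<dots>,j)\<close> of \<open>(0,\<dots>,n)\<close>,
  and \<open>ivl_le I J\<close> says that \<open>J \<subseteq> I\<close>. The pairs \<open>ivl_union I J\<close> and \<open>ivl_inter I J\<close> are
  the union and the intersection of \<open>I\<close> and \<open>J\<close> provided that \<open>I\<close> and \<open>J\<close> meet.\<close>

definition Ivl :: "nat \<Rightarrow> (nat \<times> nat) set" where
  "Ivl n = {(i, j). i \<le> j \<and> j \<le> n}"

definition ivl_le :: "nat \<times> nat \<Rightarrow> nat \<times> nat \<Rightarrow> bool" where
  "ivl_le I J \<longleftrightarrow> {fst J..snd J} \<subseteq> {fst I..snd I}"

definition ivl_union :: "nat \<times> nat \<Rightarrow> nat \<times> nat \<Rightarrow> nat \<times> nat" where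
  "ivl_union I J = (min (fst I) (fst J), max (snd I) (snd J))"

definition ivl_inter :: "nat \<times> nat \<Rightarrow> nat \<times> nat \<Rightarrow> nat \<times> nat" where
  "ivl_inter I J = (max (fst I) (fst J), min (snd I) (snd J))"

definition ivl_meet :: "nat \<times> nat \<Rightarrow> nat \<times> nat \<Rightarrow> bool" where
  "ivl_meet I J \<longleftrightarrow> {fst I..snd I} \<inter> {fst J..snd J} \<noteq> {}"

text \<open>The square \<open>f : A \<rightarrow> B\<close>, \<open>g : A \<rightarrow> C\<close>, \<open>h : B \<rightarrow> D\<close>, \<open>k : C \<rightarrow> D\<close> is a pullback in \<open>Fin\<close>.\<close>

definition fin_pullback :: "'u set \<Rightarrow> 'u set \<Rightarrow> 'u set \<Rightarrow>
    ('u \<Rightarrow> 'u) \<Rightarrow> ('u \<Rightarrow> 'u) \<Rightarrow> ('u \<Rightarrow> 'u) \<Rightarrow> ('u \<Rightarrow> 'u) \<Rightarrow> bool" where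
  "fin_pullback A B C f g h k \<longleftrightarrow>
     compose A h f = compose A k g \<and>
     (\<forall>(T :: 'u set) s t. finite T \<longrightarrow> s \<in> T \<rightarrow>\<^sub>E B \<longrightarrow> t \<in> T \<rightarrow>\<^sub>E C \<longrightarrow> compose T h s = compose T k t \<longrightarrow>
        (\<exists>!u. u \<in> T \<rightarrow>\<^sub>E A \<and> compose T f u = s \<and> compose T g u = t))"

definition span_simplices :: "nat \<Rightarrow> (nat \<times> nat, 'u) diagram set" where
  "span_simplices n = {F \<in> fin_functors (Ivl n) ivl_le.
     \<forall>I\<in>Ivl n. \<forall>J\<in>Ivl n. ivl_meet I J \<longrightarrow>
       fin_pullback (fst F (ivl_union I J)) (fst F I) (fst F J)
         (snd F (ivl_union I J) I) (snd F (ivl_union I J) J)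
         (snd F I (ivl_inter I J)) (snd F J (ivl_inter I J))}"

definition Span :: "(nat \<times> nat, 'u::infinite) diagram sset" where
  "Span = \<lparr> simplices = span_simplices,
            act = (\<lambda>m n \<alpha>. precompose (Ivl m) ivl_le (\<lambda>(i, j). (\<alpha> i, \<alpha> j))) \<rparr>"

text \<open>Since \<open>(i,\<dots>,j) \<mapsto> j\<close> is a monotone map from the intervals to \<open>[n]\<^sup>o\<^sup>p\<close>, the formula
  \<open>(i,\<dots>,j) \<mapsto> X\<^sub>j\<close> is a precomposition.\<close>

definition Rbar :: "nat \<Rightarrow> (nat, 'u::infinite) diagram \<Rightarrow> (nat \<times> nat, 'u) diagram" where
  "Rbar n = (\<lambda>X\<in>simplices Fin_op n. precompose (Ivl n) ivl_le snd X)"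

end

theory Submission
  imports Defs
begin

text \<open>
  Why the theorem holds. An \<open>n\<close>-simplex of \<open>Span\<close> has a set for every subinterval of \<open>[n]\<close>, and a
  smaller interval receives a map from every larger one. These maps are generated by the ones that
  shorten an interval on one side, and every condition that they have to satisfy - functoriality as
  well as the pullback condition - involves at most four vertices. So \<open>Span\<close> is 3-coskeletal: a
  simplex, or a map from a subcomplex of a simplex, is the same thing as a family of sets and maps
  such that each quadruple \<open>i \<le> j \<le> k \<le> l\<close> of vertices that span a face satisfies a condition
  \<open>span_quad\<close> (\<open>map_span_quad\<close>, \<open>extends_on_span_diagram\<close>). Hence all horns of dimension at least
  five have unique fillers. An inner horn of dimension two is filled by a pullback, which composes two
  spans. One of dimension three is filled because a map into a pullback is given by two maps. In
  dimension four only some equations are missing, and they can be checked after projection to the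
  pullbacks of adjacent intervals (\<open>inner_horn_extensible\<close>).

  Essential surjectivity is clear because \<open>Rbar\<close> is the identity on vertices. The main point is the
  preservation of finite products. A cone is a limit if a slice of a slice is an acyclic Kan fibration,
  and this is unravelled for discrete diagrams in an arbitrary simplicial set. Maps into a slice over
  \<open>p : K \<rightarrow> X\<close> are maps out of a join with \<open>K\<close> (\<open>curry_join_smap\<close>, \<open>uncurry_join_smap\<close>), and if \<open>K\<close>
  is discrete then the join of \<open>K\<close> with a subcomplex of the \<open>n\<close>-simplex is a union of subcomplexes of
  \<open>(n+1)\<close>-simplices, one for each vertex of \<open>K\<close>. The outcome is \<open>limit_coneI\<close> and \<open>limit_coneD\<close>: a cone over
  a family of objects with index set \<open>I\<close> is a product cone if and only if for all \<open>m \<ge> 1\<close>, given a map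
  on the boundary of the \<open>m\<close>-simplex whose last vertex is the apex and, for each \<open>i \<in> I\<close>, an extension
  of it to the last horn of the \<open>(m+1)\<close>-simplex whose last edge is the projection, there are a filler
  of the boundary and fillers of the horns which all restrict to it.

  In \<open>Fin_op\<close>, the cases \<open>m = 1\<close> and \<open>m = 2\<close> of this criterion are the existence and the uniqueness of
  the map to a product of \<open>Fin\<^sup>o\<^sup>p\<close>, and they imply that the given maps \<open>X\<^sub>i \<rightarrow> P\<close> of finite sets
  exhibit \<open>P\<close> as the disjoint union of the \<open>X\<^sub>i\<close> (\<open>product_cone_Fin_op\<close>). Conversely, assume this. The
  projections in \<open>Span\<close> are the spans \<open>P \<leftarrow> X\<^sub>i = X\<^sub>i\<close>, so composing a span \<open>A \<leftarrow> Z \<rightarrow> P\<close> with them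
  decomposes \<open>Z\<close> into the parts \<open>Z\<^sub>i\<close> over \<open>X\<^sub>i\<close>. As disjoint unions are stable under pullback
  (\<open>span_cone_cover\<close>), every set of the missing face that belongs to an interval ending at \<open>P\<close> is
  the disjoint union of sets of the given horns. So the missing sets (\<open>m = 1\<close>), maps (\<open>m = 2\<close>) and
  equations between maps (\<open>m = 3\<close>) are obtained on each part separately, and for \<open>m \<ge> 4\<close> there is
  nothing to do by coskeletality (\<open>span_cone_fill\<close>).
\<close>

section \<open>Simplicial sets and subcomplexes of simplices\<close>

lemma smapI:
  assumes "\<And>n x. x \<in> simplices X n \<Longrightarrow> f n x \<in> simplices Y n"
    and "\<And>n. f n \<in> extensional (simplices X n)"
    and "\<And>m n \<alpha> x. \<alpha> \<in> Delta m n \<Longrightarrow> x \<in> simplices X n \<Longrightarrow>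
           f m (act X m n \<alpha> x) = act Y m n \<alpha> (f n x)"
  shows "f \<in> smap X Y"
  using assms by (auto simp: smap_def PiE_def)

lemma smap_simplices: "f \<in> smap X Y \<Longrightarrow> x \<in> simplices X n \<Longrightarrow> f n x \<in> simplices Y n"
  and smap_extensional: "f \<in> smap X Y \<Longrightarrow> f n \<in> extensional (simplices X n)"
  and smap_natural: "f \<in> smap X Y \<Longrightarrow> \<alpha> \<in> Delta m n \<Longrightarrow> x \<in> simplices X n \<Longrightarrow>
           f m (act X m n \<alpha> x) = act Y m n \<alpha> (f n x)"
  by (auto simp: smap_def PiE_def)

lemma smap_eqI:
  assumes "f \<in> smap X Y" "g \<in> smap X Z" "\<And>n x. x \<in> simplices X n \<Longrightarrow> f n x = g n x"
  shows "f = g"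
proof
  fix n show "f n = g n"
    using smap_extensional[OF assms(1)] smap_extensional[OF assms(2)] assms(3)
    by (rule extensionalityI)
qed

lemma simplicial_set_simplices:
    "simplicial_set X \<Longrightarrow> \<alpha> \<in> Delta m n \<Longrightarrow> x \<in> simplices X n \<Longrightarrow> act X m n \<alpha> x \<in> simplices X m"
  and simplicial_set_id:
    "simplicial_set X \<Longrightarrow> x \<in> simplices X n \<Longrightarrow> act X n n (\<lambda>i\<in>{..n}. i) x = x"
  and simplicial_set_comp:
    "simplicial_set X \<Longrightarrow> \<beta> \<in> Delta k m \<Longrightarrow> \<alpha> \<in> Delta m n \<Longrightarrow> x \<in> simplices X n \<Longrightarrow>
       act X k m \<beta> (act X m n \<alpha> x) = act X k n (compose {..k} \<alpha> \<beta>) x"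
  unfolding simplicial_set_def by simp_all

lemma DeltaI:
  assumes "\<And>t. t \<le> m \<Longrightarrow> \<alpha> t \<le> n" "\<And>s t. s \<le> t \<Longrightarrow> t \<le> m \<Longrightarrow> \<alpha> s \<le> \<alpha> t"
    and "\<alpha> \<in> extensional {..m}"
  shows "\<alpha> \<in> Delta m n"
  using assms by (auto simp: Delta_def PiE_def intro!: mono_onI)

lemma Delta_le: "\<alpha> \<in> Delta m n \<Longrightarrow> t \<le> m \<Longrightarrow> \<alpha> t \<le> n"
  and Delta_mono: "\<alpha> \<in> Delta m n \<Longrightarrow> s \<le> t \<Longrightarrow> t \<le> m \<Longrightarrow> \<alpha> s \<le> \<alpha> t"
  and Delta_extensional: "\<alpha> \<in> Delta m n \<Longrightarrow> \<alpha> \<in> extensional {..m}"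
  by (auto simp: Delta_def mono_on_def PiE_def)

lemma Delta_eqI:
  assumes "\<alpha> \<in> extensional {..m}" "\<beta> \<in> extensional {..m}" "\<And>t. t \<le> m \<Longrightarrow> \<alpha> t = \<beta> t"
  shows "\<alpha> = (\<beta> :: nat \<Rightarrow> nat)"
  using assms by (intro extensionalityI) auto

lemma Delta_id [simp]: "(\<lambda>i\<in>{..n}. i) \<in> Delta n n"
  by (rule DeltaI) auto

lemma Delta_const [simp]: "c \<le> n \<Longrightarrow> (\<lambda>i\<in>{..m}. c) \<in> Delta m n"
  by (rule DeltaI) auto

lemma Delta_compose:
  "\<beta> \<in> Delta k m \<Longrightarrow> \<alpha> \<in> Delta m n \<Longrightarrow> compose {..k} \<alpha> \<beta> \<in> Delta k n"
  by (rule DeltaI) (auto simp: compose_eq intro: Delta_le Delta_mono)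

lemma Delta_cod_mono: "\<alpha> \<in> Delta m n \<Longrightarrow> n \<le> n' \<Longrightarrow> \<alpha> \<in> Delta m n'"
  using order_trans by (auto simp: Delta_def)

lemma Delta_cod_restrict: "\<alpha> \<in> Delta m n' \<Longrightarrow> (\<And>t. t \<le> m \<Longrightarrow> \<alpha> t \<le> n) \<Longrightarrow> \<alpha> \<in> Delta m n"
  by (auto simp: Delta_def)

lemma Delta_restrict: "\<alpha> \<in> Delta m n \<Longrightarrow> (\<And>t. t \<le> p \<Longrightarrow> \<alpha> t \<le> i) \<Longrightarrow> p \<le> m \<Longrightarrow>
    restrict \<alpha> {..p} \<in> Delta p i"
  by (rule DeltaI) (auto intro: Delta_mono)

lemma compose_id_right: "\<alpha> \<in> Delta m n \<Longrightarrow> compose {..m} \<alpha> (\<lambda>i\<in>{..m}. i) = \<alpha>"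
  and compose_id_left: "\<alpha> \<in> Delta m n \<Longrightarrow> compose {..m} (\<lambda>i\<in>{..n}. i) \<alpha> = \<alpha>"
  by (rule Delta_eqI, auto simp: compose_def Delta_extensional Delta_le)+

lemma compose_Delta_assoc:
  "\<gamma> \<in> Delta j k \<Longrightarrow> compose {..j} (compose {..k} \<alpha> \<beta>) \<gamma> = compose {..j} \<alpha> (compose {..j} \<beta> \<gamma>)"
  by (auto simp: compose_def fun_eq_iff Delta_le)

lemma Delta_0_eq: "\<alpha> \<in> Delta k 0 \<Longrightarrow> \<alpha> = (\<lambda>i\<in>{..k}. 0)"
  by (rule Delta_eqI) (auto dest: Delta_le Delta_extensional)

text \<open>Horns, boundaries and simplices are treated at once as subcomplexes of a simplex that are given by a
  family of vertex sets.\<close>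

definition sub_simplex :: "nat \<Rightarrow> nat set set \<Rightarrow> (nat \<Rightarrow> nat) sset" where
  "sub_simplex n S = \<lparr> simplices = (\<lambda>m. {\<beta> \<in> Delta m n. \<beta> ` {..m} \<in> S}), act = act (simplex n) \<rparr>"

lemma horn_sub_simplex: "horn n k = sub_simplex n {V. \<not> {..n} - {k} \<subseteq> V}"
  and boundary_sub_simplex: "boundary n = sub_simplex n {V. \<not> {..n} \<subseteq> V}"
  and simplex_sub_simplex: "simplex n = sub_simplex n UNIV"
  by (auto simp: horn_def boundary_def sub_simplex_def simplex_def Delta_le)

definition sieve :: "nat set set \<Rightarrow> bool" where
  "sieve S \<longleftrightarrow> {} \<in> S \<and> (\<forall>V\<in>S. \<forall>W. W \<subseteq> V \<longrightarrow> W \<in> S)"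

lemma sieveD: "sieve S \<Longrightarrow> V \<in> S \<Longrightarrow> W \<subseteq> V \<Longrightarrow> W \<in> S"
  and sieve_empty: "sieve S \<Longrightarrow> {} \<in> S"
  by (auto simp: sieve_def)

lemma act_simplex [simp]: "act (simplex n) k m \<alpha> \<beta> = compose {..k} \<beta> \<alpha>"
  and act_horn [simp]: "act (horn n j) k m \<alpha> \<beta> = compose {..k} \<beta> \<alpha>"
  and act_boundary [simp]: "act (boundary n) k m \<alpha> \<beta> = compose {..k} \<beta> \<alpha>"
  and act_sub_simplex [simp]: "act (sub_simplex n S) k m \<alpha> \<beta> = compose {..k} \<beta> \<alpha>"
  and simplices_simplex [simp]: "simplices (simplex n) m = Delta m n"
  by (auto simp: simplex_def horn_def boundary_def sub_simplex_def)

lemma simplices_sub_simplex: "\<beta> \<in> simplices (sub_simplex n S) m \<longleftrightarrow> \<beta> \<in> Delta m n \<and> \<beta> ` {..m} \<in> S"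
  by (auto simp: sub_simplex_def)

lemma simplices_boundary: "\<beta> \<in> simplices (boundary n) m \<longleftrightarrow> \<beta> \<in> Delta m n \<and> \<beta> ` {..m} \<noteq> {..n}"
  by (auto simp: boundary_def)

lemma simplices_horn: "\<beta> \<in> simplices (horn n k) m \<longleftrightarrow> \<beta> \<in> Delta m n \<and> \<not> {..n} - {k} \<subseteq> \<beta> ` {..m}"
  by (auto simp: horn_def)

lemma simplicial_set_sub_simplex:
  assumes "sieve S" shows "simplicial_set (sub_simplex n S)"
proof -
  have "compose {..m} x \<alpha> ` {..m} \<in> S"
    if "\<alpha> \<in> Delta m k" "x ` {..k} \<in> S" for m k \<alpha> x
    by (rule sieveD[OF assms that(2)]) (use that(1) in \<open>auto simp: compose_def Delta_le\<close>)
  then show ?thesis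
    by (auto simp: simplicial_set_def simplices_sub_simplex Delta_compose compose_id_right
        compose_Delta_assoc)
qed

lemma sieve_UNIV [simp]: "sieve UNIV"
  and sieve_boundary [simp]: "sieve {V. \<not> {..n} \<subseteq> V}"
  and sieve_horn: "0 < n \<Longrightarrow> sieve {V. \<not> {..n} - {k} \<subseteq> V}"
  by (auto simp: sieve_def subset_eq)

definition yoneda_map :: "'a sset \<Rightarrow> nat \<Rightarrow> 'a \<Rightarrow> nat \<Rightarrow> (nat \<Rightarrow> nat) \<Rightarrow> 'a" where
  "yoneda_map X n y = (\<lambda>m. \<lambda>\<beta>\<in>Delta m n. act X m n \<beta> y)"

lemma yoneda_map_smap:
  "simplicial_set X \<Longrightarrow> y \<in> simplices X n \<Longrightarrow> yoneda_map X n y \<in> smap (simplex n) X"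
  by (rule smapI) (auto simp: yoneda_map_def simplicial_set_simplices simplicial_set_comp Delta_compose)

lemma yoneda_map_apply: "\<beta> \<in> Delta m n \<Longrightarrow> yoneda_map X n y m \<beta> = act X m n \<beta> y"
  by (simp add: yoneda_map_def)

lemma smap_restrict:
  assumes "simplicial_set A" "f \<in> smap B X" "\<And>m. simplices A m \<subseteq> simplices B m"
    and "\<And>k m \<alpha> x. act A k m \<alpha> x = act B k m \<alpha> x"
  shows "(\<lambda>m. restrict (f m) (simplices A m)) \<in> smap A X"
proof (rule smapI)
  fix m n \<alpha> x assume *: "\<alpha> \<in> Delta m n" "x \<in> simplices A n"
  then have "act A m n \<alpha> x \<in> simplices A m" by (simp add: simplicial_set_simplices assms(1))
  moreover have "x \<in> simplices B n" using * assms(3) by blast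
  ultimately show "restrict (f m) (simplices A m) (act A m n \<alpha> x)
      = act X m n \<alpha> (restrict (f n) (simplices A n) x)"
    using * smap_natural[OF assms(2) *(1)] by (simp add: assms(4))
qed (use assms(3) smap_simplices[OF assms(2)] in auto)


section \<open>Joins\<close>

text \<open>A monotone map into \<open>[n] = [i] \<star> [j]\<close> has all its values in the second block, or all in the
  first, or it is itself a join of two monotone maps.\<close>

lemma Delta_cut_cases:
  fixes i :: nat
  assumes "\<alpha> \<in> Delta m n"
  obtains (right) "\<And>t. t \<le> m \<Longrightarrow> i < \<alpha> t" | (left) "\<And>t. t \<le> m \<Longrightarrow> \<alpha> t \<le> i"
    | (mid) p q where "m = Suc (p + q)" "\<And>t. t \<le> p \<Longrightarrow> \<alpha> t \<le> i" "\<And>t. p < t \<Longrightarrow> t \<le> m \<Longrightarrow> i < \<alpha> t"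
proof (cases "i < \<alpha> 0 \<or> \<alpha> m \<le> i")
  case True
  then show ?thesis
    by (metis Delta_mono[OF assms] right left le_trans less_le_trans order_refl zero_le)
next
  case False
  define p where "p = (GREATEST t. t \<le> m \<and> \<alpha> t \<le> i)"
  have p: "p \<le> m \<and> \<alpha> p \<le> i"
    unfolding p_def by (rule GreatestI_nat[of _ 0 m]) (use False in auto)
  have gt: "i < \<alpha> t" if "p < t" "t \<le> m" for t
    by (metis (mono_tags, lifting) Greatest_le_nat[of "\<lambda>t. t \<le> m \<and> \<alpha> t \<le> i" t m] leD linorder_not_less p_def that)
  have "p < m" using p False by (metis le_neq_implies_less)
  show ?thesis
  proof (rule mid[of p "m - Suc p"])
    show "m = Suc (p + (m - Suc p))" using \<open>p < m\<close> by simp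
    show "\<alpha> t \<le> i" if "t \<le> p" for t
      using Delta_mono[OF assms that] p by (meson le_trans)
  qed (use gt in auto)
qed

lemma join_act_InL [simp]: "join_act A B m n \<alpha> (InL a) = InL (act A m n \<alpha> a)"
  and join_act_InR [simp]: "join_act A B m n \<alpha> (InR b) = InR (act B m n \<alpha> b)"
  by (auto simp: join_act_def)

lemma join_act_Mid_right:
  assumes "\<And>t. t \<le> m \<Longrightarrow> i < \<alpha> t"
  shows "join_act A B m n \<alpha> (Mid i j a b) = InR (act B m j (\<lambda>t\<in>{..m}. \<alpha> t - Suc i) b)"
proof -
  have "{t \<in> {..m}. \<alpha> t \<le> i} = {}" using assms by fastforce
  then show ?thesis by (simp add: join_act_def)
qed

lemma join_act_Mid_left:
  assumes "\<And>t. t \<le> m \<Longrightarrow> \<alpha> t \<le> i"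
  shows "join_act A B m n \<alpha> (Mid i j a b) = InL (act A m i \<alpha> a)"
proof -
  have "{t \<in> {..m}. \<alpha> t \<le> i} = {..m}" using assms by auto
  then show ?thesis by (simp add: join_act_def)
qed

lemma join_act_Mid_mid:
  assumes "m = Suc (p + q)" "\<And>t. t \<le> p \<Longrightarrow> \<alpha> t \<le> i" "\<And>t. p < t \<Longrightarrow> t \<le> m \<Longrightarrow> i < \<alpha> t"
  shows "join_act A B m n \<alpha> (Mid i j a b) =
    Mid p q (act A p i (restrict \<alpha> {..p}) a) (act B q j (\<lambda>t\<in>{..q}. \<alpha> (Suc (t + p)) - Suc i) b)"
proof -
  have "{t \<in> {..m}. \<alpha> t \<le> i} = {..p}"
    using assms by (auto simp: not_le[symmetric])
  then show ?thesis using assms(1) by (simp add: join_act_def Let_def)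
qed

lemma simplices_join:
  "z \<in> simplices (join A B) n \<longleftrightarrow> (case z of InL a \<Rightarrow> a \<in> simplices A n | InR b \<Rightarrow> b \<in> simplices B n
     | Mid i j a b \<Rightarrow> n = Suc (i + j) \<and> a \<in> simplices A i \<and> b \<in> simplices B j)"
  by (auto simp: join_def split: join_simplex.splits)

lemma simplices_join_simps [simp]:
  "InL a \<in> simplices (join A B) n \<longleftrightarrow> a \<in> simplices A n"
  "InR b \<in> simplices (join A B) n \<longleftrightarrow> b \<in> simplices B n"
  "Mid i j a b \<in> simplices (join A B) n \<longleftrightarrow>
     n = Suc (i + j) \<and> a \<in> simplices A i \<and> b \<in> simplices B j"
  by (simp_all add: simplices_join)

lemma act_join [simp]: "act (join A B) = join_act A B"
  by (simp add: join_def)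

lemma Delta_cut_right:
  assumes "\<alpha> \<in> Delta m (Suc (i + j))" "\<And>t. t \<le> m \<Longrightarrow> i < \<alpha> t"
  shows "(\<lambda>t\<in>{..m}. \<alpha> t - Suc i) \<in> Delta m j"
proof (rule DeltaI)
  fix t assume "t \<le> m"
  then show "(\<lambda>t\<in>{..m}. \<alpha> t - Suc i) t \<le> j" using Delta_le[OF assms(1), of t] by auto
next
  fix s t assume "s \<le> t" "t \<le> m"
  then show "(\<lambda>t\<in>{..m}. \<alpha> t - Suc i) s \<le> (\<lambda>t\<in>{..m}. \<alpha> t - Suc i) t"
    using Delta_mono[OF assms(1), of s t] by auto
qed auto

lemma Delta_cut_left:
  assumes "\<alpha> \<in> Delta m n" "\<And>t. t \<le> m \<Longrightarrow> \<alpha> t \<le> i"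
  shows "\<alpha> \<in> Delta m i"
  using assms by (rule Delta_cod_restrict)

lemma Delta_cut_mid:
  assumes "\<alpha> \<in> Delta m (Suc (i + j))"
    and "m = Suc (p + q)" "\<And>t. t \<le> p \<Longrightarrow> \<alpha> t \<le> i" "\<And>t. p < t \<Longrightarrow> t \<le> m \<Longrightarrow> i < \<alpha> t"
  shows "restrict \<alpha> {..p} \<in> Delta p i" "(\<lambda>t\<in>{..q}. \<alpha> (Suc (t + p)) - Suc i) \<in> Delta q j"
proof -
  show "restrict \<alpha> {..p} \<in> Delta p i"
    using assms by (intro Delta_restrict[OF assms(1)]) auto
  show "(\<lambda>t\<in>{..q}. \<alpha> (Suc (t + p)) - Suc i) \<in> Delta q j"
  proof (rule DeltaI)
    fix t assume "t \<le> q"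
    then show "(\<lambda>t\<in>{..q}. \<alpha> (Suc (t + p)) - Suc i) t \<le> j"
      using Delta_le[OF assms(1), of "Suc (t + p)"] assms(2) by auto
  next
    fix s t assume "s \<le> t" "t \<le> q"
    then show "(\<lambda>t\<in>{..q}. \<alpha> (Suc (t + p)) - Suc i) s \<le> (\<lambda>t\<in>{..q}. \<alpha> (Suc (t + p)) - Suc i) t"
      using Delta_mono[OF assms(1), of "Suc (s + p)" "Suc (t + p)"] assms(2) by auto
  qed auto
qed

lemma join_act_simplices:
  assumes A: "simplicial_set A" and B: "simplicial_set B"
    and \<alpha>: "\<alpha> \<in> Delta m n" and z: "z \<in> simplices (join A B) n"
  shows "join_act A B m n \<alpha> z \<in> simplices (join A B) m"
proof (cases z)
  case (Mid i j a b)
  then have n: "n = Suc (i + j)" and ab: "a \<in> simplices A i" "b \<in> simplices B j" using z by auto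
  have \<alpha>': "\<alpha> \<in> Delta m (Suc (i + j))" using \<alpha> n by simp
  show ?thesis
  proof (cases rule: Delta_cut_cases[OF \<alpha>, where i = i, case_names right left mid])
    case right
    show ?thesis using Delta_cut_right[OF \<alpha>' right] ab
      by (simp add: Mid join_act_Mid_right[OF right] simplicial_set_simplices B)
  next
    case left
    show ?thesis using Delta_cut_left[OF \<alpha> left] ab
      by (simp add: Mid join_act_Mid_left[OF left] simplicial_set_simplices A)
  next
    case (mid p q)
    have "Mid p q (act A p i (restrict \<alpha> {..p}) a) (act B q j (\<lambda>t\<in>{..q}. \<alpha> (Suc (t + p)) - Suc i) b)
        \<in> simplices (join A B) m"
      using Delta_cut_mid[OF \<alpha>' mid] ab mid(1) by (simp add: simplicial_set_simplices A B)
    then show ?thesis by (simp only: Mid join_act_Mid_mid[OF mid])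
  qed
qed (use z \<alpha> in \<open>auto simp: simplicial_set_simplices A B\<close>)

lemma join_act_id:
  assumes A: "simplicial_set A" and B: "simplicial_set B" and z: "z \<in> simplices (join A B) n"
  shows "join_act A B n n (\<lambda>i\<in>{..n}. i) z = z"
proof (cases z)
  case (Mid i j a b)
  then have n: "n = Suc (i + j)" and ab: "a \<in> simplices A i" "b \<in> simplices B j" using z by auto
  have "join_act A B n n (\<lambda>i\<in>{..n}. i) (Mid i j a b)
      = Mid i j (act A i i (\<lambda>i\<in>{..i}. i) a) (act B j j (\<lambda>i\<in>{..j}. i) b)"
    using n by (subst join_act_Mid_mid[of n i j])
      (auto simp: restrict_def fun_eq_iff intro!: arg_cong2[where f = "act A i i"] arg_cong2[where f = "act B j j"])
  then show ?thesis
    using ab by (simp add: Mid simplicial_set_id A B)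
qed (use z in \<open>auto simp: simplicial_set_id A B\<close>)

text \<open>Cutting is compatible with composition: if \<open>\<alpha>\<close> is cut at \<open>i\<close> into pieces of sizes \<open>p\<close> and \<open>q\<close>, then
  \<open>\<alpha> \<circ> \<beta>\<close> is cut at \<open>i\<close> where \<open>\<beta>\<close> is cut at \<open>p\<close>, and its pieces are the composites of the pieces.\<close>

lemma join_act_compose:
  assumes A: "simplicial_set A" and B: "simplicial_set B"
    and \<beta>: "\<beta> \<in> Delta k m" and \<alpha>: "\<alpha> \<in> Delta m n" and z: "z \<in> simplices (join A B) n"
  shows "join_act A B k n (compose {..k} \<alpha> \<beta>) z = join_act A B k m \<beta> (join_act A B m n \<alpha> z)"
proof (cases z)
  case (Mid i j a b)
  then have n: "n = Suc (i + j)" and ab: "a \<in> simplices A i" "b \<in> simplices B j" using z by auto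
  have \<alpha>': "\<alpha> \<in> Delta m (Suc (i + j))" using \<alpha> n by simp
  have \<beta>m: "t \<le> k \<Longrightarrow> \<beta> t \<le> m" for t using Delta_le[OF \<beta>] .
  show ?thesis
  proof (cases rule: Delta_cut_cases[OF \<alpha>, where i = i, case_names right left mid])
    case right
    have r: "\<And>t. t \<le> k \<Longrightarrow> i < compose {..k} \<alpha> \<beta> t" by (simp add: compose_eq right \<beta>m)
    have e: "compose {..k} (\<lambda>t\<in>{..m}. \<alpha> t - Suc i) \<beta> = (\<lambda>t\<in>{..k}. compose {..k} \<alpha> \<beta> t - Suc i)"
      by (auto simp: compose_def fun_eq_iff \<beta>m)
    show ?thesis using Delta_cut_right[OF \<alpha>' right] ab
      by (simp add: Mid join_act_Mid_right[OF right] join_act_Mid_right[OF r]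
          simplicial_set_comp[OF B \<beta>] e)
  next
    case left
    have r: "\<And>t. t \<le> k \<Longrightarrow> compose {..k} \<alpha> \<beta> t \<le> i" by (simp add: compose_eq left \<beta>m)
    show ?thesis using Delta_cut_left[OF \<alpha> left] ab
      by (simp add: Mid join_act_Mid_left[OF left] join_act_Mid_left[OF r]
          simplicial_set_comp[OF A \<beta>])
  next
    case (mid p q)
    note pq = Delta_cut_mid[OF \<alpha>' mid]
    have \<beta>': "\<beta> \<in> Delta k (Suc (p + q))" using \<beta> mid(1) by simp
    show ?thesis
    proof (cases rule: Delta_cut_cases[OF \<beta>, where i = p, case_names right left mid])
      case right
      have r: "\<And>t. t \<le> k \<Longrightarrow> i < compose {..k} \<alpha> \<beta> t" by (simp add: compose_eq right \<beta>m mid(3))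
      have e: "compose {..k} (\<lambda>t\<in>{..q}. \<alpha> (Suc (t + p)) - Suc i) (\<lambda>t\<in>{..k}. \<beta> t - Suc p)
          = (\<lambda>t\<in>{..k}. compose {..k} \<alpha> \<beta> t - Suc i)"
      proof
        fix t show "compose {..k} (\<lambda>t\<in>{..q}. \<alpha> (Suc (t + p)) - Suc i) (\<lambda>t\<in>{..k}. \<beta> t - Suc p) t
          = (\<lambda>t\<in>{..k}. compose {..k} \<alpha> \<beta> t - Suc i) t"
          using right[of t] \<beta>m[of t] mid(1) by (auto simp: compose_def)
      qed
      show ?thesis using Delta_cut_right[OF \<beta>' right] ab pq
        by (simp add: Mid join_act_Mid_mid[OF mid] join_act_Mid_right[OF right] join_act_Mid_right[OF r]
            simplicial_set_comp[OF B] e)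
    next
      case left
      have r: "\<And>t. t \<le> k \<Longrightarrow> compose {..k} \<alpha> \<beta> t \<le> i" by (simp add: compose_eq left \<beta>m mid(2))
      have e: "compose {..k} (restrict \<alpha> {..p}) \<beta> = compose {..k} \<alpha> \<beta>"
        using left by (auto simp: compose_def fun_eq_iff)
      show ?thesis using Delta_cut_left[OF \<beta> left] ab pq
        by (simp add: Mid join_act_Mid_mid[OF mid] join_act_Mid_left[OF left] join_act_Mid_left[OF r]
            simplicial_set_comp[OF A] e)
    next
      case mid2: (mid p' q')
      have r: "k = Suc (p' + q')" "\<And>t. t \<le> p' \<Longrightarrow> compose {..k} \<alpha> \<beta> t \<le> i"
        "\<And>t. p' < t \<Longrightarrow> t \<le> k \<Longrightarrow> i < compose {..k} \<alpha> \<beta> t"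
        using mid2 mid(2,3) \<beta>m by (auto simp: compose_def)
      have e1: "compose {..p'} (restrict \<alpha> {..p}) (restrict \<beta> {..p'}) = restrict (compose {..k} \<alpha> \<beta>) {..p'}"
        using mid2 by (auto simp: compose_def fun_eq_iff)
      have e2: "compose {..q'} (\<lambda>t\<in>{..q}. \<alpha> (Suc (t + p)) - Suc i) (\<lambda>t\<in>{..q'}. \<beta> (Suc (t + p')) - Suc p)
        = (\<lambda>t\<in>{..q'}. compose {..k} \<alpha> \<beta> (Suc (t + p')) - Suc i)"
      proof
        fix t show "compose {..q'} (\<lambda>t\<in>{..q}. \<alpha> (Suc (t + p)) - Suc i) (\<lambda>t\<in>{..q'}. \<beta> (Suc (t + p')) - Suc p) t
          = (\<lambda>t\<in>{..q'}. compose {..k} \<alpha> \<beta> (Suc (t + p')) - Suc i) t"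
          using mid2(3)[of "Suc (t + p')"] \<beta>m[of "Suc (t + p')"] mid(1) mid2(1) by (auto simp: compose_def)
      qed
      show ?thesis using Delta_cut_mid[OF \<beta>' mid2] ab pq
        by (simp add: Mid join_act_Mid_mid[OF mid] join_act_Mid_mid[OF mid2] join_act_Mid_mid[OF r]
            simplicial_set_comp[OF A] simplicial_set_comp[OF B] e1 e2)
    qed
  qed
qed (use z \<alpha> \<beta> in \<open>auto simp: simplicial_set_comp A B\<close>)

lemma simplicial_set_join: "simplicial_set A \<Longrightarrow> simplicial_set B \<Longrightarrow> simplicial_set (join A B)"
  unfolding simplicial_set_def[of "join A B"]
  by (auto simp: join_act_simplices join_act_id join_act_compose)

section \<open>Slices and joins\<close>

lemma simplicial_set_simplex [simp]: "simplicial_set (simplex n)"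
  by (simp add: simplex_sub_simplex simplicial_set_sub_simplex)

lemma simplicial_set_boundary [simp]: "simplicial_set (boundary n)"
  by (simp add: boundary_sub_simplex simplicial_set_sub_simplex)

definition join_map :: "(nat \<Rightarrow> 'a \<Rightarrow> 'b) \<Rightarrow> nat \<Rightarrow> ('a, 'k) join_simplex \<Rightarrow> ('b, 'k) join_simplex" where
  "join_map f k z = (case z of InL a \<Rightarrow> InL (f k a) | InR x \<Rightarrow> InR x | Mid i j a x \<Rightarrow> Mid i j (f i a) x)"

lemma join_map_simps [simp]:
  "join_map f k (InL a) = InL (f k a)"
  "join_map f k (InR x) = InR x"
  "join_map f k (Mid i j a x) = Mid i j (f i a) x"
  by (simp_all add: join_map_def)

lemma join_simplex_map_eq: "join_simplex_map \<alpha> = join_map (\<lambda>i. compose {..i} \<alpha>)"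
  by (auto simp: join_simplex_map_def join_map_def fun_eq_iff split: join_simplex.split)

lemma join_map_simplices:
  assumes "\<And>k a. a \<in> simplices A k \<Longrightarrow> f k a \<in> simplices B k" "z \<in> simplices (join A K) k"
  shows "join_map f k z \<in> simplices (join B K) k"
  using assms by (cases z) auto

lemma join_map_natural:
  assumes "\<And>m n \<alpha> a. \<alpha> \<in> Delta m n \<Longrightarrow> a \<in> simplices A n \<Longrightarrow> f m (act A m n \<alpha> a) = act B m n \<alpha> (f n a)"
    and \<alpha>: "\<alpha> \<in> Delta m n" and z: "z \<in> simplices (join A K) n"
  shows "join_map f m (join_act A K m n \<alpha> z) = join_act B K m n \<alpha> (join_map f n z)"
proof (cases z)
  case (Mid i j a b)
  then have n: "n = Suc (i + j)" and ab: "a \<in> simplices A i" using z by auto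
  have \<alpha>': "\<alpha> \<in> Delta m (Suc (i + j))" using \<alpha> n by simp
  show ?thesis
  proof (cases rule: Delta_cut_cases[OF \<alpha>, where i = i, case_names right left mid])
    case right
    show ?thesis by (simp add: Mid join_act_Mid_right[OF right])
  next
    case left
    show ?thesis using Delta_cut_left[OF \<alpha> left] ab
      by (simp add: Mid join_act_Mid_left[OF left] assms(1))
  next
    case (mid p q)
    show ?thesis using Delta_cut_mid[OF \<alpha>' mid] ab
      by (simp add: Mid join_act_Mid_mid[OF mid] assms(1))
  qed
qed (use assms in auto)

lemma simplices_slice:
  "\<sigma> \<in> simplices (slice K X p) n \<longleftrightarrow>
     \<sigma> \<in> smap (join (simplex n) K) X \<and> (\<forall>m. \<forall>x\<in>simplices K m. \<sigma> m (InR x) = p m x)"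
  by (simp add: slice_def)

lemma act_slice:
  "act (slice K X p) m n \<alpha> \<sigma> =
     (\<lambda>k. \<lambda>z\<in>simplices (join (simplex m) K) k. \<sigma> k (join_map (\<lambda>i. compose {..i} \<alpha>) k z))"
  by (simp add: slice_def join_simplex_map_eq)

lemma join_map_act_simplices:
  assumes "simplicial_set A" "a \<in> simplices A m" "z \<in> simplices (join (simplex m) K) k"
  shows "join_map (\<lambda>i \<beta>. act A i m \<beta> a) k z \<in> simplices (join A K) k"
  by (rule join_map_simplices[OF _ assms(3)]) (simp add: assms simplicial_set_simplices)

lemma join_map_act_natural:
  assumes "simplicial_set A" "a \<in> simplices A m" "\<alpha> \<in> Delta k l" "z \<in> simplices (join (simplex m) K) l"
  shows "join_map (\<lambda>i \<beta>. act A i m \<beta> a) k (join_act (simplex m) K k l \<alpha> z)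
       = join_act A K k l \<alpha> (join_map (\<lambda>i \<beta>. act A i m \<beta> a) l z)"
  by (rule join_map_natural[OF _ assms(3,4)]) (simp add: assms simplicial_set_comp)

text \<open>The universal property of the slice: a map from \<open>A\<close> to the slice over \<open>p : K \<rightarrow> X\<close> is the same as a
  map from the join of \<open>A\<close> and \<open>K\<close> to \<open>X\<close> that restricts to \<open>p\<close> on \<open>K\<close>.\<close>

definition curry_join :: "'a sset \<Rightarrow> 'k sset \<Rightarrow> (nat \<Rightarrow> ('a, 'k) join_simplex \<Rightarrow> 'b)
    \<Rightarrow> nat \<Rightarrow> 'a \<Rightarrow> nat \<Rightarrow> (nat \<Rightarrow> nat, 'k) join_simplex \<Rightarrow> 'b" where
  "curry_join A K g = (\<lambda>m. \<lambda>a\<in>simplices A m. \<lambda>k. \<lambda>z\<in>simplices (join (simplex m) K) k.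
     g k (join_map (\<lambda>i \<beta>. act A i m \<beta> a) k z))"

definition uncurry_join :: "'a sset \<Rightarrow> 'k sset \<Rightarrow> (nat \<Rightarrow> 'k \<Rightarrow> 'b)
    \<Rightarrow> (nat \<Rightarrow> 'a \<Rightarrow> nat \<Rightarrow> (nat \<Rightarrow> nat, 'k) join_simplex \<Rightarrow> 'b)
    \<Rightarrow> nat \<Rightarrow> ('a, 'k) join_simplex \<Rightarrow> 'b" where
  "uncurry_join A K p u = (\<lambda>k. \<lambda>z\<in>simplices (join A K) k. case z of
       InL a \<Rightarrow> u k a k (InL (\<lambda>i\<in>{..k}. i))
     | InR x \<Rightarrow> p k x
     | Mid i j a x \<Rightarrow> u i a k (Mid i j (\<lambda>t\<in>{..i}. t) x))"

text \<open>A simplex of \<open>A\<close> is a map from a simplex to \<open>A\<close>; joining it with \<open>K\<close> and composing with \<open>g\<close> gives a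
  simplex of the slice.\<close>

lemma curry_join_slice:
  assumes A: "simplicial_set A" and K: "simplicial_set K"
    and g: "g \<in> smap (join A K) X" "\<And>m x. x \<in> simplices K m \<Longrightarrow> g m (InR x) = p m x"
    and a: "a \<in> simplices A m"
  shows "curry_join A K g m a \<in> simplices (slice K X p) m"
  unfolding simplices_slice
proof (intro conjI allI ballI)
  show "curry_join A K g m a \<in> smap (join (simplex m) K) X"
  proof (rule smapI)
    fix n z assume "z \<in> simplices (join (simplex m) K) n"
    then show "curry_join A K g m a n z \<in> simplices X n"
      by (simp add: curry_join_def a smap_simplices[OF g(1)] join_map_act_simplices A)
  next
    fix k l \<alpha> z assume *: "\<alpha> \<in> Delta k l" "z \<in> simplices (join (simplex m) K) l"
    have "simplicial_set (simplex m)" by (simp add: simplex_sub_simplex simplicial_set_sub_simplex)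
    then have "join_act (simplex m) K k l \<alpha> z \<in> simplices (join (simplex m) K) k"
      using * K by (simp add: join_act_simplices)
    then show "curry_join A K g m a k (act (join (simplex m) K) k l \<alpha> z) =
        act X k l \<alpha> (curry_join A K g m a l z)"
      using * smap_natural[OF g(1) *(1) join_map_act_simplices[OF A a *(2)]]
      by (simp add: curry_join_def a join_map_act_natural A)
  qed (simp add: curry_join_def a)
qed (simp add: curry_join_def a g(2))

lemma curry_join_smap:
  assumes A: "simplicial_set A" and K: "simplicial_set K"
    and g: "g \<in> smap (join A K) X" "\<And>m x. x \<in> simplices K m \<Longrightarrow> g m (InR x) = p m x"
  shows "curry_join A K g \<in> smap A (slice K X p)"
proof (rule smapI)
  fix m n \<alpha> a assume *: "\<alpha> \<in> Delta m n" "a \<in> simplices A n"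
  have "act A m n \<alpha> a \<in> simplices A m" using * A by (simp add: simplicial_set_simplices)
  moreover have "join_map (\<lambda>i \<beta>. act A i m \<beta> (act A m n \<alpha> a)) k z
      = join_map (\<lambda>i \<beta>. act A i n \<beta> a) k (join_map (\<lambda>i. compose {..i} \<alpha>) k z)"
    if "z \<in> simplices (join (simplex m) K) k" for k z
    using that * by (cases z) (auto simp: simplicial_set_comp[OF A])
  moreover have "join_map (\<lambda>i. compose {..i} \<alpha>) k z \<in> simplices (join (simplex n) K) k"
    if "z \<in> simplices (join (simplex m) K) k" for k z
    by (rule join_map_simplices[OF _ that]) (use * in \<open>auto intro: Delta_compose\<close>)
  ultimately show "curry_join A K g m (act A m n \<alpha> a) =
      act (slice K X p) m n \<alpha> (curry_join A K g n a)"
    by (auto simp: curry_join_def act_slice * fun_eq_iff)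
next
  show "curry_join A K g m a \<in> simplices (slice K X p) m" if "a \<in> simplices A m" for m a
    using assms that by (rule curry_join_slice)
qed (simp add: curry_join_def)

text \<open>A simplex of the slice is determined by its values at the simplices of the join that involve an
  identity, because all others are obtained from them by naturality.\<close>

lemma slice_map_apply:
  assumes u: "u \<in> smap A (slice K X p)" and a: "a \<in> simplices A m"
    and A: "simplicial_set A" and z: "z \<in> simplices (join (simplex m) K) k"
  shows "u m a k z = uncurry_join A K p u k (join_map (\<lambda>i \<beta>. act A i m \<beta> a) k z)"
proof -
  have J: "join_map (\<lambda>i \<beta>. act A i m \<beta> a) k z \<in> simplices (join A K) k"
    by (rule join_map_act_simplices[OF A a z])
  have S: "u m a \<in> simplices (slice K X p) m" by (rule smap_simplices[OF u a])
  show ?thesis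
  proof (cases z)
    case (InL \<beta>)
    then have "\<beta> \<in> Delta k m" using z by simp
    then show ?thesis using J smap_natural[OF u _ a, of \<beta> k]
      by (simp add: InL uncurry_join_def act_slice compose_id_right)
  next
    case (InR x)
    then show ?thesis using J S z by (simp add: uncurry_join_def simplices_slice)
  next
    case (Mid i j \<beta> x)
    then have "\<beta> \<in> Delta i m" "k = Suc (i + j)" "x \<in> simplices K j" using z by simp_all
    then show ?thesis using J smap_natural[OF u _ a, of \<beta> i]
      by (simp add: Mid uncurry_join_def act_slice compose_id_right)
  qed
qed

lemma uncurry_join_smap:
  assumes A: "simplicial_set A" and K: "simplicial_set K" and p: "p \<in> smap K X"
    and u: "u \<in> smap A (slice K X p)"
  shows "uncurry_join A K p u \<in> smap (join A K) X"
proof -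
  have S: "u m a \<in> smap (join (simplex m) K) X" if "a \<in> simplices A m" for m a
    using smap_simplices[OF u that] by (simp add: simplices_slice)
  \<comment> \<open>Every simplex of the join is the image of a simplex \<open>w\<close> of some \<open>join (simplex m) K\<close>, where
    naturality is known.\<close>
  have gen: "uncurry_join A K p u k z \<in> simplices X k \<and>
      uncurry_join A K p u l (join_act A K l k \<alpha> z) = act X l k \<alpha> (uncurry_join A K p u k z)"
    if "z = join_map (\<lambda>i \<beta>. act A i m \<beta> a) k w" "a \<in> simplices A m"
      "w \<in> simplices (join (simplex m) K) k" "\<alpha> \<in> Delta l k" for m a k w z l \<alpha>
  proof -
    have s: "simplicial_set (simplex m)" by (simp add: simplex_sub_simplex simplicial_set_sub_simplex)
    have w': "join_act (simplex m) K l k \<alpha> w \<in> simplices (join (simplex m) K) l"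
      using that s K by (simp add: join_act_simplices)
    have "uncurry_join A K p u k z = u m a k w"
      using slice_map_apply[OF u that(2) A that(3)] that(1) by simp
    moreover have "uncurry_join A K p u l (join_act A K l k \<alpha> z)
        = u m a l (join_act (simplex m) K l k \<alpha> w)"
      using slice_map_apply[OF u that(2) A w'] that
      by (simp add: join_map_act_natural[OF A that(2) that(4) that(3)])
    ultimately show ?thesis
      using smap_natural[OF S[OF that(2)] that(4,3)] smap_simplices[OF S[OF that(2)] that(3)] by simp
  qed
  have "uncurry_join A K p u k z \<in> simplices X k \<and>
      uncurry_join A K p u l (join_act A K l k \<alpha> z) = act X l k \<alpha> (uncurry_join A K p u k z)"
    if z: "z \<in> simplices (join A K) k" and \<alpha>: "\<alpha> \<in> Delta l k" for k z l \<alpha>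
  proof (cases z)
    case (InL a)
    show ?thesis
      by (rule gen[of z k a k "InL (\<lambda>i\<in>{..k}. i)"]) (use z \<alpha> in \<open>simp_all add: InL simplicial_set_id[OF A]\<close>)
  next
    case (InR x)
    then show ?thesis using z \<alpha> smap_simplices[OF p] smap_natural[OF p \<alpha>]
      by (simp add: uncurry_join_def simplicial_set_simplices[OF K])
  next
    case (Mid i j a x)
    show ?thesis
      by (rule gen[of z i a k "Mid i j (\<lambda>t\<in>{..i}. t) x"])
        (use z \<alpha> in \<open>simp_all add: Mid simplicial_set_id[OF A]\<close>)
  qed
  note main = this
  show ?thesis
  proof (rule smapI)
    show "uncurry_join A K p u k z \<in> simplices X k" if "z \<in> simplices (join A K) k" for k z
      using main[OF that Delta_id] ..
    show "uncurry_join A K p u l (act (join A K) l k \<alpha> z) = act X l k \<alpha> (uncurry_join A K p u k z)"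
      if "\<alpha> \<in> Delta l k" "z \<in> simplices (join A K) k" for k z l \<alpha>
      using main[OF that(2,1)] by simp
  qed (simp add: uncurry_join_def)
qed

lemma uncurry_join_InR:
  "x \<in> simplices K m \<Longrightarrow> uncurry_join A K p u m (InR x) = p m x"
  by (simp add: uncurry_join_def)

lemma uncurry_curry_join:
  assumes "simplicial_set A" "\<And>m x. x \<in> simplices K m \<Longrightarrow> g m (InR x) = p m x"
    "z \<in> simplices (join A K) k"
  shows "uncurry_join A K p (curry_join A K g) k z = g k z"
  using assms by (cases z) (simp_all add: uncurry_join_def curry_join_def simplicial_set_id)

lemma join_map_id:
  assumes "z \<in> simplices (join (simplex n) K) k"
  shows "join_map (\<lambda>i. compose {..i} (\<lambda>i\<in>{..n}. i)) k z = z"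
  using assms by (cases z) (auto simp: compose_id_left)

lemma simplicial_set_slice:
  assumes K: "simplicial_set K"
  shows "simplicial_set (slice K X p)"
  unfolding simplicial_set_def
proof (intro conjI allI ballI)
  fix m n \<alpha> \<sigma> assume *: "\<alpha> \<in> Delta m n" "\<sigma> \<in> simplices (slice K X p) n"
  have "act (slice K X p) m n \<alpha> \<sigma> = curry_join (simplex n) K \<sigma> m \<alpha>"
    by (simp add: act_slice curry_join_def *)
  moreover have "curry_join (simplex n) K \<sigma> m \<alpha> \<in> simplices (slice K X p) m"
    using * by (intro curry_join_slice K) (simp_all add: simplices_slice)
  ultimately show "act (slice K X p) m n \<alpha> \<sigma> \<in> simplices (slice K X p) m"
    by simp
next
  fix n \<sigma> assume *: "\<sigma> \<in> simplices (slice K X p) n"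
  show "act (slice K X p) n n (\<lambda>i\<in>{..n}. i) \<sigma> = \<sigma>"
  proof (intro ext)
    fix k z show "act (slice K X p) n n (\<lambda>i\<in>{..n}. i) \<sigma> k z = \<sigma> k z"
      using * smap_extensional[of \<sigma> _ X k]
      by (cases "z \<in> simplices (join (simplex n) K) k")
        (auto simp: act_slice simplices_slice join_map_id extensional_def)
  qed
next
  fix k m n \<beta> \<alpha> \<sigma> assume *: "\<beta> \<in> Delta k m" "\<alpha> \<in> Delta m n" "\<sigma> \<in> simplices (slice K X p) n"
  have "join_map (\<lambda>i. compose {..i} (compose {..k} \<alpha> \<beta>)) l z
      = join_map (\<lambda>i. compose {..i} \<alpha>) l (join_map (\<lambda>i. compose {..i} \<beta>) l z)"
    "join_map (\<lambda>i. compose {..i} \<beta>) l z \<in> simplices (join (simplex m) K) l"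
    if "z \<in> simplices (join (simplex k) K) l" for l z
    using that * by (cases z; auto simp: compose_Delta_assoc Delta_compose)+
  then show "act (slice K X p) k n (compose {..k} \<alpha> \<beta>) \<sigma> =
      act (slice K X p) k m \<beta> (act (slice K X p) m n \<alpha> \<sigma>)"
    by (auto simp: act_slice fun_eq_iff)
qed


section \<open>Joins with a discrete simplicial set\<close>

definition constant_at :: "'k sset \<Rightarrow> nat \<Rightarrow> 'k \<Rightarrow> 'k" where
  "constant_at K k v = act K k 0 (\<lambda>t\<in>{..k}. 0) v"

definition vertex_of :: "'k sset \<Rightarrow> nat \<Rightarrow> 'k \<Rightarrow> 'k" where
  "vertex_of K k x = act K 0 k (\<lambda>t\<in>{..0}. 0) x"

text \<open>This covers both \<open>discrete I\<close> and \<open>simplex 0\<close>, whose simplices have different types.\<close>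

definition constant_sset :: "'k sset \<Rightarrow> bool" where
  "constant_sset K \<longleftrightarrow> simplicial_set K \<and>
     (\<forall>k. \<forall>x\<in>simplices K k. constant_at K k (vertex_of K k x) = x)"

lemma constant_sset_simplicial_set: "constant_sset K \<Longrightarrow> simplicial_set K"
  by (simp add: constant_sset_def)

lemma constant_sset_discrete [simp]: "constant_sset (discrete I)"
  by (auto simp: constant_sset_def discrete_def simplicial_set_def constant_at_def vertex_of_def)

lemma constant_sset_simplex_0 [simp]: "constant_sset (simplex 0)"
  unfolding constant_sset_def constant_at_def vertex_of_def
  by (auto simp: compose_def dest!: Delta_0_eq)

lemma vertex_of_simplices:
  "simplicial_set K \<Longrightarrow> x \<in> simplices K k \<Longrightarrow> vertex_of K k x \<in> simplices K 0"
  unfolding vertex_of_def by (rule simplicial_set_simplices[OF _ Delta_const[OF le0]])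

lemma constant_at_simplices:
  "simplicial_set K \<Longrightarrow> v \<in> simplices K 0 \<Longrightarrow> constant_at K k v \<in> simplices K k"
  by (simp add: constant_at_def simplicial_set_simplices)

lemma act_constant_at:
  assumes "simplicial_set K" "v \<in> simplices K 0" "\<alpha> \<in> Delta m n"
  shows "act K m n \<alpha> (constant_at K n v) = constant_at K m v"
proof -
  have "compose {..m} (\<lambda>t\<in>{..n}. 0) \<alpha> = (\<lambda>t\<in>{..m}. 0 :: nat)"
    using assms(3) by (auto simp: compose_def fun_eq_iff Delta_le)
  then show ?thesis using assms by (simp add: constant_at_def simplicial_set_comp)
qed

lemma constant_at_0:
  assumes "simplicial_set K" "v \<in> simplices K 0"
  shows "constant_at K 0 v = v"
proof -
  have "(\<lambda>t\<in>{..0}. 0) = (\<lambda>i\<in>{..0}. i :: nat)" by auto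
  then show ?thesis using simplicial_set_id[OF assms] by (simp only: constant_at_def)
qed

lemma vertex_of_constant_at:
  assumes "simplicial_set K" "v \<in> simplices K 0"
  shows "vertex_of K k (constant_at K k v) = v"
  unfolding vertex_of_def act_constant_at[OF assms Delta_const[OF le0]] by (rule constant_at_0[OF assms])

lemma constant_sset_act:
  assumes K: "constant_sset K" and x: "x \<in> simplices K n" and \<alpha>: "\<alpha> \<in> Delta m n"
  shows "act K m n \<alpha> x = constant_at K m (vertex_of K n x)"
    and "vertex_of K m (act K m n \<alpha> x) = vertex_of K n x"
proof -
  note S = constant_sset_simplicial_set[OF K]
  have v: "vertex_of K n x \<in> simplices K 0" by (rule vertex_of_simplices[OF S x])
  have "x = constant_at K n (vertex_of K n x)" using K x by (simp add: constant_sset_def)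
  then show *: "act K m n \<alpha> x = constant_at K m (vertex_of K n x)"
    using act_constant_at[OF S v \<alpha>] by simp
  show "vertex_of K m (act K m n \<alpha> x) = vertex_of K n x"
    unfolding * by (rule vertex_of_constant_at[OF S v])
qed

text \<open>If \<open>K\<close> is discrete then the join of the \<open>n\<close>-simplex and \<open>K\<close> is a union of \<open>(n+1)\<close>-simplices,
  one for each vertex \<open>v\<close> of \<open>K\<close>, along their common \<open>n\<close>-th face. The map \<open>cone_simplex K n v\<close> is
  the inclusion of the \<open>(n+1)\<close>-simplex that belongs to \<open>v\<close>, and \<open>cone_proj n\<close> identifies all these
  simplices with each other.\<close>

definition cone_simplex :: "'k sset \<Rightarrow> nat \<Rightarrow> 'k \<Rightarrow> nat \<Rightarrow> (nat \<Rightarrow> nat) \<Rightarrow> (nat \<Rightarrow> nat, 'k) join_simplex"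
where
  "cone_simplex K n v k \<gamma> = join_act (simplex n) K k (Suc n) \<gamma> (Mid n 0 (\<lambda>i\<in>{..n}. i) v)"

definition cone_proj :: "nat \<Rightarrow> nat \<Rightarrow> (nat \<Rightarrow> nat, 'k) join_simplex \<Rightarrow> nat \<Rightarrow> nat" where
  "cone_proj n k z = (case z of InL \<beta> \<Rightarrow> \<beta> | InR x \<Rightarrow> (\<lambda>t\<in>{..k}. Suc n)
     | Mid i j \<beta> x \<Rightarrow> (\<lambda>t\<in>{..k}. if t \<le> i then \<beta> t else Suc n))"

definition over_vertex :: "'k sset \<Rightarrow> nat \<Rightarrow> 'k \<Rightarrow> ('a, 'k) join_simplex \<Rightarrow> bool" where
  "over_vertex K k v z \<longleftrightarrow> (case z of InL a \<Rightarrow> True | InR x \<Rightarrow> vertex_of K k x = v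
     | Mid i j a x \<Rightarrow> vertex_of K j x = v)"

lemma cone_proj_simps [simp]:
  "cone_proj n k (InL \<beta>) = \<beta>"
  "cone_proj n k (InR x) = (\<lambda>t\<in>{..k}. Suc n)"
  "cone_proj n k (Mid i j \<beta> x) = (\<lambda>t\<in>{..k}. if t \<le> i then \<beta> t else Suc n)"
  by (simp_all add: cone_proj_def)

lemma over_vertex_simps [simp]:
  "over_vertex K k v (InL a)"
  "over_vertex K k v (InR x) \<longleftrightarrow> vertex_of K k x = v"
  "over_vertex K k v (Mid i j a x) \<longleftrightarrow> vertex_of K j x = v"
  by (simp_all add: over_vertex_def)

lemma join_act_sub_simplex: "join_act (sub_simplex n S) K = join_act (simplex n) K"
proof -
  have eq: "act (sub_simplex n S) = act (simplex n)" by (simp add: sub_simplex_def)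
  show ?thesis by (intro ext) (unfold join_act_def eq, rule refl)
qed

lemma join_sub_simplex_subset:
  "z \<in> simplices (join (sub_simplex n S) K) k \<Longrightarrow> z \<in> simplices (join (simplex n) K) k"
  by (cases z) (auto simp: simplices_sub_simplex)

lemma cone_proj_Delta:
  assumes "z \<in> simplices (join (simplex n) K) k"
  shows "cone_proj n k z \<in> Delta k (Suc n)"
proof (cases z)
  case (Mid i j \<beta> x)
  then have \<beta>: "\<beta> \<in> Delta i n" using assms by simp
  show ?thesis unfolding Mid cone_proj_simps
    by (rule DeltaI) (use Delta_le[OF \<beta>] Delta_mono[OF \<beta>] in \<open>auto simp: le_SucI\<close>)
qed (use assms in \<open>auto intro: Delta_cod_mono\<close>)

lemma cone_proj_image:
  assumes "z \<in> simplices (join (sub_simplex n S) K) k" "sieve S"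
  shows "cone_proj n k z ` {..k} \<inter> {..n} \<in> S"
proof (cases z)
  case (Mid i j \<beta> x)
  then have "\<beta> ` {..i} \<in> S" using assms by (simp add: simplices_sub_simplex)
  then show ?thesis unfolding Mid cone_proj_simps
    by (rule sieveD[OF assms(2)]) (auto split: if_splits)
next
  case (InR x)
  then show ?thesis using sieve_empty[OF assms(2)] by (simp add: image_constant_conv)
next
  case (InL \<beta>)
  then show ?thesis using assms(1) sieveD[OF assms(2)] by (auto simp: simplices_sub_simplex)
qed

text \<open>Both sides send the part of \<open>[m]\<close> that \<open>\<alpha>\<close> maps to the second block to the cone point.\<close>

lemma cone_proj_natural:
  assumes \<alpha>: "\<alpha> \<in> Delta m k" and z: "z \<in> simplices (join (simplex n) K) k"
  shows "cone_proj n m (join_act (simplex n) K m k \<alpha> z) = compose {..m} (cone_proj n k z) \<alpha>"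
proof (cases z)
  case (InR x)
  then show ?thesis using Delta_le[OF \<alpha>] by (auto simp: compose_def fun_eq_iff)
next
  case (Mid i j \<beta> x)
  note le = Delta_le[OF \<alpha>]
  show ?thesis
  proof (cases rule: Delta_cut_cases[OF \<alpha>, where i = i, case_names right left mid])
    case right
    then show ?thesis using le
      by (auto simp: Mid join_act_Mid_right[OF right] compose_def fun_eq_iff not_le[symmetric])
  next
    case left
    then show ?thesis using le
      by (auto simp: Mid join_act_Mid_left[OF left] compose_def fun_eq_iff)
  next
    case (mid p q)
    have "cone_proj n m (Mid p q (act (simplex n) p i (restrict \<alpha> {..p}) \<beta>)
           (act K q j (\<lambda>t\<in>{..q}. \<alpha> (Suc (t + p)) - Suc i) x))
         = compose {..m} (cone_proj n k (Mid i j \<beta> x)) \<alpha>"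
    proof
      fix t show "cone_proj n m (Mid p q (act (simplex n) p i (restrict \<alpha> {..p}) \<beta>)
           (act K q j (\<lambda>t\<in>{..q}. \<alpha> (Suc (t + p)) - Suc i) x)) t
         = compose {..m} (cone_proj n k (Mid i j \<beta> x)) \<alpha> t"
        using mid(1) mid(2)[of t] mid(3)[of t] le[of t] by (auto simp: compose_def)
    qed
    then show ?thesis by (simp only: Mid join_act_Mid_mid[OF mid])
  qed
qed simp

lemma over_vertex_act:
  assumes K: "constant_sset K" and \<alpha>: "\<alpha> \<in> Delta m k" and z: "z \<in> simplices (join A K) k"
    and v: "over_vertex K k v z"
  shows "over_vertex K m v (join_act A K m k \<alpha> z)"
proof (cases z)
  case (Mid i j a x)
  then have x: "x \<in> simplices K j" and k: "k = Suc (i + j)" using z by simp_all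
  have \<alpha>': "\<alpha> \<in> Delta m (Suc (i + j))" using \<alpha> k by simp
  show ?thesis
  proof (cases rule: Delta_cut_cases[OF \<alpha>, where i = i, case_names right left mid])
    case right
    show ?thesis using v constant_sset_act[OF K x Delta_cut_right[OF \<alpha>' right]]
      by (simp add: Mid join_act_Mid_right[OF right])
  next
    case left
    show ?thesis by (simp add: Mid join_act_Mid_left[OF left])
  next
    case (mid p q)
    show ?thesis using v constant_sset_act[OF K x Delta_cut_mid(2)[OF \<alpha>' mid]]
      by (simp add: Mid join_act_Mid_mid[OF mid])
  qed
qed (use assms constant_sset_act[OF K _ \<alpha>] in auto)

context
  fixes K :: "'k sset" and v :: 'k
  assumes K: "constant_sset K" and v: "v \<in> simplices K 0"
begin

lemma cone_simplex_Mid: "Mid n 0 (\<lambda>i\<in>{..n}. i) v \<in> simplices (join (simplex n) K) (Suc n)"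
  using v by simp

lemma cone_simplex_natural:
  assumes "\<alpha> \<in> Delta m k" "\<gamma> \<in> Delta k (Suc n)"
  shows "cone_simplex K n v m (compose {..m} \<gamma> \<alpha>) = join_act (simplex n) K m k \<alpha> (cone_simplex K n v k \<gamma>)"
  unfolding cone_simplex_def
  by (rule join_act_compose[OF simplicial_set_simplex constant_sset_simplicial_set[OF K] assms
        cone_simplex_Mid])

lemma cone_simplex_InL: "\<gamma> \<in> Delta k n \<Longrightarrow> cone_simplex K n v k \<gamma> = InL \<gamma>"
  unfolding cone_simplex_def
  by (subst join_act_Mid_left) (simp_all add: Delta_le compose_id_left)

lemma cone_simplex_const: "cone_simplex K n v k (\<lambda>t\<in>{..k}. Suc n) = InR (constant_at K k v)"
  by (simp add: cone_simplex_def join_act_Mid_right constant_at_def cong: restrict_cong)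

lemma cone_simplex_mid:
  assumes "k = Suc (p + q)" "\<And>t. t \<le> p \<Longrightarrow> \<gamma> t \<le> n" "\<And>t. p < t \<Longrightarrow> t \<le> k \<Longrightarrow> n < \<gamma> t"
    and \<gamma>: "\<gamma> \<in> Delta k (Suc n)"
  shows "cone_simplex K n v k \<gamma> = Mid p q (restrict \<gamma> {..p}) (constant_at K q v)"
proof -
  have "\<gamma> (Suc (t + p)) = Suc n" if "t \<le> q" for t
    using assms(3)[of "Suc (t + p)"] Delta_le[OF \<gamma>, of "Suc (t + p)"] that assms(1) by auto
  then have "(\<lambda>t\<in>{..q}. \<gamma> (Suc (t + p)) - Suc n) = (\<lambda>t\<in>{..q}. 0)"
    by (auto simp: fun_eq_iff)
  moreover have "restrict \<gamma> {..p} \<in> Delta p n"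
    using assms by (intro Delta_restrict[OF \<gamma>]) auto
  ultimately show ?thesis
    by (simp add: cone_simplex_def join_act_Mid_mid[OF assms(1-3)] constant_at_def compose_id_left)
qed

lemma cone_simplex_simplices:
  assumes \<gamma>: "\<gamma> \<in> Delta k (Suc n)" and S: "sieve S" "\<gamma> ` {..k} \<inter> {..n} \<in> S"
  shows "cone_simplex K n v k \<gamma> \<in> simplices (join (sub_simplex n S) K) k"
proof (cases rule: Delta_cut_cases[OF \<gamma>, where i = n, case_names right left mid])
  case right
  then have "\<gamma> = (\<lambda>t\<in>{..k}. Suc n)"
    using \<gamma> by (intro Delta_eqI[of _ k]) (auto simp: Delta_extensional le_antisym Suc_le_eq Delta_le)
  then show ?thesis
    by (simp add: cone_simplex_const constant_at_simplices constant_sset_simplicial_set K v)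
next
  case left
  then have "\<gamma> \<in> Delta k n" using Delta_cut_left[OF \<gamma>] by blast
  moreover have "\<gamma> ` {..k} \<inter> {..n} = \<gamma> ` {..k}" using left by auto
  ultimately show ?thesis using S by (simp add: cone_simplex_InL simplices_sub_simplex)
next
  case (mid p q)
  have "restrict \<gamma> {..p} ` {..p} \<in> S"
    by (rule sieveD[OF S]) (use mid in auto)
  moreover have "restrict \<gamma> {..p} \<in> Delta p n"
    using mid by (intro Delta_restrict[OF \<gamma>]) auto
  ultimately have "Mid p q (restrict \<gamma> {..p}) (constant_at K q v) \<in> simplices (join (sub_simplex n S) K) k"
    using mid(1) by (simp add: constant_at_simplices constant_sset_simplicial_set K v simplices_sub_simplex)
  then show ?thesis by (simp only: cone_simplex_mid[OF mid \<gamma>])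
qed

lemma over_vertex_cone_simplex: "\<gamma> \<in> Delta k (Suc n) \<Longrightarrow> over_vertex K k v (cone_simplex K n v k \<gamma>)"
  unfolding cone_simplex_def
  by (rule over_vertex_act[OF K _ cone_simplex_Mid])
     (use vertex_of_constant_at[OF constant_sset_simplicial_set[OF K] v, of 0]
        simplicial_set_id[OF constant_sset_simplicial_set[OF K] v]
      in \<open>auto simp: constant_at_def vertex_of_def restrict_def cong: if_cong\<close>)

lemma cone_proj_cone_simplex: "\<gamma> \<in> Delta k (Suc n) \<Longrightarrow> cone_proj n k (cone_simplex K n v k \<gamma>) = \<gamma>"
  unfolding cone_simplex_def
  apply (subst cone_proj_natural[OF _ cone_simplex_Mid], assumption)
  apply (rule Delta_eqI[of _ k])
  apply (auto simp: compose_def Delta_extensional dest: Delta_le)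
  done

lemma cone_simplex_cone_proj:
  assumes z: "z \<in> simplices (join (simplex n) K) k" and ov: "over_vertex K k v z"
  shows "cone_simplex K n v k (cone_proj n k z) = z"
proof (cases z)
  case (InR x)
  then have "x = constant_at K k v" using K z ov by (auto simp: constant_sset_def)
  then show ?thesis by (simp add: InR cone_simplex_const)
next
  case (Mid i j \<beta> x)
  then have x: "x = constant_at K j v" and \<beta>: "\<beta> \<in> Delta i n" and k: "k = Suc (i + j)"
    using K z ov by (auto simp: constant_sset_def)
  have "restrict (cone_proj n k z) {..i} = \<beta>"
    using \<beta> k by (intro Delta_eqI[of _ i]) (auto simp: Mid Delta_extensional)
  moreover have "cone_simplex K n v k (cone_proj n k z)
      = Mid i j (restrict (cone_proj n k z) {..i}) (constant_at K j v)"
    by (rule cone_simplex_mid) (use k Delta_le[OF \<beta>] cone_proj_Delta[OF z] in \<open>auto simp: Mid\<close>)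
  ultimately show ?thesis by (simp add: Mid x)
qed (use z in \<open>simp add: cone_simplex_InL\<close>)

end

abbreviation cone_sieve :: "nat \<Rightarrow> nat set set \<Rightarrow> nat set set" where
  "cone_sieve n S \<equiv> {V. V \<inter> {..n} \<in> S}"

lemma sieve_cone_sieve: "sieve S \<Longrightarrow> sieve (cone_sieve n S)"
  unfolding sieve_def by (metis (mono_tags, lifting) Int_empty_left inf_mono mem_Collect_eq order_refl)

lemma cone_component_smap:
  assumes K: "constant_sset K" and v: "v \<in> simplices K 0" and S: "sieve S"
    and g: "g \<in> smap (join (sub_simplex n S) K) X"
  shows "(\<lambda>k. \<lambda>\<gamma>\<in>simplices (sub_simplex (Suc n) (cone_sieve n S)) k. g k (cone_simplex K n v k \<gamma>))
    \<in> smap (sub_simplex (Suc n) (cone_sieve n S)) X"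
proof (rule smapI)
  fix m k \<alpha> \<gamma> assume \<alpha>: "\<alpha> \<in> Delta m k" and \<gamma>: "\<gamma> \<in> simplices (sub_simplex (Suc n) (cone_sieve n S)) k"
  then have \<gamma>': "\<gamma> \<in> Delta k (Suc n)" "\<gamma> ` {..k} \<inter> {..n} \<in> S" by (auto simp: simplices_sub_simplex)
  have c: "compose {..m} \<gamma> \<alpha> \<in> simplices (sub_simplex (Suc n) (cone_sieve n S)) m"
    using simplicial_set_simplices[OF simplicial_set_sub_simplex[OF sieve_cone_sieve[OF S]] \<alpha> \<gamma>] by simp
  show "(\<lambda>\<gamma>\<in>simplices (sub_simplex (Suc n) (cone_sieve n S)) m. g m (cone_simplex K n v m \<gamma>))
         (act (sub_simplex (Suc n) (cone_sieve n S)) m k \<alpha> \<gamma>) =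
       act X m k \<alpha> ((\<lambda>\<gamma>\<in>simplices (sub_simplex (Suc n) (cone_sieve n S)) k. g k (cone_simplex K n v k \<gamma>)) \<gamma>)"
    using c \<gamma> smap_natural[OF g \<alpha> cone_simplex_simplices[OF K v \<gamma>'(1) S \<gamma>'(2)]]
    by (simp add: cone_simplex_natural[OF K v \<alpha> \<gamma>'(1)] join_act_sub_simplex)
qed (use smap_simplices[OF g cone_simplex_simplices[OF K v _ S]] in \<open>auto simp: simplices_sub_simplex\<close>)

text \<open>Since the join with a discrete \<open>K\<close> is a union of simplices with a common face, maps on these
  simplices that agree there can be glued. The map \<open>b\<close> on the common face is kept as an argument as
  \<open>K\<close> may be empty.\<close>

definition cone_glue :: "(nat \<Rightarrow> nat) sset \<Rightarrow> 'k sset \<Rightarrow> nat \<Rightarrow> (nat \<Rightarrow> (nat \<Rightarrow> nat) \<Rightarrow> 'a)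
    \<Rightarrow> ('k \<Rightarrow> nat \<Rightarrow> (nat \<Rightarrow> nat) \<Rightarrow> 'a) \<Rightarrow> nat \<Rightarrow> (nat \<Rightarrow> nat, 'k) join_simplex \<Rightarrow> 'a" where
  "cone_glue A K n b H = (\<lambda>k. \<lambda>z\<in>simplices (join A K) k. case z of
       InL \<beta> \<Rightarrow> b k \<beta>
     | InR x \<Rightarrow> H (vertex_of K k x) k (cone_proj n k z)
     | Mid i j \<beta> x \<Rightarrow> H (vertex_of K j x) k (cone_proj n k z))"

lemma cone_glue_InL: "\<beta> \<in> simplices A k \<Longrightarrow> cone_glue A K n b H k (InL \<beta>) = b k \<beta>"
  by (simp add: cone_glue_def)

context
  fixes K :: "'k sset" and n :: nat and S :: "nat set set" and X :: "'a sset"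
    and b :: "nat \<Rightarrow> (nat \<Rightarrow> nat) \<Rightarrow> 'a" and H :: "'k \<Rightarrow> nat \<Rightarrow> (nat \<Rightarrow> nat) \<Rightarrow> 'a"
  assumes K: "constant_sset K" and S: "sieve S"
    and b: "b \<in> smap (sub_simplex n S) X"
    and H: "\<And>v. v \<in> simplices K 0 \<Longrightarrow> H v \<in> smap (sub_simplex (Suc n) (cone_sieve n S)) X"
    and agree: "\<And>v k \<beta>. v \<in> simplices K 0 \<Longrightarrow> \<beta> \<in> simplices (sub_simplex n S) k \<Longrightarrow> H v k \<beta> = b k \<beta>"
begin

lemma cone_glue_over:
  assumes "z \<in> simplices (join (sub_simplex n S) K) k" "v \<in> simplices K 0" "over_vertex K k v z"
  shows "cone_glue (sub_simplex n S) K n b H k z = H v k (cone_proj n k z)"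
  using assms agree by (cases z) (auto simp: cone_glue_def)

lemma cone_glue_smap: "cone_glue (sub_simplex n S) K n b H \<in> smap (join (sub_simplex n S) K) X"
proof -
  let ?A = "sub_simplex n S" and ?g = "cone_glue (sub_simplex n S) K n b H"
  note A = simplicial_set_sub_simplex[OF S] and K' = constant_sset_simplicial_set[OF K]
  have main: "?g k z \<in> simplices X k \<and> ?g m (join_act ?A K m k \<alpha> z) = act X m k \<alpha> (?g k z)"
    if z: "z \<in> simplices (join ?A K) k" and \<alpha>: "\<alpha> \<in> Delta m k" for k m \<alpha> z
  proof (cases "\<exists>v\<in>simplices K 0. over_vertex K k v z")
    case True
    then obtain v where v: "v \<in> simplices K 0" and ov: "over_vertex K k v z" by blast
    note z' = join_sub_simplex_subset[OF z]
    have a: "join_act ?A K m k \<alpha> z \<in> simplices (join ?A K) m"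
      using z \<alpha> by (simp add: join_act_simplices A K')
    have p: "cone_proj n k z \<in> simplices (sub_simplex (Suc n) (cone_sieve n S)) k"
      using cone_proj_Delta[OF z'] cone_proj_image[OF z S] by (simp add: simplices_sub_simplex)
    have "?g m (join_act ?A K m k \<alpha> z) = H v m (cone_proj n m (join_act ?A K m k \<alpha> z))"
      by (rule cone_glue_over[OF a v over_vertex_act[OF K \<alpha> z ov]])
    also have "\<dots> = H v m (compose {..m} (cone_proj n k z) \<alpha>)"
      using cone_proj_natural[OF \<alpha> z'] by (simp add: join_act_sub_simplex)
    also have "\<dots> = act X m k \<alpha> (H v k (cone_proj n k z))"
      using smap_natural[OF H[OF v] \<alpha> p] by simp
    finally show ?thesis
      using smap_simplices[OF H[OF v] p] by (simp add: cone_glue_over[OF z v ov])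
  next
    case False
    then obtain \<beta> where \<beta>: "z = InL \<beta>" "\<beta> \<in> simplices ?A k"
      using z vertex_of_simplices[OF K'] by (cases z) auto
    then show ?thesis
      using smap_natural[OF b \<alpha> \<beta>(2)] smap_simplices[OF b \<beta>(2)] simplicial_set_simplices[OF A \<alpha> \<beta>(2)]
      by (simp add: cone_glue_InL)
  qed
  show ?thesis
  proof (rule smapI)
    show "?g k z \<in> simplices X k" if "z \<in> simplices (join ?A K) k" for k z
      using main[OF that Delta_id] ..
    show "?g m (act (join ?A K) m k \<alpha> z) = act X m k \<alpha> (?g k z)"
      if "\<alpha> \<in> Delta m k" "z \<in> simplices (join ?A K) k" for k m \<alpha> z
      using main[OF that(2,1)] by simp
  qed (simp add: cone_glue_def)
qed

end


section \<open>Final vertices\<close>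

lemma cone_proj_last:
  assumes "z \<in> simplices (join A K) k"
  shows "(\<exists>a. z = InL a) \<or> Suc n \<in> cone_proj n k z ` {..k}"
proof (rule disjCI)
  assume "Suc n \<notin> cone_proj n k z ` {..k}"
  then have "cone_proj n k z k \<noteq> Suc n" by (metis atMost_iff imageI order_refl)
  then show "\<exists>a. z = InL a" using assms by (cases z) auto
qed

lemma over_vertex_simplex_0:
  "z \<in> simplices (join A (simplex 0)) k \<Longrightarrow> over_vertex (simplex 0) k (\<lambda>i\<in>{..0}. 0) z"
  using Delta_0_eq[OF vertex_of_simplices[of "simplex 0", simplified]] by (cases z) auto

lemma slice_proj_apply:
  "\<sigma> \<in> simplices (slice K X p) n \<Longrightarrow> slice_proj K X p n \<sigma> = \<sigma> n (InL (\<lambda>i\<in>{..n}. i))"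
  by (simp add: slice_proj_def)

lemma slice_proj_smap:
  assumes "simplicial_set K" shows "slice_proj K X p \<in> smap (slice K X p) X"
proof (rule smapI)
  fix n \<sigma> assume "\<sigma> \<in> simplices (slice K X p) n"
  then show "slice_proj K X p n \<sigma> \<in> simplices X n"
    by (auto simp: slice_proj_apply simplices_slice intro: smap_simplices)
next
  fix m n \<alpha> \<sigma> assume *: "\<alpha> \<in> Delta m n" "\<sigma> \<in> simplices (slice K X p) n"
  have \<sigma>: "\<sigma> \<in> smap (join (simplex n) K) X" using * by (simp add: simplices_slice)
  show "slice_proj K X p m (act (slice K X p) m n \<alpha> \<sigma>) = act X m n \<alpha> (slice_proj K X p n \<sigma>)"
    using * smap_natural[OF \<sigma> *(1), of "InL (\<lambda>i\<in>{..n}. i)"]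
    by (simp add: slice_proj_apply simplicial_set_simplices[OF simplicial_set_slice[OF assms]])
      (simp add: act_slice compose_id_left compose_id_right)
qed (simp add: slice_proj_def)

lemma horn_last: "horn (Suc n) (Suc n) = sub_simplex (Suc n) (cone_sieve n {V. \<not> {..n} \<subseteq> V})"
proof -
  have "{..Suc n} - {Suc n} = {..n}" by auto
  then show ?thesis by (simp add: horn_sub_simplex)
qed

lemma join_boundary_subset:
  "z \<in> simplices (join (boundary n) K) k \<Longrightarrow> z \<in> simplices (join (simplex n) K) k"
  unfolding boundary_sub_simplex by (rule join_sub_simplex_subset)

lemma cone_proj_boundary:
  assumes "z \<in> simplices (join (boundary n) K) k"
  shows "cone_proj n k z \<in> simplices (boundary (Suc n)) k"
proof -
  have "\<not> {..n} \<subseteq> cone_proj n k z ` {..k} \<inter> {..n}"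
    using cone_proj_image[of z n "{V. \<not> {..n} \<subseteq> V}" K k] assms by (simp add: boundary_sub_simplex)
  then have "cone_proj n k z ` {..k} \<noteq> {..Suc n}" by auto
  then show ?thesis
    by (simp add: simplices_boundary cone_proj_Delta[OF join_boundary_subset[OF assms]])
qed

lemma boundary_Suc_cases:
  assumes "\<gamma> \<in> simplices (boundary (Suc n)) k"
  obtains "\<gamma> \<in> Delta k n" | "Suc n \<in> \<gamma> ` {..k}" "\<not> {..n} \<subseteq> \<gamma> ` {..k} \<inter> {..n}"
proof (cases "Suc n \<in> \<gamma> ` {..k}")
  case False
  then have "\<gamma> t \<le> n" if "t \<le> k" for t
    using assms Delta_le[of \<gamma> k "Suc n" t] that
    by (metis atMost_iff image_eqI le_SucE simplices_boundary)
  then show ?thesis using assms that(1) by (auto simp: simplices_boundary intro: Delta_cod_restrict)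
next
  case True
  have "\<not> {..n} \<subseteq> \<gamma> ` {..k}"
  proof
    assume "{..n} \<subseteq> \<gamma> ` {..k}"
    then have "{..Suc n} \<subseteq> \<gamma> ` {..k}" using True by (auto simp: atMost_Suc)
    moreover have "\<gamma> ` {..k} \<subseteq> {..Suc n}" using assms by (auto simp: simplices_boundary dest: Delta_le)
    ultimately show False using assms by (simp add: simplices_boundary)
  qed
  then show ?thesis using that(2) True by blast
qed

lemma Delta_simplices_boundary_Suc:
  assumes "\<beta> \<in> Delta k n"
  shows "\<beta> \<in> simplices (boundary (Suc n)) k"
proof -
  have "\<beta> ` {..k} \<subseteq> {..n}" using assms by (auto dest: Delta_le)
  then have "\<beta> ` {..k} \<noteq> {..Suc n}" by auto
  then show ?thesis using assms by (simp add: simplices_boundary Delta_cod_mono)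
qed

lemma vertex_map_smap: "simplicial_set X \<Longrightarrow> c \<in> simplices X 0 \<Longrightarrow> vertex_map X c \<in> smap (simplex 0) X"
  using yoneda_map_smap[of X c 0] by (simp add: vertex_map_def yoneda_map_def)

lemma smap_const_vertex:
  assumes "f \<in> smap A X" "(\<lambda>i\<in>{..0}. e) \<in> simplices A 0" "f 0 (\<lambda>i\<in>{..0}. e) = c" "x \<in> Delta m 0"
    and "\<And>\<alpha> \<beta>. act A m 0 \<alpha> \<beta> = compose {..m} \<beta> \<alpha>"
  shows "f m (\<lambda>t\<in>{..m}. e) = vertex_map X c m x"
proof -
  have "compose {..m} (\<lambda>i\<in>{..0}. e) x = (\<lambda>t\<in>{..m}. e)"
    using Delta_0_eq[OF assms(4)] by (auto simp: compose_def fun_eq_iff)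
  then show ?thesis
    using smap_natural[OF assms(1,4,2)] assms(3-5) by (simp add: vertex_map_def)
qed

text \<open>The join of the boundary of the \<open>n\<close>-simplex with a point is the last horn of the
  \<open>(n+1)\<close>-simplex. So the two parts of a lifting problem against the projection from the slice over
  \<open>c\<close> form a map from the boundary of the \<open>(n+1)\<close>-simplex whose last vertex is \<open>c\<close>, and a lift is an
  extension of this map.\<close>

lemma final_vertexI:
  assumes Y: "simplicial_set Y" and c: "c \<in> simplices Y 0"
    and fill: "\<And>n t. t \<in> smap (boundary (Suc n)) Y \<Longrightarrow> t 0 (\<lambda>i\<in>{..0}. Suc n) = c \<Longrightarrow>
      \<exists>y\<in>simplices Y (Suc n). extends_on (boundary (Suc n)) (yoneda_map Y (Suc n) y) t"
  shows "final_vertex Y c"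
proof -
  let ?K = "simplex 0" and ?p = "vertex_map Y c" and ?o = "\<lambda>i\<in>{..0}. 0 :: nat"
  note K = constant_sset_simplex_0 and p = vertex_map_smap[OF Y c]
  have o: "?o \<in> simplices ?K 0" by (simp del: atMost_0)
  have "\<exists>w\<in>smap (simplex n) (slice ?K Y ?p). extends_on (boundary n) w u \<and>
      scomp (simplex n) (slice_proj ?K Y ?p) w = v"
    if u: "u \<in> smap (boundary n) (slice ?K Y ?p)" and v: "v \<in> smap (simplex n) Y"
      and e: "extends_on (boundary n) v (scomp (boundary n) (slice_proj ?K Y ?p) u)" for n u v
  proof -
    define g where "g = uncurry_join (boundary n) ?K ?p u"
    have g: "g \<in> smap (join (boundary n) ?K) Y"
      unfolding g_def by (rule uncurry_join_smap[OF _ _ p u]) simp_all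
    have vg: "v k \<beta> = g k (InL \<beta>)" if "\<beta> \<in> simplices (boundary n) k" for k \<beta>
      using e that smap_simplices[OF u that]
      by (simp add: extends_on_def scomp_def compose_eq slice_proj_apply g_def uncurry_join_def)
    have cs: "cone_simplex ?K n ?o k \<gamma> \<in> simplices (join (boundary n) ?K) k"
      if "\<gamma> \<in> Delta k (Suc n)" "\<not> {..n} \<subseteq> \<gamma> ` {..k} \<inter> {..n}" for k \<gamma>
      using cone_simplex_simplices[OF K o that(1) sieve_boundary, of n] that(2)
      by (simp add: boundary_sub_simplex)
    \<comment> \<open>\<open>v\<close> gives the face opposite to the last vertex and \<open>u\<close> gives all other faces.\<close>
    define t where "t = (\<lambda>k. \<lambda>\<gamma>\<in>simplices (boundary (Suc n)) k.
      if Suc n \<in> \<gamma> ` {..k} then g k (cone_simplex ?K n ?o k \<gamma>) else v k \<gamma>)"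
    have t1: "t k \<gamma> = v k \<gamma>" if "\<gamma> \<in> Delta k n" for k \<gamma>
    proof -
      have "Suc n \<notin> \<gamma> ` {..k}" using Delta_le[OF that] by (metis atMost_iff imageE not_less_eq_eq order_refl)
      then show ?thesis using Delta_simplices_boundary_Suc[OF that] by (simp add: t_def)
    qed
    have t2: "t k \<gamma> = g k (cone_simplex ?K n ?o k \<gamma>)"
      if "\<gamma> \<in> simplices (boundary (Suc n)) k" "Suc n \<in> \<gamma> ` {..k}" for k \<gamma>
      using that by (simp add: t_def)
    have t: "t \<in> smap (boundary (Suc n)) Y"
    proof (rule smapI)
      fix k \<gamma> assume \<gamma>: "\<gamma> \<in> simplices (boundary (Suc n)) k"
      then show "t k \<gamma> \<in> simplices Y k"
      proof (cases rule: boundary_Suc_cases)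
        case 1 then show ?thesis using smap_simplices[OF v] by (simp add: t1)
      next
        case 2 then show ?thesis
          using \<gamma> smap_simplices[OF g cs] by (simp add: t2 simplices_boundary)
      qed
    next
      fix m k \<alpha> \<gamma> assume \<alpha>: "\<alpha> \<in> Delta m k" and \<gamma>: "\<gamma> \<in> simplices (boundary (Suc n)) k"
      have a: "compose {..m} \<gamma> \<alpha> \<in> simplices (boundary (Suc n)) m"
        using simplicial_set_simplices[OF simplicial_set_boundary \<alpha> \<gamma>] by simp
      from \<gamma> have "t m (compose {..m} \<gamma> \<alpha>) = act Y m k \<alpha> (t k \<gamma>)"
      proof (cases rule: boundary_Suc_cases)
        case 1 then show ?thesis
          using smap_natural[OF v \<alpha>, of \<gamma>] Delta_compose[OF \<alpha> 1] by (simp add: t1)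
      next
        case 2
        have \<gamma>': "\<gamma> \<in> Delta k (Suc n)" using \<gamma> by (simp add: simplices_boundary)
        have "act Y m k \<alpha> (t k \<gamma>) = g m (cone_simplex ?K n ?o m (compose {..m} \<gamma> \<alpha>))"
          using smap_natural[OF g \<alpha> cs[OF \<gamma>' 2(2)]]
          by (simp add: t2[OF \<gamma> 2(1)] cone_simplex_natural[OF K o \<alpha> \<gamma>'] boundary_sub_simplex
              join_act_sub_simplex del: atMost_0)
        also have "\<dots> = t m (compose {..m} \<gamma> \<alpha>)"
        proof (cases "Suc n \<in> compose {..m} \<gamma> \<alpha> ` {..m}")
          case False
          have im: "compose {..m} \<gamma> \<alpha> ` {..m} \<subseteq> \<gamma> ` {..k}"
            using Delta_le[OF \<alpha>] by (auto simp: compose_def)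
          have d: "compose {..m} \<gamma> \<alpha> \<in> Delta m n" using a False by (rule_tac boundary_Suc_cases) auto
          then have "compose {..m} \<gamma> \<alpha> \<in> simplices (boundary n) m"
            using im 2(2) by (auto simp: simplices_boundary)
          then show ?thesis
            using d vg by (simp add: t1 cone_simplex_InL del: atMost_0)
        qed (simp add: t2[OF a])
        finally show ?thesis ..
      qed
      then show "t m (act (boundary (Suc n)) m k \<alpha> \<gamma>) = act Y m k \<alpha> (t k \<gamma>)" by simp
    qed (simp add: t_def)
    have last: "(\<lambda>i\<in>{..0}. Suc n) \<in> simplices (boundary (Suc n)) 0"
      by (auto simp: simplices_boundary simp del: atMost_0)
    have "t 0 (\<lambda>i\<in>{..0}. Suc n) = c"
    proof -
      have "t 0 (\<lambda>i\<in>{..0}. Suc n) = g 0 (InR (constant_at ?K 0 ?o))"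
        using t2[OF last] cone_simplex_const[OF K o, of n 0] by auto
      also have "\<dots> = vertex_map Y c 0 ?o"
        using constant_at_0[OF _ o] o by (simp add: g_def uncurry_join_InR del: atMost_0)
      also have "?o = (\<lambda>i\<in>{..0}. i)" by auto
      also have "vertex_map Y c 0 (\<lambda>i\<in>{..0}. i) = c"
        using simplicial_set_id[OF Y c] by (simp add: vertex_map_def del: atMost_0)
      finally show ?thesis .
    qed
    then obtain y where y: "y \<in> simplices Y (Suc n)"
      and yt: "\<And>k \<gamma>. \<gamma> \<in> simplices (boundary (Suc n)) k \<Longrightarrow> yoneda_map Y (Suc n) y k \<gamma> = t k \<gamma>"
      using fill[OF t] unfolding extends_on_def by blast
    define G where "G = (\<lambda>k. \<lambda>z\<in>simplices (join (simplex n) ?K) k. yoneda_map Y (Suc n) y k (cone_proj n k z))"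
    have G: "G \<in> smap (join (simplex n) ?K) Y"
    proof (rule smapI)
      fix k z assume "z \<in> simplices (join (simplex n) ?K) k"
      then show "G k z \<in> simplices Y k"
        using smap_simplices[OF yoneda_map_smap[OF Y y]] cone_proj_Delta[of z n] by (simp add: G_def)
    next
      fix m k \<alpha> z assume *: "\<alpha> \<in> Delta m k" "z \<in> simplices (join (simplex n) ?K) k"
      then show "G m (act (join (simplex n) ?K) m k \<alpha> z) = act Y m k \<alpha> (G k z)"
        using smap_natural[OF yoneda_map_smap[OF Y y] *(1), of "cone_proj n k z"]
        by (simp add: G_def cone_proj_Delta cone_proj_natural join_act_simplices)
    qed (simp add: G_def)
    have Gp: "G m (InR x) = ?p m x" if "x \<in> simplices ?K m" for m x
    proof -
      have "(\<lambda>t\<in>{..m}. Suc n) \<in> simplices (boundary (Suc n)) m"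
        by (auto simp: simplices_boundary)
      moreover have "t m (\<lambda>t\<in>{..m}. Suc n) = ?p m x"
        by (rule smap_const_vertex[OF t last \<open>t 0 (\<lambda>i\<in>{..0}. Suc n) = c\<close>]) (use that in simp_all)
      ultimately show ?thesis using that yt by (simp add: G_def)
    qed
    have Gg: "G k z = g k z" if z: "z \<in> simplices (join (boundary n) ?K) k" for k z
    proof -
      have "G k z = t k (cone_proj n k z)"
        using yt[OF cone_proj_boundary[OF z]] join_boundary_subset[OF z] by (simp add: G_def)
      also have "\<dots> = g k z"
      proof (cases "Suc n \<in> cone_proj n k z ` {..k}")
        case True
        show ?thesis
          using cone_simplex_cone_proj[OF K o join_boundary_subset[OF z] over_vertex_simplex_0[OF z]]
          by (simp add: t2[OF cone_proj_boundary[OF z] True])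
      next
        case False
        then obtain \<beta> where \<beta>: "z = InL \<beta>"
          using cone_proj_last[OF z, of n] by (cases z) (auto simp del: cone_proj_simps)
        then have "\<beta> \<in> simplices (boundary n) k" "\<beta> \<in> Delta k n"
          using z by (simp_all add: simplices_boundary)
        then show ?thesis using vg \<beta> by (simp add: t1)
      qed
      finally show ?thesis .
    qed
    define w where "w = curry_join (simplex n) ?K G"
    have w: "w \<in> smap (simplex n) (slice ?K Y ?p)"
      unfolding w_def by (rule curry_join_smap[OF _ _ G Gp]) simp_all
    have "w m \<beta> = u m \<beta>" if \<beta>: "\<beta> \<in> simplices (boundary n) m" for m \<beta>
    proof (rule smap_eqI)
      have \<beta>': "\<beta> \<in> simplices (simplex n) m" using \<beta> by (simp add: simplices_boundary)
      show "w m \<beta> \<in> smap (join (simplex m) ?K) Y" "u m \<beta> \<in> smap (join (simplex m) ?K) Y"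
        using smap_simplices[OF u \<beta>] smap_simplices[OF w \<beta>'] by (simp_all add: simplices_slice)
      fix k z assume z: "z \<in> simplices (join (simplex m) ?K) k"
      have "u m \<beta> k z = g k (join_map (\<lambda>i \<alpha>. act (boundary n) i m \<alpha> \<beta>) k z)"
        unfolding g_def by (rule slice_map_apply[OF u \<beta> _ z]) simp
      moreover have "w m \<beta> k z = G k (join_map (\<lambda>i \<alpha>. act (simplex n) i m \<alpha> \<beta>) k z)"
        using \<beta>' z by (simp add: w_def curry_join_def)
      moreover have "join_map (\<lambda>i \<alpha>. act (boundary n) i m \<alpha> \<beta>) k z \<in> simplices (join (boundary n) ?K) k"
        by (rule join_map_act_simplices[OF _ \<beta> z]) simp
      ultimately show "w m \<beta> k z = u m \<beta> k z" using Gg by simp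
    qed
    then have "extends_on (boundary n) w u" by (simp add: extends_on_def)
    moreover have "scomp (simplex n) (slice_proj ?K Y ?p) w = v"
    proof (rule ext, rule ext)
      fix m \<beta> show "scomp (simplex n) (slice_proj ?K Y ?p) w m \<beta> = v m \<beta>"
      proof (cases "\<beta> \<in> Delta m n")
        case True
        then have "slice_proj ?K Y ?p m (w m \<beta>) = G m (InL \<beta>)"
          using smap_simplices[OF w, of \<beta> m] by (simp add: slice_proj_apply)
            (simp add: w_def curry_join_def compose_id_right)
        also have "\<dots> = v m \<beta>"
          using True yt[OF Delta_simplices_boundary_Suc[OF True]] by (simp add: G_def t1)
        finally show ?thesis using True by (simp add: scomp_def compose_eq)
      next
        case False
        then show ?thesis using smap_extensional[OF v, of m] by (simp add: scomp_def compose_def extensional_def)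
      qed
    qed
    ultimately show ?thesis using w by blast
  qed
  then show ?thesis
    using slice_proj_smap[of ?K Y ?p] c
    by (simp add: final_vertex_def acyclic_kan_fibration_def)
qed

text \<open>The converse: the restrictions of \<open>t\<close> to the last horn and to the last face form a lifting problem.\<close>

lemma final_vertexD:
  assumes Y: "simplicial_set Y" and c: "final_vertex Y c"
    and t: "t \<in> smap (boundary (Suc n)) Y" and tc: "t 0 (\<lambda>i\<in>{..0}. Suc n) = c"
  shows "\<exists>y\<in>simplices Y (Suc n). extends_on (boundary (Suc n)) (yoneda_map Y (Suc n) y) t"
proof -
  let ?K = "simplex 0" and ?p = "vertex_map Y c" and ?o = "\<lambda>i\<in>{..0}. 0 :: nat"
  have c0: "c \<in> simplices Y 0" using c by (simp add: final_vertex_def)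
  note K = constant_sset_simplex_0 and p = vertex_map_smap[OF Y c0]
  have o: "?o \<in> simplices ?K 0" by (simp del: atMost_0)
  have last: "(\<lambda>i\<in>{..0}. Suc n) \<in> simplices (boundary (Suc n)) 0"
    by (auto simp: simplices_boundary simp del: atMost_0)
  define G where "G = (\<lambda>k. \<lambda>z\<in>simplices (join (boundary n) ?K) k. t k (cone_proj n k z))"
  have G: "G \<in> smap (join (boundary n) ?K) Y"
  proof (rule smapI)
    fix k z assume "z \<in> simplices (join (boundary n) ?K) k"
    then show "G k z \<in> simplices Y k"
      using smap_simplices[OF t cone_proj_boundary] by (simp add: G_def)
  next
    fix m k \<alpha> z assume *: "\<alpha> \<in> Delta m k" "z \<in> simplices (join (boundary n) ?K) k"
    have "cone_proj n m (join_act (boundary n) ?K m k \<alpha> z) = compose {..m} (cone_proj n k z) \<alpha>"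
      using cone_proj_natural[OF *(1) join_boundary_subset[OF *(2)]]
      by (simp add: boundary_sub_simplex join_act_sub_simplex)
    then show "G m (act (join (boundary n) ?K) m k \<alpha> z) = act Y m k \<alpha> (G k z)"
      using * smap_natural[OF t *(1) cone_proj_boundary[OF *(2)]]
      by (simp add: G_def join_act_simplices)
  qed (simp add: G_def)
  have Gp: "G m (InR x) = ?p m x" if "x \<in> simplices ?K m" for m x
  proof -
    have "t m (\<lambda>t\<in>{..m}. Suc n) = ?p m x"
      by (rule smap_const_vertex[OF t last tc]) (use that in simp_all)
    then show ?thesis using that by (simp add: G_def)
  qed
  define u where "u = curry_join (boundary n) ?K G"
  have u: "u \<in> smap (boundary n) (slice ?K Y ?p)"
    unfolding u_def by (rule curry_join_smap[OF _ _ G Gp]) simp_all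
  define v where "v = (\<lambda>k. restrict (t k) (simplices (simplex n) k))"
  have v: "v \<in> smap (simplex n) Y"
    unfolding v_def by (rule smap_restrict[OF _ t]) (auto simp: Delta_simplices_boundary_Suc)
  have "slice_proj ?K Y ?p k (u k \<beta>) = v k \<beta>" if \<beta>: "\<beta> \<in> simplices (boundary n) k" for k \<beta>
  proof -
    have "slice_proj ?K Y ?p k (u k \<beta>) = u k \<beta> k (InL (\<lambda>i\<in>{..k}. i))"
      by (rule slice_proj_apply[OF smap_simplices[OF u \<beta>]])
    also have "\<beta> \<in> Delta k n" using \<beta> by (simp add: simplices_boundary)
    then have "u k \<beta> k (InL (\<lambda>i\<in>{..k}. i)) = v k \<beta>"
      using \<beta> by (simp add: u_def curry_join_def G_def v_def compose_id_right)
    finally show ?thesis .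
  qed
  then have "extends_on (boundary n) v (scomp (boundary n) (slice_proj ?K Y ?p) u)"
    by (simp add: extends_on_def scomp_def compose_eq)
  then obtain w where w: "w \<in> smap (simplex n) (slice ?K Y ?p)" and wu: "extends_on (boundary n) w u"
    and wv: "scomp (simplex n) (slice_proj ?K Y ?p) w = v"
    using c u v unfolding final_vertex_def acyclic_kan_fibration_def by blast
  define g where "g = uncurry_join (simplex n) ?K ?p w"
  have g: "g \<in> smap (join (simplex n) ?K) Y"
    unfolding g_def by (rule uncurry_join_smap[OF _ _ p w]) simp_all
  have gG: "g k z = G k z" if z: "z \<in> simplices (join (boundary n) ?K) k" for k z
  proof -
    have "g k z = uncurry_join (boundary n) ?K ?p u k z"
      using z join_boundary_subset[OF z] wu by (cases z) (auto simp: g_def uncurry_join_def extends_on_def)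
    also have "\<dots> = G k z" unfolding u_def by (rule uncurry_curry_join) (simp_all add: Gp z)
    finally show ?thesis .
  qed
  let ?\<theta> = "cone_simplex ?K n ?o"
  have cs: "?\<theta> k \<gamma> \<in> simplices (join (simplex n) ?K) k" if "\<gamma> \<in> Delta k (Suc n)" for k \<gamma>
    using cone_simplex_simplices[OF K o that sieve_UNIV] by (simp add: simplex_sub_simplex)
  \<comment> \<open>The join of the \<open>n\<close>-simplex with a point is the \<open>(n+1)\<close>-simplex.\<close>
  define y where "y = g (Suc n) (?\<theta> (Suc n) (\<lambda>i\<in>{..Suc n}. i))"
  have y: "y \<in> simplices Y (Suc n)"
    unfolding y_def by (rule smap_simplices[OF g cs]) (rule Delta_id)
  have yg: "act Y k (Suc n) \<gamma> y = g k (?\<theta> k \<gamma>)" if "\<gamma> \<in> Delta k (Suc n)" for k \<gamma>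
    using smap_natural[OF g that cs[OF Delta_id]] cone_simplex_natural[OF K o that Delta_id] that
    by (simp add: y_def compose_id_left del: atMost_0)
  have "yoneda_map Y (Suc n) y k \<gamma> = t k \<gamma>" if \<gamma>: "\<gamma> \<in> simplices (boundary (Suc n)) k" for k \<gamma>
  proof -
    have \<gamma>': "\<gamma> \<in> Delta k (Suc n)" using \<gamma> by (simp add: simplices_boundary)
    from \<gamma> have "g k (?\<theta> k \<gamma>) = t k \<gamma>"
    proof (cases rule: boundary_Suc_cases)
      case 1
      have "g k (?\<theta> k \<gamma>) = slice_proj ?K Y ?p k (w k \<gamma>)"
        using 1 smap_simplices[OF w, of \<gamma> k] cone_simplex_InL[OF K o 1]
        by (simp add: slice_proj_apply g_def uncurry_join_def)
      also have "\<dots> = v k \<gamma>" using wv 1 by (auto simp: scomp_def compose_eq)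
      finally show ?thesis using 1 by (simp add: v_def)
    next
      case 2
      have "?\<theta> k \<gamma> \<in> simplices (join (boundary n) ?K) k"
        using cone_simplex_simplices[OF K o \<gamma>' sieve_boundary, of n] 2
        by (simp add: boundary_sub_simplex)
      then show ?thesis
        by (simp add: gG del: atMost_0) (simp add: G_def cone_proj_cone_simplex[OF K o \<gamma>'] del: atMost_0)
    qed
    then show ?thesis by (simp add: yoneda_map_apply \<gamma>' yg)
  qed
  then show ?thesis using y by (auto simp: extends_on_def)
qed

section \<open>A criterion for product cones\<close>

text \<open>Vertices of simplicial sets are written as functions on \<open>{..0}\<close>.\<close>

declare atMost_0 [simp del]

definition last_edge :: "nat \<Rightarrow> nat \<Rightarrow> nat" where
  "last_edge n = (\<lambda>t\<in>{..1}. t + n)"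

lemma last_edge_Delta: "last_edge n \<in> Delta 1 (Suc n)"
  unfolding last_edge_def by (rule DeltaI) auto

lemma last_edge_in_horn: "last_edge (Suc n) \<in> simplices (horn (Suc (Suc n)) (Suc (Suc n))) 1"
proof -
  have "0 \<notin> last_edge (Suc n) ` {..1}" by (auto simp: last_edge_def)
  then show ?thesis using last_edge_Delta by (auto simp: simplices_horn)
qed

text \<open>A lifting problem for a cone \<open>c\<close> over a family of objects consists of a map \<open>b\<close> from the boundary
  of an \<open>(n+1)\<close>-simplex whose last vertex is the apex of \<open>c\<close>, and for each \<open>i\<close> an extension \<open>h i\<close> of
  \<open>b\<close> to the last horn of the \<open>(n+2)\<close>-simplex whose last edge is the \<open>i\<close>-th projection. A solution is
  a filler \<open>y\<close> of \<open>b\<close> together with fillers \<open>w i\<close> of all \<open>h i\<close> that have \<open>y\<close> as their last face.\<close>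

definition cone_problem :: "'i set \<Rightarrow> 'a sset \<Rightarrow> (nat \<Rightarrow> (nat \<Rightarrow> nat, 'i) join_simplex \<Rightarrow> 'a) \<Rightarrow> nat
    \<Rightarrow> (nat \<Rightarrow> (nat \<Rightarrow> nat) \<Rightarrow> 'a) \<Rightarrow> ('i \<Rightarrow> nat \<Rightarrow> (nat \<Rightarrow> nat) \<Rightarrow> 'a) \<Rightarrow> bool" where
  "cone_problem I X c n b h \<longleftrightarrow> b \<in> smap (boundary (Suc n)) X \<and>
     b 0 (\<lambda>i\<in>{..0}. Suc n) = c 0 (InL (\<lambda>i\<in>{..0}. i)) \<and>
     (\<forall>i\<in>I. h i \<in> smap (horn (Suc (Suc n)) (Suc (Suc n))) X \<and> extends_on (boundary (Suc n)) (h i) b \<and>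
        h i 1 (last_edge (Suc n)) = c 1 (Mid 0 0 (\<lambda>i\<in>{..0}. i) i))"

definition cone_solution :: "'i set \<Rightarrow> 'a sset \<Rightarrow> nat
    \<Rightarrow> (nat \<Rightarrow> (nat \<Rightarrow> nat) \<Rightarrow> 'a) \<Rightarrow> ('i \<Rightarrow> nat \<Rightarrow> (nat \<Rightarrow> nat) \<Rightarrow> 'a) \<Rightarrow> 'a \<Rightarrow> ('i \<Rightarrow> 'a) \<Rightarrow> bool" where
  "cone_solution I X n b h y w \<longleftrightarrow> y \<in> simplices X (Suc n) \<and>
     extends_on (boundary (Suc n)) (yoneda_map X (Suc n) y) b \<and>
     (\<forall>i\<in>I. w i \<in> simplices X (Suc (Suc n)) \<and>
        extends_on (horn (Suc (Suc n)) (Suc (Suc n))) (yoneda_map X (Suc (Suc n)) (w i)) (h i) \<and>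
        act X (Suc n) (Suc (Suc n)) (\<lambda>t\<in>{..Suc n}. t) (w i) = y)"

lemma simplices_discrete [simp]: "simplices (discrete I) k = I"
  and constant_at_discrete [simp]: "constant_at (discrete I) k i = i"
  and vertex_of_discrete [simp]: "vertex_of (discrete I) k i = i"
  by (simp_all add: discrete_def constant_at_def vertex_of_def)

lemma simplicial_set_discrete [simp]: "simplicial_set (discrete I)"
  using constant_sset_discrete by (rule constant_sset_simplicial_set)

lemma cone_base_smap:
  assumes K: "simplicial_set K" and c: "c \<in> smap (join A K) X"
  shows "cone_base K c \<in> smap K X"
proof (rule smapI)
  fix m n \<alpha> x assume *: "\<alpha> \<in> Delta m n" "x \<in> simplices K n"
  then show "cone_base K c m (act K m n \<alpha> x) = act X m n \<alpha> (cone_base K c n x)"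
    using smap_natural[OF c *(1), of "InR x"] by (simp add: cone_base_def simplicial_set_simplices K)
qed (use smap_simplices[OF c] in \<open>simp_all add: cone_base_def\<close>)

lemma horn_last_eq:
  "simplices (horn (Suc n) (Suc n)) k = {\<gamma> \<in> Delta k (Suc n). \<not> {..n} \<subseteq> \<gamma> ` {..k} \<inter> {..n}}"
  by (auto simp: horn_last sub_simplex_def)

lemma boundary_subset_horn:
  assumes "\<beta> \<in> simplices (boundary n) k"
  shows "\<beta> \<in> simplices (horn (Suc n) (Suc n)) k"
proof -
  have "\<beta> \<in> Delta k n" "\<beta> ` {..k} \<noteq> {..n}" using assms by (simp_all add: simplices_boundary)
  moreover have "\<beta> ` {..k} \<subseteq> {..n}" using \<open>\<beta> \<in> Delta k n\<close> by (auto dest: Delta_le)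
  ultimately show ?thesis by (auto simp: horn_last_eq Delta_cod_mono)
qed

text \<open>The map \<open>t\<close> from a boundary to the slice over the base of \<open>c\<close> that has to be extended is, by currying, a
  map from the join with \<open>I\<close>, hence a boundary with a horn attached to it for each \<open>i\<close>. The last vertex
  of \<open>t\<close> being \<open>c\<close> fixes the last edges of the horns.\<close>

lemma limit_coneI:
  fixes X :: "'a sset" and I :: "'i set"
  assumes X: "simplicial_set X" and c: "c \<in> smap (join (simplex 0) (discrete I)) X"
    and fill: "\<And>n b h. cone_problem I X c n b h \<Longrightarrow> \<exists>y w. cone_solution I X n b h y w"
  shows "limit_cone (discrete I) X c"
proof -
  let ?K = "discrete I" and ?p = "cone_base (discrete I) c"
  let ?Y = "slice ?K X ?p"
  have p: "?p \<in> smap ?K X" by (rule cone_base_smap[OF _ c]) simp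
  note K = constant_sset_discrete[of I]
  have Y: "simplicial_set ?Y" by (rule simplicial_set_slice) simp
  have "\<exists>y\<in>simplices ?Y (Suc n). extends_on (boundary (Suc n)) (yoneda_map ?Y (Suc n) y) t"
    if t: "t \<in> smap (boundary (Suc n)) ?Y" and tc: "t 0 (\<lambda>i\<in>{..0}. Suc n) = c" for n t
  proof -
    let ?B = "boundary (Suc n)" and ?H = "horn (Suc (Suc n)) (Suc (Suc n))"
    define g where "g = uncurry_join ?B ?K ?p t"
    have g: "g \<in> smap (join ?B ?K) X"
      unfolding g_def by (rule uncurry_join_smap[OF _ _ p t]) simp_all
    define b where "b = (\<lambda>k. \<lambda>\<beta>\<in>simplices ?B k. g k (InL \<beta>))"
    define h where "h = (\<lambda>i k. \<lambda>\<gamma>\<in>simplices ?H k. g k (cone_simplex ?K (Suc n) i k \<gamma>))"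
    have last: "(\<lambda>i\<in>{..0}. Suc n) \<in> simplices ?B 0"
      by (auto simp: simplices_boundary)
    have b: "b \<in> smap ?B X"
    proof (rule smapI)
      fix m k \<alpha> \<beta> assume *: "\<alpha> \<in> Delta m k" "\<beta> \<in> simplices ?B k"
      then show "b m (act ?B m k \<alpha> \<beta>) = act X m k \<alpha> (b k \<beta>)"
        using smap_natural[OF g *(1), of "InL \<beta>"] simplicial_set_simplices[OF simplicial_set_boundary *]
        by (simp add: b_def)
    qed (use smap_simplices[OF g] in \<open>simp_all add: b_def\<close>)
    have h: "h i \<in> smap ?H X" if "i \<in> I" for i
      unfolding h_def horn_last
      by (rule cone_component_smap[OF K]) (use that g in \<open>simp_all add: boundary_sub_simplex\<close>)
    have "cone_problem I X c n b h"
      unfolding cone_problem_def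
    proof (intro conjI ballI)
      show "b \<in> smap ?B X" by (rule b)
      show "b 0 (\<lambda>i\<in>{..0}. Suc n) = c 0 (InL (\<lambda>i\<in>{..0}. i))"
        using last tc by (simp add: b_def g_def uncurry_join_def)
    next
      fix i assume i: "i \<in> I"
      then have i': "i \<in> simplices ?K 0" by simp
      show "h i \<in> smap ?H X" using h i by simp
      show "extends_on ?B (h i) b"
        using boundary_subset_horn
        by (auto simp: extends_on_def h_def b_def simplices_boundary cone_simplex_InL[OF K i'])
      let ?e = "last_edge (Suc n)"
      have "cone_simplex ?K (Suc n) i 1 ?e = Mid 0 0 (restrict ?e {..0}) (constant_at ?K 0 i)"
        by (rule cone_simplex_mid[OF K i' _ _ _ last_edge_Delta]) (auto simp: last_edge_def)
      also have "restrict ?e {..0} = (\<lambda>i\<in>{..0}. Suc n)" by (auto simp: last_edge_def)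
      finally have e: "cone_simplex ?K (Suc n) i 1 ?e = Mid 0 0 (\<lambda>i\<in>{..0}. Suc n) i"
        by (simp only: constant_at_discrete)
      have "h i 1 ?e = g 1 (cone_simplex ?K (Suc n) i 1 ?e)"
        unfolding h_def by (rule restrict_apply'[OF last_edge_in_horn])
      also have "\<dots> = g 1 (Mid 0 0 (\<lambda>i\<in>{..0}. Suc n) i)" by (simp only: e)
      also have "\<dots> = c 1 (Mid 0 0 (\<lambda>i\<in>{..0}. i) i)"
        using last i tc by (simp add: g_def uncurry_join_def)
      finally show "h i 1 ?e = c 1 (Mid 0 0 (\<lambda>i\<in>{..0}. i) i)" .
    qed
    then obtain y w where sol: "cone_solution I X n b h y w" using fill by blast
    have y: "y \<in> simplices X (Suc n)"
      and yb: "\<And>k \<beta>. \<beta> \<in> simplices ?B k \<Longrightarrow> yoneda_map X (Suc n) y k \<beta> = b k \<beta>"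
      and w: "\<And>i. i \<in> I \<Longrightarrow> w i \<in> simplices X (Suc (Suc n))"
      and wh: "\<And>i k \<gamma>. i \<in> I \<Longrightarrow> \<gamma> \<in> simplices ?H k \<Longrightarrow> yoneda_map X (Suc (Suc n)) (w i) k \<gamma> = h i k \<gamma>"
      and wy: "\<And>i. i \<in> I \<Longrightarrow> act X (Suc n) (Suc (Suc n)) (\<lambda>t\<in>{..Suc n}. t) (w i) = y"
      using sol unfolding cone_solution_def extends_on_def by simp_all
    let ?b = "yoneda_map X (Suc n) y" and ?w = "\<lambda>i. yoneda_map X (Suc (Suc n)) (w i)"
    \<comment> \<open>The solution is glued to a map from the join of the whole simplex with \<open>I\<close>.\<close>
    define G where "G = cone_glue (sub_simplex (Suc n) UNIV) ?K (Suc n) ?b ?w"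
    have S: "simplex (Suc n) = sub_simplex (Suc n) UNIV" "simplex (Suc (Suc n)) = sub_simplex (Suc (Suc n)) (cone_sieve (Suc n) UNIV)"
      by (simp_all add: simplex_sub_simplex)
    have b': "?b \<in> smap (sub_simplex (Suc n) UNIV) X"
      using yoneda_map_smap[OF X y] by (simp add: S)
    have w': "?w v \<in> smap (sub_simplex (Suc (Suc n)) (cone_sieve (Suc n) UNIV)) X" if "v \<in> simplices ?K 0" for v
      using yoneda_map_smap[OF X w] that by (simp add: S(2))
    have agree: "?w v k \<beta> = ?b k \<beta>" if v: "v \<in> simplices ?K 0" and "\<beta> \<in> simplices (sub_simplex (Suc n) UNIV) k" for v k \<beta>
    proof -
      have \<beta>: "\<beta> \<in> Delta k (Suc n)" using that by (simp add: simplices_sub_simplex)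
      have i: "(\<lambda>t\<in>{..Suc n}. t) \<in> Delta (Suc n) (Suc (Suc n))" by (rule DeltaI) auto
      have "?b k \<beta> = act X k (Suc n) \<beta> (act X (Suc n) (Suc (Suc n)) (\<lambda>t\<in>{..Suc n}. t) (w v))"
        using \<beta> v by (simp add: yoneda_map_apply wy)
      also have "\<dots> = act X k (Suc (Suc n)) \<beta> (w v)"
        using simplicial_set_comp[OF X \<beta> i w] v compose_id_left[OF \<beta>] by simp
      also have "\<dots> = ?w v k \<beta>" using \<beta> by (simp add: yoneda_map_apply Delta_cod_mono)
      finally show ?thesis ..
    qed
    have G: "G \<in> smap (join (simplex (Suc n)) ?K) X"
      unfolding G_def S by (rule cone_glue_smap[OF K sieve_UNIV b' w' agree])
    have Gg: "G k z = g k z" if z: "z \<in> simplices (join ?B ?K) k" for k z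
    proof (cases "\<exists>\<beta>. z = InL \<beta>")
      case True
      then show ?thesis using z yb
        by (auto simp: G_def cone_glue_InL simplices_sub_simplex simplices_boundary b_def)
    next
      case False
      then obtain v where v: "v \<in> I" and ov: "over_vertex ?K k v z" using z by (cases z) auto
      then have v': "v \<in> simplices ?K 0" by simp
      have z1: "z \<in> simplices (join (simplex (Suc n)) ?K) k" using z by (rule join_boundary_subset)
      have z2: "z \<in> simplices (join (sub_simplex (Suc n) UNIV) ?K) k"
        using z1 by (simp only: simplex_sub_simplex)
      have "cone_proj (Suc n) k z ` {..k} \<inter> {..Suc n} \<in> {V. \<not> {..Suc n} \<subseteq> V}"
        by (rule cone_proj_image[of _ _ _ ?K]) (use z in \<open>simp_all add: boundary_sub_simplex\<close>)
      then have pz: "cone_proj (Suc n) k z \<in> simplices ?H k"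
        using cone_proj_Delta[OF z1] by (simp add: horn_last_eq)
      have "G k z = ?w v k (cone_proj (Suc n) k z)"
        unfolding G_def by (rule cone_glue_over[OF K sieve_UNIV b' w' agree z2 v' ov])
      also have "\<dots> = g k (cone_simplex ?K (Suc n) v k (cone_proj (Suc n) k z))"
        using wh[OF v pz] pz by (simp add: h_def)
      also have "\<dots> = g k z" by (simp add: cone_simplex_cone_proj[OF K v' z1 ov])
      finally show ?thesis .
    qed
    have GY: "G \<in> simplices ?Y (Suc n)"
      unfolding simplices_slice
    proof (intro conjI allI ballI)
      fix m i assume "i \<in> simplices ?K m"
      then show "G m (InR i) = ?p m i" using Gg[of "InR i" m] by (simp add: g_def uncurry_join_InR)
    qed (rule G)
    moreover have "yoneda_map ?Y (Suc n) G k \<beta> = t k \<beta>" if \<beta>: "\<beta> \<in> simplices ?B k" for k \<beta>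
    proof (rule smap_eqI)
      have \<beta>': "\<beta> \<in> Delta k (Suc n)" using \<beta> by (simp add: simplices_boundary)
      show "yoneda_map ?Y (Suc n) G k \<beta> \<in> smap (join (simplex k) ?K) X"
        using simplicial_set_simplices[OF Y \<beta>' GY] by (simp add: yoneda_map_apply \<beta>' simplices_slice)
      show "t k \<beta> \<in> smap (join (simplex k) ?K) X"
        using smap_simplices[OF t \<beta>] by (simp add: simplices_slice)
      fix l z assume z: "z \<in> simplices (join (simplex k) ?K) l"
      have "t k \<beta> l z = g l (join_map (\<lambda>i \<alpha>. act ?B i k \<alpha> \<beta>) l z)"
        unfolding g_def by (rule slice_map_apply[OF t \<beta> _ z]) simp
      moreover have "join_map (\<lambda>i \<alpha>. act ?B i k \<alpha> \<beta>) l z \<in> simplices (join ?B ?K) l"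
        by (rule join_map_act_simplices[OF _ \<beta> z]) simp
      ultimately show "yoneda_map ?Y (Suc n) G k \<beta> l z = t k \<beta> l z"
        using z Gg by (simp add: yoneda_map_apply \<beta>' act_slice)
    qed
    ultimately show ?thesis by (auto simp: extends_on_def)
  qed
  moreover have "c \<in> simplices ?Y 0"
    using c by (auto simp: simplices_slice cone_base_def)
  ultimately show ?thesis
    unfolding limit_cone_def using c final_vertexI[OF Y] by blast
qed

text \<open>The same correspondence, read backwards.\<close>

lemma limit_coneD:
  fixes X :: "'a sset" and I :: "'i set"
  assumes X: "simplicial_set X" and c: "limit_cone (discrete I) X c" and P: "cone_problem I X c n b h"
  shows "\<exists>y w. cone_solution I X n b h y w"
proof -
  let ?K = "discrete I" and ?p = "cone_base (discrete I) c"
  let ?Y = "slice ?K X ?p"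
  let ?B = "boundary (Suc n)" and ?H = "horn (Suc (Suc n)) (Suc (Suc n))"
  have cs: "c \<in> smap (join (simplex 0) ?K) X" and cf: "final_vertex ?Y c"
    using c by (simp_all add: limit_cone_def)
  have p: "?p \<in> smap ?K X" by (rule cone_base_smap[OF _ cs]) simp
  note K = constant_sset_discrete[of I]
  have Y: "simplicial_set ?Y" by (rule simplicial_set_slice) simp
  have b: "b \<in> smap ?B X" and bc: "b 0 (\<lambda>i\<in>{..0}. Suc n) = c 0 (InL (\<lambda>i\<in>{..0}. i))"
    and h: "\<And>i. i \<in> I \<Longrightarrow> h i \<in> smap ?H X"
    and hb: "\<And>i k \<beta>. i \<in> I \<Longrightarrow> \<beta> \<in> simplices ?B k \<Longrightarrow> h i k \<beta> = b k \<beta>"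
    and hc: "\<And>i. i \<in> I \<Longrightarrow> h i 1 (last_edge (Suc n)) = c 1 (Mid 0 0 (\<lambda>i\<in>{..0}. i) i)"
    using P by (auto simp: cone_problem_def extends_on_def)
  define g where "g = cone_glue ?B ?K (Suc n) b h"
  have S: "?B = sub_simplex (Suc n) {V. \<not> {..Suc n} \<subseteq> V}" by (rule boundary_sub_simplex)
  have glue: "constant_sset ?K" "sieve {V. \<not> {..Suc n} \<subseteq> V}" "b \<in> smap (sub_simplex (Suc n) {V. \<not> {..Suc n} \<subseteq> V}) X"
    "\<And>v. v \<in> simplices ?K 0 \<Longrightarrow> h v \<in> smap (sub_simplex (Suc (Suc n)) (cone_sieve (Suc n) {V. \<not> {..Suc n} \<subseteq> V})) X"
    "\<And>v k \<beta>. v \<in> simplices ?K 0 \<Longrightarrow> \<beta> \<in> simplices (sub_simplex (Suc n) {V. \<not> {..Suc n} \<subseteq> V}) k \<Longrightarrow> h v k \<beta> = b k \<beta>"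
    using b h hb unfolding S horn_last by simp_all
  have g: "g \<in> smap (join ?B ?K) X"
    unfolding g_def S by (rule cone_glue_smap[OF glue])
  have go: "g k z = h v k (cone_proj (Suc n) k z)"
    if "z \<in> simplices (join ?B ?K) k" "v \<in> I" "over_vertex ?K k v z" for k z v
    unfolding g_def S by (rule cone_glue_over[OF glue]) (use that in \<open>simp_all add: S[symmetric]\<close>)
  have gL: "g k (InL \<beta>) = b k \<beta>" if "\<beta> \<in> simplices ?B k" for k \<beta>
    using that by (simp add: g_def cone_glue_InL)
  have last: "(\<lambda>i\<in>{..0}. Suc n) \<in> simplices ?B 0"
    by (auto simp: simplices_boundary)
  let ?e = "last_edge (Suc n)"
  \<comment> \<open>The values of \<open>h i\<close> on the degenerations of the last edge are those of \<open>c\<close>.\<close>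
  have hcz: "h v k (compose {..k} ?e (cone_proj 0 k z)) = c k z"
    if z: "z \<in> simplices (join (simplex 0) ?K) k" and v: "v \<in> I" and ov: "over_vertex ?K k v z" for k z v
  proof -
    have v': "v \<in> simplices ?K 0" using v by simp
    have s: "cone_proj 0 k z \<in> Delta k 1" using cone_proj_Delta[OF z] by simp
    have "c k z = c k (join_act (simplex 0) ?K k 1 (cone_proj 0 k z) (Mid 0 0 (\<lambda>i\<in>{..0}. i) v))"
      using cone_simplex_cone_proj[OF K v' z ov] by (simp add: cone_simplex_def)
    also have "\<dots> = act X k 1 (cone_proj 0 k z) (c 1 (Mid 0 0 (\<lambda>i\<in>{..0}. i) v))"
      using smap_natural[OF cs s, of "Mid 0 0 (\<lambda>i\<in>{..0}. i) v"] v by simp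
    also have "\<dots> = h v k (compose {..k} ?e (cone_proj 0 k z))"
      using smap_natural[OF h[OF v] s last_edge_in_horn] by (simp only: act_horn hc[OF v])
    finally show ?thesis ..
  qed
  have gp: "g m (InR i) = ?p m i" if "i \<in> simplices ?K m" for m i
  proof -
    have i: "i \<in> I" using that by simp
    have "compose {..m} ?e (cone_proj 0 m (InR i)) = (\<lambda>t\<in>{..m}. Suc (Suc n))"
      by (auto simp: compose_def fun_eq_iff last_edge_def)
    then show ?thesis
      using go[of "InR i" m i] hcz[of "InR i" m i] i by (simp add: cone_base_def)
  qed
  define t where "t = curry_join ?B ?K g"
  have t: "t \<in> smap ?B ?Y"
    unfolding t_def by (rule curry_join_smap[OF _ _ g gp]) simp_all
  have "t 0 (\<lambda>i\<in>{..0}. Suc n) = c"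
  proof (rule smap_eqI[OF _ cs])
    show "t 0 (\<lambda>i\<in>{..0}. Suc n) \<in> smap (join (simplex 0) ?K) X"
      using smap_simplices[OF t last] by (simp add: simplices_slice)
    fix k z assume z: "z \<in> simplices (join (simplex 0) ?K) k"
    let ?J = "join_map (\<lambda>i \<beta>. act ?B i 0 \<beta> (\<lambda>i\<in>{..0}. Suc n)) k z"
    have J: "?J \<in> simplices (join ?B ?K) k"
      by (rule join_map_act_simplices[OF _ last z]) simp
    have tJ: "t 0 (\<lambda>i\<in>{..0}. Suc n) k z = g k ?J"
      using last z by (simp add: t_def curry_join_def)
    show "t 0 (\<lambda>i\<in>{..0}. Suc n) k z = c k z"
    proof (cases "\<exists>\<beta>. z = InL \<beta>")
      case True
      then obtain \<beta> where \<beta>: "z = InL \<beta>" "\<beta> \<in> Delta k 0" using z by auto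
      have "g k ?J = act X k 0 \<beta> (b 0 (\<lambda>i\<in>{..0}. Suc n))"
        using J gL smap_natural[OF b \<beta>(2) last] by (simp add: \<beta>(1))
      also have "\<dots> = c k z"
        using smap_natural[OF cs \<beta>(2), of "InL (\<lambda>i\<in>{..0}. i)"] compose_id_left[OF \<beta>(2)]
        by (simp add: bc \<beta>(1))
      finally show ?thesis using tJ by simp
    next
      case False
      then obtain v where v: "v \<in> I" and ov: "over_vertex ?K k v z" using z by (cases z) auto
      have "over_vertex ?K k v ?J" using ov by (cases z) auto
      moreover have "cone_proj (Suc n) k ?J = compose {..k} ?e (cone_proj 0 k z)"
        using z False by (cases z) (auto simp: compose_def fun_eq_iff last_edge_def dest!: Delta_0_eq)
      ultimately show ?thesis using tJ go[OF J v] hcz[OF z v ov] by simp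
    qed
  qed
  then obtain Z where Z: "Z \<in> simplices ?Y (Suc n)"
    and Zt: "\<And>k \<beta>. \<beta> \<in> simplices ?B k \<Longrightarrow> yoneda_map ?Y (Suc n) Z k \<beta> = t k \<beta>"
    using final_vertexD[OF Y cf t] by (auto simp: extends_on_def)
  have Zs: "Z \<in> smap (join (simplex (Suc n)) ?K) X" and Zp: "\<And>m i. i \<in> I \<Longrightarrow> Z m (InR i) = ?p m i"
    using Z by (auto simp: simplices_slice)
  have tZ: "t m \<beta> k z = Z k (join_map (\<lambda>i. compose {..i} \<beta>) k z)"
    if "\<beta> \<in> simplices ?B m" "z \<in> simplices (join (simplex m) ?K) k" for m \<beta> k z
    using that Zt[OF that(1), symmetric] by (simp add: yoneda_map_apply simplices_boundary act_slice)
  have Zg: "Z k z = g k z" if z: "z \<in> simplices (join ?B ?K) k" for k z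
  proof -
    have "g k z = uncurry_join ?B ?K ?p t k z"
      unfolding t_def by (rule uncurry_curry_join[symmetric]) (simp_all add: z gp)
    also have "\<dots> = Z k z"
    proof (cases z)
      case (InL \<beta>)
      then have "\<beta> \<in> simplices ?B k" "\<beta> \<in> Delta k (Suc n)" using z by (auto simp: simplices_boundary)
      then show ?thesis using z by (simp add: InL uncurry_join_def tZ compose_id_right)
    next
      case (InR i)
      then show ?thesis using z by (simp add: uncurry_join_def Zp)
    next
      case (Mid i j \<beta> x)
      then have "\<beta> \<in> simplices ?B i" "\<beta> \<in> Delta i (Suc n)" using z by (auto simp: simplices_boundary)
      then show ?thesis using z by (simp add: Mid uncurry_join_def tZ compose_id_right)
    qed
    finally show ?thesis ..
  qed
  \<comment> \<open>A simplex \<open>Z\<close> of the slice is itself a map from a join, whose nondegenerate simplices are read off.\<close>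
  define y where "y = Z (Suc n) (InL (\<lambda>i\<in>{..Suc n}. i))"
  define w where "w = (\<lambda>i. Z (Suc (Suc n)) (Mid (Suc n) 0 (\<lambda>i\<in>{..Suc n}. i) i))"
  have y: "y \<in> simplices X (Suc n)" unfolding y_def by (rule smap_simplices[OF Zs]) simp
  have w: "w i \<in> simplices X (Suc (Suc n))" if "i \<in> I" for i
    unfolding w_def by (rule smap_simplices[OF Zs]) (use that in simp)
  have yZ: "act X k (Suc n) \<beta> y = Z k (InL \<beta>)" if "\<beta> \<in> Delta k (Suc n)" for k \<beta>
    using smap_natural[OF Zs that, of "InL (\<lambda>i\<in>{..Suc n}. i)"] by (simp add: y_def compose_id_left[OF that])
  have wZ: "act X k (Suc (Suc n)) \<gamma> (w i) = Z k (cone_simplex ?K (Suc n) i k \<gamma>)"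
    if "\<gamma> \<in> Delta k (Suc (Suc n))" "i \<in> I" for k \<gamma> i
    using smap_natural[OF Zs that(1), of "Mid (Suc n) 0 (\<lambda>i\<in>{..Suc n}. i) i"] that(2)
    by (simp add: w_def cone_simplex_def)
  have "yoneda_map X (Suc n) y k \<beta> = b k \<beta>" if \<beta>: "\<beta> \<in> simplices ?B k" for k \<beta>
  proof -
    have "\<beta> \<in> Delta k (Suc n)" using \<beta> by (simp add: simplices_boundary)
    then show ?thesis using \<beta> by (simp add: yoneda_map_apply yZ Zg gL)
  qed
  moreover have "yoneda_map X (Suc (Suc n)) (w i) k \<gamma> = h i k \<gamma>"
    if i: "i \<in> I" and \<gamma>: "\<gamma> \<in> simplices ?H k" for i k \<gamma>
  proof -
    have \<gamma>': "\<gamma> \<in> Delta k (Suc (Suc n))" "\<gamma> ` {..k} \<inter> {..Suc n} \<in> {V. \<not> {..Suc n} \<subseteq> V}"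
      using \<gamma> unfolding horn_last_eq by simp_all
    have i': "i \<in> simplices ?K 0" using i by simp
    have s: "cone_simplex ?K (Suc n) i k \<gamma> \<in> simplices (join ?B ?K) k"
      unfolding S by (rule cone_simplex_simplices[OF K i' \<gamma>'(1) _ \<gamma>'(2)]) simp
    show ?thesis
      using go[OF s i over_vertex_cone_simplex[OF K i' \<gamma>'(1)]]
      by (simp add: yoneda_map_apply \<gamma>'(1) wZ i Zg[OF s] cone_proj_cone_simplex[OF K i' \<gamma>'(1)])
  qed
  moreover have "act X (Suc n) (Suc (Suc n)) (\<lambda>t\<in>{..Suc n}. t) (w i) = y" if "i \<in> I" for i
  proof -
    have "(\<lambda>t\<in>{..Suc n}. t) \<in> Delta (Suc n) (Suc (Suc n))" by (rule DeltaI) auto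
    then show ?thesis
      using that cone_simplex_InL[OF K, of i "\<lambda>t\<in>{..Suc n}. t" "Suc n" "Suc n"] by (simp add: wZ y_def)
  qed
  ultimately have "cone_solution I X n b h y w"
    using y w by (simp add: cone_solution_def extends_on_def)
  then show ?thesis by blast
qed

section \<open>Diagrams of finite sets\<close>

lemma fin_functorsI:
  assumes "\<And>p. p \<in> P \<Longrightarrow> finite (Ob p)" "Ob \<in> extensional P"
    and "\<And>p q. p \<in> P \<Longrightarrow> q \<in> P \<Longrightarrow> le p q \<Longrightarrow> Mor p q \<in> Ob p \<rightarrow>\<^sub>E Ob q"
    and "\<And>p q. \<not> (p \<in> P \<and> q \<in> P \<and> le p q) \<Longrightarrow> Mor p q = undefined"
    and "\<And>p x. p \<in> P \<Longrightarrow> x \<in> Ob p \<Longrightarrow> Mor p p x = x" "\<And>p. p \<in> P \<Longrightarrow> le p p"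
    and "\<And>p q r x. p \<in> P \<Longrightarrow> q \<in> P \<Longrightarrow> r \<in> P \<Longrightarrow> le p q \<Longrightarrow> le q r \<Longrightarrow> x \<in> Ob p \<Longrightarrow> Mor p r x = Mor q r (Mor p q x)"
    and trans: "\<And>p q r. p \<in> P \<Longrightarrow> q \<in> P \<Longrightarrow> r \<in> P \<Longrightarrow> le p q \<Longrightarrow> le q r \<Longrightarrow> le p r"
  shows "(Ob, Mor) \<in> fin_functors P le"
proof -
  have ids: "Mor p p = (\<lambda>x\<in>Ob p. x)" if "p \<in> P" for p
    using assms(3)[of p p] assms(5)[OF that] assms(6) that
    by (intro extensionalityI[of _ "Ob p"]) (auto simp: PiE_def)
  have comps: "Mor p r = compose (Ob p) (Mor q r) (Mor p q)"
    if "p \<in> P" "q \<in> P" "r \<in> P" "le p q" "le q r" for p q r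
    using assms(3)[of p r] assms(7)[OF that] trans[OF that] that
    by (intro extensionalityI[of _ "Ob p"]) (auto simp: PiE_def compose_def)
  have obs: "Ob \<in> P \<rightarrow>\<^sub>E {A. finite A}" using assms(1,2) by (auto simp: PiE_def)
  have mors: "if p \<in> P \<and> q \<in> P \<and> le p q then Mor p q \<in> Ob p \<rightarrow>\<^sub>E Ob q else Mor p q = undefined" for p q
    using assms(3,4)[of p q] by (cases "p \<in> P \<and> q \<in> P \<and> le p q") auto
  show ?thesis
    unfolding fin_functors_def mem_Collect_eq case_prod_conv
    by (intro conjI ballI allI impI) (fact obs mors | rule ids comps; assumption)+
qed

lemma fin_functors_finite: "F \<in> fin_functors P le \<Longrightarrow> p \<in> P \<Longrightarrow> finite (fst F p)"
  and fin_functors_Ob_ext: "F \<in> fin_functors P le \<Longrightarrow> fst F \<in> extensional P"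
  and fin_functors_Mor: "F \<in> fin_functors P le \<Longrightarrow> p \<in> P \<Longrightarrow> q \<in> P \<Longrightarrow> le p q \<Longrightarrow>
        snd F p q \<in> fst F p \<rightarrow>\<^sub>E fst F q"
  and fin_functors_undefined: "F \<in> fin_functors P le \<Longrightarrow> \<not> (p \<in> P \<and> q \<in> P \<and> le p q) \<Longrightarrow>
        snd F p q = undefined"
  and fin_functors_id: "F \<in> fin_functors P le \<Longrightarrow> p \<in> P \<Longrightarrow> snd F p p = (\<lambda>x\<in>fst F p. x)"
  and fin_functors_comp: "F \<in> fin_functors P le \<Longrightarrow> p \<in> P \<Longrightarrow> q \<in> P \<Longrightarrow> r \<in> P \<Longrightarrow> le p q \<Longrightarrow> le q r \<Longrightarrow>
        snd F p r = compose (fst F p) (snd F q r) (snd F p q)"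
proof -
  have *: "if p \<in> P \<and> q \<in> P \<and> le p q then snd F p q \<in> fst F p \<rightarrow>\<^sub>E fst F q else snd F p q = undefined"
    if "F \<in> fin_functors P le" for p q
    using that by (simp add: fin_functors_def case_prod_beta)
  show "F \<in> fin_functors P le \<Longrightarrow> p \<in> P \<Longrightarrow> finite (fst F p)"
    by (auto simp: fin_functors_def PiE_def Pi_def)
  show "F \<in> fin_functors P le \<Longrightarrow> fst F \<in> extensional P"
    by (auto simp: fin_functors_def PiE_def)
  show "F \<in> fin_functors P le \<Longrightarrow> p \<in> P \<Longrightarrow> q \<in> P \<Longrightarrow> le p q \<Longrightarrow> snd F p q \<in> fst F p \<rightarrow>\<^sub>E fst F q"
    using *[of p q] by simp
  show "F \<in> fin_functors P le \<Longrightarrow> \<not> (p \<in> P \<and> q \<in> P \<and> le p q) \<Longrightarrow> snd F p q = undefined"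
    using *[of p q] by (simp split: if_splits)
  show "F \<in> fin_functors P le \<Longrightarrow> p \<in> P \<Longrightarrow> snd F p p = (\<lambda>x\<in>fst F p. x)"
    by (auto simp: fin_functors_def)
  show "F \<in> fin_functors P le \<Longrightarrow> p \<in> P \<Longrightarrow> q \<in> P \<Longrightarrow> r \<in> P \<Longrightarrow> le p q \<Longrightarrow> le q r \<Longrightarrow>
        snd F p r = compose (fst F p) (snd F q r) (snd F p q)"
    by (auto simp: fin_functors_def)
qed

lemma fin_functors_Mor_in: "F \<in> fin_functors P le \<Longrightarrow> p \<in> P \<Longrightarrow> q \<in> P \<Longrightarrow> le p q \<Longrightarrow> x \<in> fst F p \<Longrightarrow>
    snd F p q x \<in> fst F q"
  using fin_functors_Mor by fastforce

lemma fin_functors_eqI: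
  assumes F: "F \<in> fin_functors P le" and G: "G \<in> fin_functors P le"
    and ob: "\<And>p. p \<in> P \<Longrightarrow> fst F p = fst G p"
    and mor: "\<And>p q. p \<in> P \<Longrightarrow> q \<in> P \<Longrightarrow> le p q \<Longrightarrow> snd F p q = snd G p q"
  shows "F = G"
proof -
  have "fst F = fst G"
    by (rule extensionalityI[OF fin_functors_Ob_ext[OF F] fin_functors_Ob_ext[OF G] ob])
  moreover have "snd F p q = snd G p q" for p q
    using mor fin_functors_undefined[OF F, of p q] fin_functors_undefined[OF G, of p q]
    by (cases "p \<in> P \<and> q \<in> P \<and> le p q") auto
  ultimately show ?thesis by (auto simp: prod_eq_iff fun_eq_iff)
qed

lemma precompose_fin_functors:
  assumes F: "F \<in> fin_functors Q leQ" and a: "\<And>p. p \<in> P \<Longrightarrow> a p \<in> Q"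
    and mono: "\<And>p q. p \<in> P \<Longrightarrow> q \<in> P \<Longrightarrow> le p q \<Longrightarrow> leQ (a p) (a q)"
    and refl: "\<And>p. p \<in> P \<Longrightarrow> le p p"
    and trans: "\<And>p q r. p \<in> P \<Longrightarrow> q \<in> P \<Longrightarrow> r \<in> P \<Longrightarrow> le p q \<Longrightarrow> le q r \<Longrightarrow> le p r"
  shows "precompose P le a F \<in> fin_functors P le"
  unfolding precompose_def
proof (rule fin_functorsI)
  fix p q r x
  assume *: "p \<in> P" "q \<in> P" "r \<in> P" "le p q" "le q r" "x \<in> (\<lambda>p\<in>P. fst F (a p)) p"
  then show "(if p \<in> P \<and> r \<in> P \<and> le p r then snd F (a p) (a r) else undefined) x
    = (if q \<in> P \<and> r \<in> P \<and> le q r then snd F (a q) (a r) else undefined)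
       ((if p \<in> P \<and> q \<in> P \<and> le p q then snd F (a p) (a q) else undefined) x)"
    using trans[OF *(1-5)] fin_functors_comp[OF F a a a, of p q r] by (simp add: mono compose_eq)
next
  fix p q assume *: "p \<in> P" "q \<in> P" "le p q"
  then show "(if p \<in> P \<and> q \<in> P \<and> le p q then snd F (a p) (a q) else undefined)
      \<in> (\<lambda>p\<in>P. fst F (a p)) p \<rightarrow>\<^sub>E (\<lambda>p\<in>P. fst F (a p)) q"
    using fin_functors_Mor[OF F a a mono, OF *(1,2,1,2,3)] by simp
next
  fix p x assume *: "p \<in> P" "x \<in> (\<lambda>p\<in>P. fst F (a p)) p"
  then show "(if p \<in> P \<and> p \<in> P \<and> le p p then snd F (a p) (a p) else undefined) x = x"
    using fin_functors_id[OF F a] refl by simp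
next
  fix p assume "p \<in> P"
  then show "finite ((\<lambda>p\<in>P. fst F (a p)) p)" using fin_functors_finite[OF F a] by simp
next
  fix p q r assume "p \<in> P" "q \<in> P" "r \<in> P" "le p q" "le q r"
  then show "le p r" by (rule trans)
qed (auto intro: refl)

lemma precompose_id:
  assumes F: "F \<in> fin_functors P le" and a: "\<And>p. p \<in> P \<Longrightarrow> a p = p"
  shows "precompose P le a F = F"
proof -
  have "(\<lambda>p\<in>P. fst F (a p)) = fst F"
    using a fin_functors_Ob_ext[OF F] by (intro extensionalityI[of _ P]) auto
  moreover have "(if p \<in> P \<and> q \<in> P \<and> le p q then snd F (a p) (a q) else undefined) = snd F p q" for p q
    using a fin_functors_undefined[OF F, of p q] by auto
  ultimately show ?thesis by (simp add: precompose_def)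
qed

lemma precompose_precompose:
  assumes "\<And>p. p \<in> P \<Longrightarrow> b p \<in> Q" "\<And>p. p \<in> P \<Longrightarrow> c p = a (b p)"
    and "\<And>p q. p \<in> P \<Longrightarrow> q \<in> P \<Longrightarrow> le p q \<Longrightarrow> leQ (b p) (b q)"
  shows "precompose P le b (precompose Q leQ a F) = precompose P le c F"
  using assms by (auto simp: precompose_def fun_eq_iff restrict_def)

lemma simplices_Fin_op: "simplices Fin_op n = fin_functors {..n} (\<ge>)"
  and act_Fin_op: "act Fin_op m n \<alpha> = precompose {..m} (\<ge>) \<alpha>"
  by (simp_all add: Fin_op_def)

lemma simplicial_set_Fin_op: "simplicial_set Fin_op"
  unfolding simplicial_set_def simplices_Fin_op act_Fin_op
proof (intro conjI allI ballI)
  fix m n \<alpha> x assume "\<alpha> \<in> Delta m n" "(x :: (nat, 'a) diagram) \<in> fin_functors {..n} (\<ge>)"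
  then show "precompose {..m} (\<ge>) \<alpha> x \<in> fin_functors {..m} (\<ge>)"
    by (intro precompose_fin_functors[where Q = "{..n}" and leQ = "(\<ge>)"]) (auto intro: Delta_le Delta_mono)
next
  fix n and x :: "(nat, 'a) diagram" assume "x \<in> fin_functors {..n} (\<ge>)"
  then show "precompose {..n} (\<ge>) (\<lambda>i\<in>{..n}. i) x = x" by (rule precompose_id) auto
next
  fix k m n \<beta> \<alpha> and x :: "(nat, 'a) diagram" assume "\<beta> \<in> Delta k m" "\<alpha> \<in> Delta m n"
  then show "precompose {..k} (\<ge>) (compose {..k} \<alpha> \<beta>) x = precompose {..k} (\<ge>) \<beta> (precompose {..m} (\<ge>) \<alpha> x)"
    by (intro precompose_precompose[symmetric]) (auto intro: Delta_le Delta_mono simp: compose_eq)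
qed

lemma fin_pullbackI:
  assumes f: "\<And>a. a \<in> A \<Longrightarrow> f a \<in> B" and g: "\<And>a. a \<in> A \<Longrightarrow> g a \<in> C"
    and comm: "\<And>a. a \<in> A \<Longrightarrow> h (f a) = k (g a)"
    and ex: "\<And>b c. b \<in> B \<Longrightarrow> c \<in> C \<Longrightarrow> h b = k c \<Longrightarrow> \<exists>!a. a \<in> A \<and> f a = b \<and> g a = c"
  shows "fin_pullback A B C f g h k"
  unfolding fin_pullback_def
proof (intro conjI allI impI)
  show "compose A h f = compose A k g" using comm by (auto simp: compose_def fun_eq_iff)
  fix T :: "'a set" and s t
  assume s: "s \<in> T \<rightarrow>\<^sub>E B" and t: "t \<in> T \<rightarrow>\<^sub>E C" and st: "compose T h s = compose T k t"
  have eq: "h (s x) = k (t x)" if "x \<in> T" for x using fun_cong[OF st, of x] that by (simp add: compose_def)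
  let ?P = "\<lambda>x a. a \<in> A \<and> f a = s x \<and> g a = t x"
  have P: "\<exists>!a. ?P x a" if "x \<in> T" for x
    by (rule ex[OF _ _ eq[OF that]]) (use s t that in auto)
  define u where "u = (\<lambda>x\<in>T. THE a. ?P x a)"
  have u: "?P x (u x)" if "x \<in> T" for x using theI'[OF P[OF that]] that by (simp add: u_def)
  show "\<exists>!u. u \<in> T \<rightarrow>\<^sub>E A \<and> compose T f u = s \<and> compose T g u = t"
  proof (rule ex1I[of _ u])
    show "u \<in> T \<rightarrow>\<^sub>E A \<and> compose T f u = s \<and> compose T g u = t"
      using u s t by (auto simp: u_def compose_def PiE_def extensional_def fun_eq_iff)
    fix v assume v: "v \<in> T \<rightarrow>\<^sub>E A \<and> compose T f v = s \<and> compose T g v = t"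
    show "v = u"
    proof (rule extensionalityI[of _ T])
      fix x assume x: "x \<in> T"
      then have "?P x (v x)" using v by (auto simp: compose_def)
      then show "v x = u x" using u[OF x] P[OF x] by blast
    qed (use v in \<open>auto simp: u_def PiE_def\<close>)
  qed
qed

lemma fin_pullback_universal:
  fixes A T :: "'u set"
  assumes "fin_pullback A B C f g h k"
    and "finite T" "s \<in> T \<rightarrow>\<^sub>E B" "t \<in> T \<rightarrow>\<^sub>E C" "compose T h s = compose T k t"
  shows "\<exists>!u. u \<in> T \<rightarrow>\<^sub>E A \<and> compose T f u = s \<and> compose T g u = t"
  by (rule conjunct2[OF assms(1)[unfolded fin_pullback_def], rule_format, OF assms(2-5)])

text \<open>The elements of a set are the maps from a one-element set.\<close>

lemma fin_pullback_ex1: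
  fixes A :: "'u set"
  assumes P: "fin_pullback A B C f g h k" and b: "b \<in> B" and c: "c \<in> C" and e: "h b = k c"
  shows "\<exists>!a. a \<in> A \<and> f a = b \<and> g a = c"
proof -
  let ?T = "{undefined :: 'u}"
  have "compose ?T h (\<lambda>_\<in>?T. b) = compose ?T k (\<lambda>_\<in>?T. c)" using e by (auto simp: compose_def)
  then have ex: "\<exists>!u. u \<in> ?T \<rightarrow>\<^sub>E A \<and> compose ?T f u = (\<lambda>_\<in>?T. b) \<and> compose ?T g u = (\<lambda>_\<in>?T. c)"
    (is "\<exists>!u. ?Q u")
    by (intro fin_pullback_universal[OF P]) (use b c in auto)
  define u where "u = (THE u. ?Q u)"
  have u: "u \<in> ?T \<rightarrow>\<^sub>E A" "compose ?T f u = (\<lambda>_\<in>?T. b)" "compose ?T g u = (\<lambda>_\<in>?T. c)"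
    using theI'[OF ex] by (simp_all add: u_def)
  show ?thesis
  proof (rule ex1I[of _ "u undefined"])
    have "f (u undefined) = b" using fun_cong[OF u(2), of undefined] by (simp add: compose_def)
    moreover have "g (u undefined) = c" using fun_cong[OF u(3), of undefined] by (simp add: compose_def)
    ultimately show "u undefined \<in> A \<and> f (u undefined) = b \<and> g (u undefined) = c" using u(1) by auto
    fix a assume "a \<in> A \<and> f a = b \<and> g a = c"
    then have "?Q (\<lambda>_\<in>?T. a)" by (auto simp: compose_def)
    then have "(\<lambda>_\<in>?T. a) = u" unfolding u_def by (rule the1_equality[OF ex, symmetric])
    then show "a = u undefined" by auto
  qed
qed

lemma fin_pullback_swap:
  assumes "fin_pullback A B C f g h k" shows "fin_pullback A C B g f k h"
  unfolding fin_pullback_def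
proof (intro conjI allI impI)
  show "compose A k g = compose A h f" using assms by (simp add: fin_pullback_def)
  fix T :: "'a set" and s t
  assume "finite T" "s \<in> T \<rightarrow>\<^sub>E C" "t \<in> T \<rightarrow>\<^sub>E B" "compose T k s = compose T h t"
  then have "\<exists>!u. u \<in> T \<rightarrow>\<^sub>E A \<and> compose T f u = t \<and> compose T g u = s"
    by (intro fin_pullback_universal[OF assms]) auto
  then show "\<exists>!u. u \<in> T \<rightarrow>\<^sub>E A \<and> compose T g u = s \<and> compose T f u = t"
    by (simp only: conj_commute)
qed

lemma fin_pullback_id:
  assumes F: "F \<in> fin_functors P le" and "p \<in> P" "q \<in> P" "le p q"
  shows "fin_pullback (fst F p) (fst F p) (fst F q) (snd F p p) (snd F p q) (snd F p q) (snd F q q)"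
  using assms fin_functors_id[OF F] fin_functors_Mor_in[OF assms] by (intro fin_pullbackI) auto


section \<open>Simplices of Span\<close>

lemma Ivl_iff [simp]: "(i, j) \<in> Ivl n \<longleftrightarrow> i \<le> j \<and> j \<le> n"
  by (auto simp: Ivl_def)

lemma ivl_le_iff: "k \<le> l \<Longrightarrow> ivl_le (i, j) (k, l) \<longleftrightarrow> i \<le> k \<and> l \<le> j"
  by (auto simp: ivl_le_def)

lemma ivl_leI: "i \<le> k \<Longrightarrow> l \<le> j \<Longrightarrow> ivl_le (i, j) (k, l)"
  by (auto simp: ivl_le_def)

lemma ivl_meet_iff: "ivl_meet (i, j) (k, l) \<longleftrightarrow> max i k \<le> min j l"
  by (auto simp: ivl_meet_def disjoint_iff intro!: exI[of _ "max i k"])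

lemma ivl_le_refl: "ivl_le I I"
  and ivl_le_trans: "ivl_le I J \<Longrightarrow> ivl_le J K \<Longrightarrow> ivl_le I K"
  by (auto simp: ivl_le_def)

lemma simplices_Span: "simplices Span n = span_simplices n"
  and act_Span: "act Span m n \<alpha> = precompose (Ivl m) ivl_le (\<lambda>(i, j). (\<alpha> i, \<alpha> j))"
  by (simp_all add: Span_def)

lemma span_simplices_fin_functors: "F \<in> span_simplices n \<Longrightarrow> F \<in> fin_functors (Ivl n) ivl_le"
  by (simp add: span_simplices_def)

text \<open>A monotone map preserves unions and intersections of intervals, as it preserves maxima and minima.\<close>

lemma precompose_span_simplices:
  assumes \<alpha>: "\<alpha> \<in> Delta m n" and F: "F \<in> span_simplices n"
  shows "precompose (Ivl m) ivl_le (\<lambda>(i, j). (\<alpha> i, \<alpha> j)) F \<in> span_simplices m"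
proof -
  let ?a = "\<lambda>(i, j). (\<alpha> i, \<alpha> j)"
  note le = Delta_le[OF \<alpha>] and mono = Delta_mono[OF \<alpha>]
  have a: "?a I \<in> Ivl n" if "I \<in> Ivl m" for I
    using that le mono by (cases I) auto
  have am: "ivl_le (?a I) (?a J)" if "I \<in> Ivl m" "J \<in> Ivl m" "ivl_le I J" for I J
    using that mono by (cases I; cases J) (auto simp: ivl_le_iff)
  have F': "precompose (Ivl m) ivl_le ?a F \<in> fin_functors (Ivl m) ivl_le"
    by (rule precompose_fin_functors[OF span_simplices_fin_functors[OF F] a am])
      (auto intro: ivl_le_refl ivl_le_trans)
  have "fin_pullback (fst (precompose (Ivl m) ivl_le ?a F) (ivl_union I J))
         (fst (precompose (Ivl m) ivl_le ?a F) I) (fst (precompose (Ivl m) ivl_le ?a F) J)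
         (snd (precompose (Ivl m) ivl_le ?a F) (ivl_union I J) I)
         (snd (precompose (Ivl m) ivl_le ?a F) (ivl_union I J) J)
         (snd (precompose (Ivl m) ivl_le ?a F) I (ivl_inter I J))
         (snd (precompose (Ivl m) ivl_le ?a F) J (ivl_inter I J))"
    if I: "I \<in> Ivl m" and J: "J \<in> Ivl m" and IJ: "ivl_meet I J" for I J
  proof -
    obtain i j k l where ij: "I = (i, j)" "J = (k, l)" by (metis surj_pair)
    have b: "i \<le> j" "j \<le> m" "k \<le> l" "l \<le> m" "max i k \<le> min j l"
      using I J IJ by (auto simp: ij ivl_meet_iff)
    have mx: "\<alpha> (max x y) = max (\<alpha> x) (\<alpha> y)" "\<alpha> (min x y) = min (\<alpha> x) (\<alpha> y)" if "x \<le> m" "y \<le> m" for x y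
      using mono[of x y] mono[of y x] that by (cases "x \<le> y"; simp add: max_def min_def)+
    have u: "?a (ivl_union I J) = ivl_union (?a I) (?a J)" "?a (ivl_inter I J) = ivl_inter (?a I) (?a J)"
      using b by (simp_all add: ij ivl_union_def ivl_inter_def mx)
    have "\<alpha> (max i k) \<le> \<alpha> (min j l)" by (rule mono) (use b in auto)
    moreover have "\<alpha> (max i k) = max (\<alpha> i) (\<alpha> k)" "\<alpha> (min j l) = min (\<alpha> j) (\<alpha> l)"
      using b by (auto intro!: mx)
    ultimately have "max (\<alpha> i) (\<alpha> k) \<le> min (\<alpha> j) (\<alpha> l)" by (simp only:)
    then have meet: "ivl_meet (?a I) (?a J)" by (simp add: ij ivl_meet_iff)
    have UI: "ivl_union I J \<in> Ivl m" "ivl_inter I J \<in> Ivl m" "ivl_le (ivl_union I J) I"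
      "ivl_le (ivl_union I J) J" "ivl_le I (ivl_inter I J)" "ivl_le J (ivl_inter I J)"
      using b by (auto simp: ij ivl_union_def ivl_inter_def ivl_le_iff)
    show ?thesis
      using F a[OF I] a[OF J] meet I J UI
      by (simp add: precompose_def span_simplices_def u del: split_paired_All)
  qed
  then show ?thesis using F' by (simp add: span_simplices_def)
qed

lemma simplicial_set_Span: "simplicial_set Span"
  unfolding simplicial_set_def simplices_Span act_Span
proof (intro conjI allI ballI)
  fix n and x :: "(nat \<times> nat, 'a) diagram" assume "x \<in> span_simplices n"
  then show "precompose (Ivl n) ivl_le (\<lambda>(i, j). (restrict (\<lambda>i. i) {..n} i, restrict (\<lambda>i. i) {..n} j)) x = x"
    by (intro precompose_id[OF span_simplices_fin_functors]) auto
next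
  fix k m n \<beta> \<alpha> and x :: "(nat \<times> nat, 'a) diagram" assume *: "\<beta> \<in> Delta k m" "\<alpha> \<in> Delta m n"
  have "ivl_le (\<beta> i, \<beta> j) (\<beta> i', \<beta> j')" if "i \<le> i'" "i' \<le> j'" "j' \<le> j" "j \<le> k" for i j i' j'
    by (rule ivl_leI; rule Delta_mono[OF *(1)]) (use that in auto)
  then show "precompose (Ivl k) ivl_le (\<lambda>(i, j). (compose {..k} \<alpha> \<beta> i, compose {..k} \<alpha> \<beta> j)) x =
      precompose (Ivl k) ivl_le (\<lambda>(i, j). (\<beta> i, \<beta> j)) (precompose (Ivl m) ivl_le (\<lambda>(i, j). (\<alpha> i, \<alpha> j)) x)"
    using * by (intro precompose_precompose[symmetric])
      (auto simp: compose_eq ivl_le_iff Delta_le intro: Delta_mono)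
qed (rule precompose_span_simplices)

text \<open>A diagram on the intervals is given by its values and by the maps that shorten an interval on
  the right and on the left: \<open>L i j k\<close> restricts from \<open>(i,\<dots>,k)\<close> to \<open>(i,\<dots>,j)\<close>, and \<open>R i j k\<close>
  restricts from \<open>(i,\<dots>,k)\<close> to \<open>(j,\<dots>,k)\<close>. All conditions on these data, including the pullback
  condition, involve at most four vertices.\<close>

definition span_quad :: "(nat \<Rightarrow> nat \<Rightarrow> 'u set) \<Rightarrow> (nat \<Rightarrow> nat \<Rightarrow> nat \<Rightarrow> 'u \<Rightarrow> 'u)
    \<Rightarrow> (nat \<Rightarrow> nat \<Rightarrow> nat \<Rightarrow> 'u \<Rightarrow> 'u) \<Rightarrow> nat \<Rightarrow> nat \<Rightarrow> nat \<Rightarrow> nat \<Rightarrow> bool" where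
  "span_quad ob L R i j k l \<longleftrightarrow>
     finite (ob i l) \<and> L i k l \<in> ob i l \<rightarrow>\<^sub>E ob i k \<and> R i k l \<in> ob i l \<rightarrow>\<^sub>E ob k l \<and>
     (\<forall>x\<in>ob i l. L i l l x = x \<and> R i i l x = x \<and>
        L i j k (L i k l x) = L i j l x \<and> R j k l (R i j l x) = R i k l x \<and>
        R i j k (L i k l x) = L j k l (R i j l x)) \<and>
     (\<forall>x\<in>ob i k. \<forall>y\<in>ob k l. R i k k x = L k k l y \<longrightarrow>
        (\<exists>!z. z \<in> ob i l \<and> L i k l z = x \<and> R i k l z = y))"

definition span_data :: "nat set \<Rightarrow> (nat \<Rightarrow> nat \<Rightarrow> 'u set) \<Rightarrow> (nat \<Rightarrow> nat \<Rightarrow> nat \<Rightarrow> 'u \<Rightarrow> 'u)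
    \<Rightarrow> (nat \<Rightarrow> nat \<Rightarrow> nat \<Rightarrow> 'u \<Rightarrow> 'u) \<Rightarrow> bool" where
  "span_data V ob L R \<longleftrightarrow> (\<forall>i\<in>V. \<forall>j\<in>V. \<forall>k\<in>V. \<forall>l\<in>V. i \<le> j \<longrightarrow> j \<le> k \<longrightarrow> k \<le> l \<longrightarrow> span_quad ob L R i j k l)"

definition span_diagram :: "nat \<Rightarrow> (nat \<Rightarrow> nat \<Rightarrow> 'u set) \<Rightarrow> (nat \<Rightarrow> nat \<Rightarrow> nat \<Rightarrow> 'u \<Rightarrow> 'u)
    \<Rightarrow> (nat \<Rightarrow> nat \<Rightarrow> nat \<Rightarrow> 'u \<Rightarrow> 'u) \<Rightarrow> (nat \<times> nat, 'u) diagram" where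
  "span_diagram n ob L R = ((\<lambda>I\<in>Ivl n. ob (fst I) (snd I)),
     (\<lambda>I J. if I \<in> Ivl n \<and> J \<in> Ivl n \<and> ivl_le I J
        then compose (ob (fst I) (snd I)) (R (fst I) (fst J) (snd J)) (L (fst I) (snd J) (snd I))
        else undefined))"

context
  fixes n :: nat and ob :: "nat \<Rightarrow> nat \<Rightarrow> 'u set" and L R :: "nat \<Rightarrow> nat \<Rightarrow> nat \<Rightarrow> 'u \<Rightarrow> 'u"
  assumes D: "span_data {..n} ob L R"
begin

lemma span_data_quad: "i \<le> j \<Longrightarrow> j \<le> k \<Longrightarrow> k \<le> l \<Longrightarrow> l \<le> n \<Longrightarrow> span_quad ob L R i j k l"
  using D unfolding span_data_def by auto

lemma span_data_finite: "i \<le> j \<Longrightarrow> j \<le> n \<Longrightarrow> finite (ob i j)"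
  using span_data_quad[of i i i j] by (simp add: span_quad_def)

lemma span_data_L: "i \<le> j \<Longrightarrow> j \<le> k \<Longrightarrow> k \<le> n \<Longrightarrow> L i j k \<in> ob i k \<rightarrow>\<^sub>E ob i j"
  and span_data_R: "i \<le> j \<Longrightarrow> j \<le> k \<Longrightarrow> k \<le> n \<Longrightarrow> R i j k \<in> ob i k \<rightarrow>\<^sub>E ob j k"
  using span_data_quad[of i i j k] by (simp_all add: span_quad_def)

lemma span_data_L_in: "i \<le> j \<Longrightarrow> j \<le> k \<Longrightarrow> k \<le> n \<Longrightarrow> x \<in> ob i k \<Longrightarrow> L i j k x \<in> ob i j"
  and span_data_R_in: "i \<le> j \<Longrightarrow> j \<le> k \<Longrightarrow> k \<le> n \<Longrightarrow> x \<in> ob i k \<Longrightarrow> R i j k x \<in> ob j k"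
  using span_data_L[of i j k] span_data_R[of i j k] by auto

lemma span_data_L_id: "i \<le> k \<Longrightarrow> k \<le> n \<Longrightarrow> x \<in> ob i k \<Longrightarrow> L i k k x = x"
  and span_data_R_id: "i \<le> k \<Longrightarrow> k \<le> n \<Longrightarrow> x \<in> ob i k \<Longrightarrow> R i i k x = x"
  using span_data_quad[of i i i k] by (simp_all add: span_quad_def)

lemma span_data_LL: "i \<le> j \<Longrightarrow> j \<le> k \<Longrightarrow> k \<le> l \<Longrightarrow> l \<le> n \<Longrightarrow> x \<in> ob i l \<Longrightarrow> L i j k (L i k l x) = L i j l x"
  and span_data_RR: "i \<le> j \<Longrightarrow> j \<le> k \<Longrightarrow> k \<le> l \<Longrightarrow> l \<le> n \<Longrightarrow> x \<in> ob i l \<Longrightarrow> R j k l (R i j l x) = R i k l x"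
  and span_data_RL: "i \<le> j \<Longrightarrow> j \<le> k \<Longrightarrow> k \<le> l \<Longrightarrow> l \<le> n \<Longrightarrow> x \<in> ob i l \<Longrightarrow>
        R i j k (L i k l x) = L j k l (R i j l x)"
  using span_data_quad[of i j k l] by (simp_all add: span_quad_def)

lemma span_data_ex1: "i \<le> k \<Longrightarrow> k \<le> l \<Longrightarrow> l \<le> n \<Longrightarrow> x \<in> ob i k \<Longrightarrow> y \<in> ob k l \<Longrightarrow> R i k k x = L k k l y \<Longrightarrow>
    \<exists>!z. z \<in> ob i l \<and> L i k l z = x \<and> R i k l z = y"
  using span_data_quad[of i i k l] by (simp add: span_quad_def)

lemma span_data_eqI:
  assumes "i \<le> k" "k \<le> l" "l \<le> n" "z \<in> ob i l" "z' \<in> ob i l" "L i k l z = L i k l z'" "R i k l z = R i k l z'"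
  shows "z = z'"
proof -
  have "R i k k (L i k l z) = L k k l (R i k l z)" using assms by (simp add: span_data_RL)
  then have "\<exists>!w. w \<in> ob i l \<and> L i k l w = L i k l z \<and> R i k l w = R i k l z"
    using assms by (intro span_data_ex1 span_data_L_in span_data_R_in) auto
  then show ?thesis using assms by metis
qed

text \<open>By pasting, the squares for overlapping intervals are pullbacks because those for adjacent
  intervals are.\<close>

lemma span_data_pullback:
  assumes le: "i \<le> j" "j \<le> k" "k \<le> l" "l \<le> n"
    and x: "x \<in> ob i k" and y: "y \<in> ob j l" and e: "R i j k x = L j k l y"
  shows "\<exists>!z. z \<in> ob i l \<and> L i k l z = x \<and> R i j l z = y"
proof -
  note in_simps = span_data_L_in span_data_R_in
  have "R i k k x = R j k k (R i j k x)" using le x by (simp add: span_data_RR)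
  also have "\<dots> = L k k l (R j k l y)" using le y by (simp add: e span_data_RL)
  finally have ex: "\<exists>!z. z \<in> ob i l \<and> L i k l z = x \<and> R i k l z = R j k l y"
    using le x y by (intro span_data_ex1 in_simps) auto
  then obtain z where z: "z \<in> ob i l" "L i k l z = x" "R i k l z = R j k l y" by blast
  have "R i j l z = y"
  proof (rule span_data_eqI[of j k l])
    show "L j k l (R i j l z) = L j k l y" using le z e span_data_RL[of i j k l z] by simp
    show "R j k l (R i j l z) = R j k l y" using le z by (simp add: span_data_RR)
  qed (use le z y in \<open>auto intro: in_simps\<close>)
  moreover have "z' = z" if "z' \<in> ob i l" "L i k l z' = x" "R i j l z' = y" for z'
  proof -
    have "R i k l z' = R j k l y" using that le span_data_RR[of i j k l z'] by simp
    then show ?thesis using ex z that by blast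
  qed
  ultimately show ?thesis using z by blast
qed

lemma span_diagram_Mor:
  assumes "i \<le> k" "k \<le> l" "l \<le> j" "j \<le> n" "x \<in> ob i j"
  shows "snd (span_diagram n ob L R) (i, j) (k, l) x = R i k l (L i l j x)"
  using assms by (simp add: span_diagram_def ivl_le_iff compose_eq)

text \<open>The composite of two maps of intervals shortens on the right, on the left, on the right and on the
  left again; the two middle steps are exchanged first.\<close>

lemma span_diagram_fin_functors: "span_diagram n ob L R \<in> fin_functors (Ivl n) ivl_le"
proof -
  have "(fst (span_diagram n ob L R), snd (span_diagram n ob L R)) \<in> fin_functors (Ivl n) ivl_le"
  proof (rule fin_functorsI)
    fix I J K x assume *: "I \<in> Ivl n" "J \<in> Ivl n" "K \<in> Ivl n" "ivl_le I J" "ivl_le J K"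
      "x \<in> fst (span_diagram n ob L R) I"
    obtain i j k l p q where e: "I = (i, j)" "J = (k, l)" "K = (p, q)" by (metis surj_pair)
    have le: "i \<le> k" "k \<le> p" "p \<le> q" "q \<le> l" "l \<le> j" "j \<le> n" and x: "x \<in> ob i j"
      using * by (auto simp: e ivl_le_iff span_diagram_def)
    have "R k p q (L k q l (R i k l (L i l j x))) = R k p q (R i k q (L i q l (L i l j x)))"
      using le x by (simp add: span_data_RL span_data_L_in)
    also have "\<dots> = R i p q (L i q j x)"
      using le x by (simp add: span_data_LL span_data_RR span_data_L_in)
    finally show "snd (span_diagram n ob L R) I K x =
        snd (span_diagram n ob L R) J K (snd (span_diagram n ob L R) I J x)"
      using le x by (simp add: e span_diagram_Mor span_data_L_in span_data_R_in)
  next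
    fix I J assume *: "I \<in> Ivl n" "J \<in> Ivl n" "ivl_le I J"
    then show "snd (span_diagram n ob L R) I J \<in> fst (span_diagram n ob L R) I \<rightarrow>\<^sub>E fst (span_diagram n ob L R) J"
      by (cases I; cases J) (auto simp: span_diagram_def ivl_le_iff compose_eq compose_def PiE_def
          intro!: span_data_R_in span_data_L_in)
  next
    fix I x assume "I \<in> Ivl n" "x \<in> fst (span_diagram n ob L R) I"
    then show "snd (span_diagram n ob L R) I I x = x"
      by (cases I) (auto simp: span_diagram_Mor span_data_L_id span_data_R_id span_diagram_def ivl_le_iff compose_eq)
  next
    fix I assume "I \<in> Ivl n"
    then show "finite (fst (span_diagram n ob L R) I)"
      by (cases I) (auto simp: span_diagram_def span_data_finite)
  qed (auto simp: span_diagram_def ivl_le_refl intro: ivl_le_trans)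
  then show ?thesis by simp
qed

text \<open>Two intervals that meet either overlap, and then the square is a pullback by pasting, or one of them
  contains the other, and then two opposite sides of the square are identities.\<close>

lemma span_diagram_simplices: "span_diagram n ob L R \<in> span_simplices n"
proof -
  let ?F = "span_diagram n ob L R"
  note FF = span_diagram_fin_functors
  have ob: "fst ?F (i, j) = ob i j" if "i \<le> j" "j \<le> n" for i j using that by (simp add: span_diagram_def)
  have mono_case: "fin_pullback (fst ?F (i, l)) (fst ?F (i, k)) (fst ?F (j, l))
      (snd ?F (i, l) (i, k)) (snd ?F (i, l) (j, l)) (snd ?F (i, k) (j, k)) (snd ?F (j, l) (j, k))"
    if le: "i \<le> j" "j \<le> k" "k \<le> l" "l \<le> n" for i j k l
  proof -
    have m: "snd ?F (i, l) (i, k) z = L i k l z" "snd ?F (i, l) (j, l) z = R i j l z" if "z \<in> ob i l" for z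
      using le that by (simp_all add: span_diagram_Mor span_data_L_id span_data_R_id span_data_L_in)
    have m': "snd ?F (i, k) (j, k) x = R i j k x" if "x \<in> ob i k" for x
      using le that by (simp add: span_diagram_Mor span_data_L_id)
    have m'': "snd ?F (j, l) (j, k) y = L j k l y" if "y \<in> ob j l" for y
      using le that by (simp add: span_diagram_Mor span_data_R_id span_data_L_in)
    show ?thesis
    proof (rule fin_pullbackI)
      fix b c assume "b \<in> fst ?F (i, k)" "c \<in> fst ?F (j, l)" "snd ?F (i, k) (j, k) b = snd ?F (j, l) (j, k) c"
      then have "\<exists>!z. z \<in> ob i l \<and> L i k l z = b \<and> R i j l z = c"
        using le by (intro span_data_pullback) (simp_all add: ob m' m'')
      then show "\<exists>!a. a \<in> fst ?F (i, l) \<and> snd ?F (i, l) (i, k) a = b \<and> snd ?F (i, l) (j, l) a = c"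
        using le by (simp add: ob m cong: conj_cong)
    qed (use le in \<open>simp_all add: ob m m' m'' span_data_L_in span_data_R_in span_data_RL\<close>)
  qed
  have "fin_pullback (fst ?F (ivl_union I J)) (fst ?F I) (fst ?F J)
      (snd ?F (ivl_union I J) I) (snd ?F (ivl_union I J) J)
      (snd ?F I (ivl_inter I J)) (snd ?F J (ivl_inter I J))"
    if IJ: "I \<in> Ivl n" "J \<in> Ivl n" "ivl_meet I J" for I J
  proof -
    obtain i j k l where e: "I = (i, j)" "J = (k, l)" by (metis surj_pair)
    have b: "i \<le> j" "j \<le> n" "k \<le> l" "l \<le> n" "i \<le> l" "k \<le> j" using IJ by (auto simp: e ivl_meet_iff)
    consider "i \<le> k" "j \<le> l" | "k \<le> i" "l \<le> j" | "i \<le> k" "l \<le> j" | "k \<le> i" "j \<le> l" by linarith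
    then show ?thesis
    proof cases
      case 1
      then show ?thesis using mono_case[of i k j l] b
        by (simp add: e ivl_union_def ivl_inter_def max_absorb2 min_absorb1)
    next
      case 2
      then show ?thesis using fin_pullback_swap[OF mono_case[of k i l j]] b
        by (simp add: e ivl_union_def ivl_inter_def max_absorb1 min_absorb2)
    next
      case 3
      then show ?thesis using fin_pullback_id[OF FF, of I J] b
        by (simp add: e ivl_union_def ivl_inter_def max_absorb1 max_absorb2 min_absorb1 min_absorb2 ivl_le_iff)
    next
      case 4
      then show ?thesis using fin_pullback_swap[OF fin_pullback_id[OF FF, of J I]] b
        by (simp add: e ivl_union_def ivl_inter_def max_absorb1 max_absorb2 min_absorb1 min_absorb2 ivl_le_iff)
    qed
  qed
  then show ?thesis using FF by (simp add: span_simplices_def)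
qed

end

definition span_ob :: "(nat \<times> nat, 'u) diagram \<Rightarrow> nat \<Rightarrow> nat \<Rightarrow> 'u set" where
  "span_ob F i j = fst F (i, j)"

definition span_left :: "(nat \<times> nat, 'u) diagram \<Rightarrow> nat \<Rightarrow> nat \<Rightarrow> nat \<Rightarrow> 'u \<Rightarrow> 'u" where
  "span_left F i j k = snd F (i, k) (i, j)"

definition span_right :: "(nat \<times> nat, 'u) diagram \<Rightarrow> nat \<Rightarrow> nat \<Rightarrow> nat \<Rightarrow> 'u \<Rightarrow> 'u" where
  "span_right F i j k = snd F (i, k) (j, k)"

lemma span_data_of_simplex:
  assumes F: "F \<in> span_simplices n"
  shows "span_data {..n} (span_ob F) (span_left F) (span_right F)"
  unfolding span_data_def
proof (intro ballI impI)
  fix i j k l assume "l \<in> {..n}" and le: "i \<le> j" "j \<le> k" "k \<le> l"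
  then have l: "l \<le> n" by simp
  note FF = span_simplices_fin_functors[OF F]
  note defs = span_ob_def span_left_def span_right_def
  have comp: "snd F q r (snd F p q x) = snd F p r x"
    if "p \<in> Ivl n" "q \<in> Ivl n" "r \<in> Ivl n" "ivl_le p q" "ivl_le q r" "x \<in> fst F p" for p q r x
    using fin_functors_comp[OF FF that(1-5)] that(6) by (simp add: compose_eq)
  have pb: "fin_pullback (fst F (i, l)) (fst F (i, k)) (fst F (k, l)) (snd F (i, l) (i, k))
     (snd F (i, l) (k, l)) (snd F (i, k) (k, k)) (snd F (k, l) (k, k))"
  proof -
    have "ivl_meet (i, k) (k, l)" "ivl_union (i, k) (k, l) = (i, l)" "ivl_inter (i, k) (k, l) = (k, k)"
      using le by (auto simp: ivl_meet_iff ivl_union_def ivl_inter_def)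
    moreover have "(i, k) \<in> Ivl n" "(k, l) \<in> Ivl n" using le l by auto
    ultimately show ?thesis
      using F unfolding span_simplices_def by (metis (no_types, lifting) mem_Collect_eq)
  qed
  show "span_quad (span_ob F) (span_left F) (span_right F) i j k l"
    unfolding span_quad_def defs
  proof (intro conjI ballI impI)
    show "finite (fst F (i, l))" using le l by (intro fin_functors_finite[OF FF]) simp
    show "snd F (i, l) (i, k) \<in> fst F (i, l) \<rightarrow>\<^sub>E fst F (i, k)"
      "snd F (i, l) (k, l) \<in> fst F (i, l) \<rightarrow>\<^sub>E fst F (k, l)"
      by (rule fin_functors_Mor[OF FF]; use le l in \<open>simp add: ivl_le_iff\<close>)+
    fix x assume x: "x \<in> fst F (i, l)"
    show "snd F (i, l) (i, l) x = x" "snd F (i, l) (i, l) x = x"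
      using fin_functors_id[OF FF, of "(i, l)"] le l x by simp_all
    show "snd F (i, k) (i, j) (snd F (i, l) (i, k) x) = snd F (i, l) (i, j) x"
      "snd F (j, l) (k, l) (snd F (i, l) (j, l) x) = snd F (i, l) (k, l) x"
      using le l x by (simp_all add: comp ivl_le_iff)
    show "snd F (i, k) (j, k) (snd F (i, l) (i, k) x) = snd F (j, l) (j, k) (snd F (i, l) (j, l) x)"
      using le l x by (simp add: comp ivl_le_iff)
  next
    fix x y assume "x \<in> fst F (i, k)" "y \<in> fst F (k, l)" "snd F (i, k) (k, k) x = snd F (k, l) (k, k) y"
    then show "\<exists>!z. z \<in> fst F (i, l) \<and> snd F (i, l) (i, k) z = x \<and> snd F (i, l) (k, l) z = y"
      by (rule fin_pullback_ex1[OF pb])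
  qed
qed

lemma span_simplex_eqI:
  assumes F: "F \<in> span_simplices n" and G: "G \<in> span_simplices n"
    and ob: "\<And>i j. i \<le> j \<Longrightarrow> j \<le> n \<Longrightarrow> span_ob F i j = span_ob G i j"
    and L: "\<And>i j k. i \<le> j \<Longrightarrow> j \<le> k \<Longrightarrow> k \<le> n \<Longrightarrow> span_left F i j k = span_left G i j k"
    and R: "\<And>i j k. i \<le> j \<Longrightarrow> j \<le> k \<Longrightarrow> k \<le> n \<Longrightarrow> span_right F i j k = span_right G i j k"
  shows "F = G"
proof (rule fin_functors_eqI)
  note FF = span_simplices_fin_functors
  show "F \<in> fin_functors (Ivl n) ivl_le" "G \<in> fin_functors (Ivl n) ivl_le" using FF F G by blast+
  have ob': "fst F p = fst G p" if "p \<in> Ivl n" for p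
    using that ob by (cases p) (simp add: span_ob_def)
  show "fst F p = fst G p" if "p \<in> Ivl n" for p using ob' that .
  fix p q assume pq: "p \<in> Ivl n" "q \<in> Ivl n" "ivl_le p q"
  obtain i j k l where e: "p = (i, j)" "q = (k, l)" by (metis surj_pair)
  have b: "i \<le> k" "k \<le> l" "l \<le> j" "j \<le> n" using pq by (auto simp: e ivl_le_iff)
  have "snd H p q = compose (fst H p) (span_right H i k l) (span_left H i l j)" if "H \<in> span_simplices n" for H
    using fin_functors_comp[OF FF[OF that], of "(i, j)" "(i, l)" "(k, l)"] b
    by (simp add: e span_right_def span_left_def ivl_le_iff)
  from this[OF F] this[OF G] show "snd F p q = snd G p q" using L R b ob'[OF pq(1)] by simp
qed

lemma span_diagram_ob: "i \<le> j \<Longrightarrow> j \<le> n \<Longrightarrow> span_ob (span_diagram n ob L R) i j = ob i j"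
  by (simp add: span_ob_def span_diagram_def)

lemma span_diagram_left:
  assumes D: "span_data {..n} ob L R" and le: "i \<le> j" "j \<le> k" "k \<le> n"
  shows "span_left (span_diagram n ob L R) i j k = L i j k"
proof (rule extensionalityI[of _ "ob i k"])
  show "L i j k \<in> extensional (ob i k)" using span_data_L[OF D le] by (simp add: PiE_def)
  show "span_left (span_diagram n ob L R) i j k x = L i j k x" if "x \<in> ob i k" for x
    using that le by (simp add: span_left_def span_diagram_Mor[OF D] span_data_R_id[OF D] span_data_L_in[OF D])
qed (use le in \<open>auto simp: span_left_def span_diagram_def compose_def ivl_le_iff\<close>)

lemma span_diagram_right:
  assumes D: "span_data {..n} ob L R" and le: "i \<le> j" "j \<le> k" "k \<le> n"
  shows "span_right (span_diagram n ob L R) i j k = R i j k"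
proof (rule extensionalityI[of _ "ob i k"])
  show "R i j k \<in> extensional (ob i k)" using span_data_R[OF D le] by (simp add: PiE_def)
  show "span_right (span_diagram n ob L R) i j k x = R i j k x" if "x \<in> ob i k" for x
    using that le by (simp add: span_right_def span_diagram_Mor[OF D] span_data_L_id[OF D])
qed (use le in \<open>auto simp: span_right_def span_diagram_def compose_def ivl_le_iff\<close>)

lemma span_act_ob:
  "i \<le> j \<Longrightarrow> j \<le> m \<Longrightarrow> span_ob (act Span m n \<alpha> F) i j = span_ob F (\<alpha> i) (\<alpha> j)"
  and span_act_left: "i \<le> j \<Longrightarrow> j \<le> k \<Longrightarrow> k \<le> m \<Longrightarrow>
    span_left (act Span m n \<alpha> F) i j k = span_left F (\<alpha> i) (\<alpha> j) (\<alpha> k)"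
  and span_act_right: "i \<le> j \<Longrightarrow> j \<le> k \<Longrightarrow> k \<le> m \<Longrightarrow>
    span_right (act Span m n \<alpha> F) i j k = span_right F (\<alpha> i) (\<alpha> j) (\<alpha> k)"
  by (simp_all add: span_ob_def span_left_def span_right_def act_Span precompose_def ivl_le_iff)


section \<open>Maps from subcomplexes of a simplex to Span\<close>

definition edge :: "nat \<Rightarrow> nat \<Rightarrow> nat \<Rightarrow> nat" where
  "edge i j = (\<lambda>t\<in>{..1}. if t = 0 then i else j)"

definition triangle :: "nat \<Rightarrow> nat \<Rightarrow> nat \<Rightarrow> nat \<Rightarrow> nat" where
  "triangle i j k = (\<lambda>t\<in>{..2}. if t = 0 then i else if t = 1 then j else k)"

definition tetrahedron :: "nat \<Rightarrow> nat \<Rightarrow> nat \<Rightarrow> nat \<Rightarrow> nat \<Rightarrow> nat" where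
  "tetrahedron i j k l = (\<lambda>t\<in>{..3}. if t = 0 then i else if t = 1 then j else if t = 2 then k else l)"

lemma edge_Delta: "i \<le> j \<Longrightarrow> j \<le> n \<Longrightarrow> edge i j \<in> Delta 1 n"
  unfolding edge_def by (rule DeltaI) auto

lemma triangle_Delta: "i \<le> j \<Longrightarrow> j \<le> k \<Longrightarrow> k \<le> n \<Longrightarrow> triangle i j k \<in> Delta 2 n"
  unfolding triangle_def by (rule DeltaI) auto

lemma tetrahedron_Delta: "i \<le> j \<Longrightarrow> j \<le> k \<Longrightarrow> k \<le> l \<Longrightarrow> l \<le> n \<Longrightarrow> tetrahedron i j k l \<in> Delta 3 n"
  unfolding tetrahedron_def by (rule DeltaI) auto

lemma tetrahedron_image: "tetrahedron i j k l ` {..3} = {i, j, k, l}"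
proof -
  have "{..3} = {0, 1, 2, 3 :: nat}" by auto
  then show ?thesis by (auto simp: tetrahedron_def)
qed

lemma compose_edge: "p \<le> m \<Longrightarrow> q \<le> m \<Longrightarrow> compose {..1} \<beta> (edge p q) = edge (\<beta> p) (\<beta> q)"
  and compose_triangle: "compose {..2} \<beta> (triangle p q r) = triangle (\<beta> p) (\<beta> q) (\<beta> r)"
  by (auto simp: edge_def triangle_def compose_def fun_eq_iff)

text \<open>The data of a map from a subcomplex to \<open>Span\<close>. They are only meaningful for vertices that span a
  simplex of the subcomplex.\<close>

definition map_ob :: "(nat \<Rightarrow> (nat \<Rightarrow> nat) \<Rightarrow> (nat \<times> nat, 'u) diagram) \<Rightarrow> nat \<Rightarrow> nat \<Rightarrow> 'u set" where
  "map_ob u i j = span_ob (u 1 (edge i j)) 0 1"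

definition map_left :: "(nat \<Rightarrow> (nat \<Rightarrow> nat) \<Rightarrow> (nat \<times> nat, 'u) diagram)
    \<Rightarrow> nat \<Rightarrow> nat \<Rightarrow> nat \<Rightarrow> 'u \<Rightarrow> 'u" where
  "map_left u i j k = span_left (u 2 (triangle i j k)) 0 1 2"

definition map_right :: "(nat \<Rightarrow> (nat \<Rightarrow> nat) \<Rightarrow> (nat \<times> nat, 'u) diagram)
    \<Rightarrow> nat \<Rightarrow> nat \<Rightarrow> nat \<Rightarrow> 'u \<Rightarrow> 'u" where
  "map_right u i j k = span_right (u 2 (triangle i j k)) 0 1 2"

lemma map_data_of_simplex:
  assumes u: "u \<in> smap (sub_simplex n S) Span" and \<beta>: "\<beta> \<in> simplices (sub_simplex n S) m"
  shows "p \<le> q \<Longrightarrow> q \<le> m \<Longrightarrow> span_ob (u m \<beta>) p q = map_ob u (\<beta> p) (\<beta> q)"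
    and "p \<le> q \<Longrightarrow> q \<le> r \<Longrightarrow> r \<le> m \<Longrightarrow> span_left (u m \<beta>) p q r = map_left u (\<beta> p) (\<beta> q) (\<beta> r)"
    and "p \<le> q \<Longrightarrow> q \<le> r \<Longrightarrow> r \<le> m \<Longrightarrow> span_right (u m \<beta>) p q r = map_right u (\<beta> p) (\<beta> q) (\<beta> r)"
proof -
  show "span_ob (u m \<beta>) p q = map_ob u (\<beta> p) (\<beta> q)" if "p \<le> q" "q \<le> m"
  proof -
    have "u 1 (edge (\<beta> p) (\<beta> q)) = act Span 1 m (edge p q) (u m \<beta>)"
      using smap_natural[OF u edge_Delta[OF that] \<beta>] compose_edge[of p m q \<beta>] that by simp
    then show ?thesis by (simp add: map_ob_def span_act_ob del: One_nat_def) (simp add: edge_def)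
  qed
  have *: "u 2 (triangle (\<beta> p) (\<beta> q) (\<beta> r)) = act Span 2 m (triangle p q r) (u m \<beta>)"
    if "p \<le> q" "q \<le> r" "r \<le> m"
    using smap_natural[OF u triangle_Delta[OF that] \<beta>] compose_triangle[of \<beta> p q r] by simp
  show "span_left (u m \<beta>) p q r = map_left u (\<beta> p) (\<beta> q) (\<beta> r)"
    "span_right (u m \<beta>) p q r = map_right u (\<beta> p) (\<beta> q) (\<beta> r)" if "p \<le> q" "q \<le> r" "r \<le> m"
    using *[OF that] by (simp_all add: map_left_def map_right_def span_act_left span_act_right del: One_nat_def)
      (simp_all add: triangle_def)
qed

text \<open>The conditions for four vertices hold in the image of the tetrahedron that they span.\<close>

lemma map_span_quad:
  assumes u: "u \<in> smap (sub_simplex n S) Span"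
    and le: "i \<le> j" "j \<le> k" "k \<le> l" "l \<le> n" and S: "{i, j, k, l} \<in> S"
  shows "span_quad (map_ob u) (map_left u) (map_right u) i j k l"
proof -
  let ?t = "tetrahedron i j k l"
  have t: "?t \<in> simplices (sub_simplex n S) 3"
    using tetrahedron_Delta[OF le] S by (simp add: simplices_sub_simplex tetrahedron_image)
  have v: "?t 0 = i" "?t 1 = j" "?t 2 = k" "?t 3 = l" by (simp_all add: tetrahedron_def)
  have "u 3 ?t \<in> span_simplices 3" using smap_simplices[OF u t] by (simp add: simplices_Span)
  then have Q: "span_quad (span_ob (u 3 ?t)) (span_left (u 3 ?t)) (span_right (u 3 ?t)) 0 1 2 3"
    by (rule span_data_quad[OF span_data_of_simplex]) auto
  note D = map_data_of_simplex[OF u t]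
  have D': "span_ob (u 3 ?t) 0 3 = map_ob u i l" "span_ob (u 3 ?t) 0 2 = map_ob u i k"
    "span_ob (u 3 ?t) 2 3 = map_ob u k l"
    "span_left (u 3 ?t) 0 2 3 = map_left u i k l" "span_right (u 3 ?t) 0 2 3 = map_right u i k l"
    "span_left (u 3 ?t) 0 3 3 = map_left u i l l" "span_right (u 3 ?t) 0 0 3 = map_right u i i l"
    "span_left (u 3 ?t) 0 1 2 = map_left u i j k" "span_left (u 3 ?t) 0 1 3 = map_left u i j l"
    "span_right (u 3 ?t) 1 2 3 = map_right u j k l" "span_right (u 3 ?t) 0 1 3 = map_right u i j l"
    "span_right (u 3 ?t) 0 1 2 = map_right u i j k" "span_left (u 3 ?t) 1 2 3 = map_left u j k l"
    "span_right (u 3 ?t) 0 2 2 = map_right u i k k" "span_left (u 3 ?t) 2 2 3 = map_left u k k l"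
    by (subst D; simp add: v del: One_nat_def)+
  show ?thesis using Q unfolding span_quad_def D' .
qed

text \<open>Simplices of \<open>Span\<close> are determined by their data, which involve at most three vertices at a time.\<close>

lemma extends_on_span_diagram:
  assumes u: "u \<in> smap (sub_simplex n S) Span" and S: "sieve S" and D: "span_data {..n} ob L R"
    and ob: "\<And>i j. i \<le> j \<Longrightarrow> j \<le> n \<Longrightarrow> {i, j} \<in> S \<Longrightarrow> ob i j = map_ob u i j"
    and L: "\<And>i j k. i \<le> j \<Longrightarrow> j \<le> k \<Longrightarrow> k \<le> n \<Longrightarrow> {i, j, k} \<in> S \<Longrightarrow> L i j k = map_left u i j k"
    and R: "\<And>i j k. i \<le> j \<Longrightarrow> j \<le> k \<Longrightarrow> k \<le> n \<Longrightarrow> {i, j, k} \<in> S \<Longrightarrow> R i j k = map_right u i j k"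
  shows "extends_on (sub_simplex n S) (yoneda_map Span n (span_diagram n ob L R)) u"
  unfolding extends_on_def
proof (intro allI ballI)
  fix m \<beta> assume \<beta>: "\<beta> \<in> simplices (sub_simplex n S) m"
  then have \<beta>': "\<beta> \<in> Delta m n" and im: "\<beta> ` {..m} \<in> S" by (auto simp: simplices_sub_simplex)
  note le = Delta_le[OF \<beta>'] and mono = Delta_mono[OF \<beta>']
  let ?F = "span_diagram n ob L R"
  have F: "?F \<in> simplices Span n" using span_diagram_simplices[OF D] by (simp add: simplices_Span)
  have "act Span m n \<beta> ?F = u m \<beta>"
  proof (rule span_simplex_eqI[of _ m])
    show "act Span m n \<beta> ?F \<in> span_simplices m"
      using simplicial_set_simplices[OF simplicial_set_Span \<beta>' F] by (simp add: simplices_Span)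
    show "u m \<beta> \<in> span_simplices m" using smap_simplices[OF u \<beta>] by (simp add: simplices_Span)
  next
    fix i j assume ij: "i \<le> j" "j \<le> m"
    have "{\<beta> i, \<beta> j} \<in> S" by (rule sieveD[OF S im]) (use ij in auto)
    then show "span_ob (act Span m n \<beta> ?F) i j = span_ob (u m \<beta>) i j"
      using ij le mono by (simp add: span_act_ob span_diagram_ob ob map_data_of_simplex[OF u \<beta>])
  next
    fix i j k assume ij: "i \<le> j" "j \<le> k" "k \<le> m"
    have "{\<beta> i, \<beta> j, \<beta> k} \<in> S" by (rule sieveD[OF S im]) (use ij in auto)
    then show "span_left (act Span m n \<beta> ?F) i j k = span_left (u m \<beta>) i j k"
      "span_right (act Span m n \<beta> ?F) i j k = span_right (u m \<beta>) i j k"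
      using ij le mono
      by (simp_all add: span_act_left span_act_right span_diagram_left[OF D] span_diagram_right[OF D] L R
          map_data_of_simplex[OF u \<beta>])
  qed
  then show "yoneda_map Span n ?F m \<beta> = u m \<beta>" by (simp add: yoneda_map_apply[OF \<beta>'])
qed

section \<open>Extending span data\<close>

lemma span_quad_finite: "span_quad ob L R i j k l \<Longrightarrow> finite (ob i l)"
  and span_quad_L: "span_quad ob L R i j k l \<Longrightarrow> L i k l \<in> ob i l \<rightarrow>\<^sub>E ob i k"
  and span_quad_R: "span_quad ob L R i j k l \<Longrightarrow> R i k l \<in> ob i l \<rightarrow>\<^sub>E ob k l"
  and span_quad_L_in: "span_quad ob L R i j k l \<Longrightarrow> x \<in> ob i l \<Longrightarrow> L i k l x \<in> ob i k"
  and span_quad_R_in: "span_quad ob L R i j k l \<Longrightarrow> x \<in> ob i l \<Longrightarrow> R i k l x \<in> ob k l"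
  and span_quad_L_id: "span_quad ob L R i j k l \<Longrightarrow> x \<in> ob i l \<Longrightarrow> L i l l x = x"
  and span_quad_R_id: "span_quad ob L R i j k l \<Longrightarrow> x \<in> ob i l \<Longrightarrow> R i i l x = x"
  and span_quad_LL: "span_quad ob L R i j k l \<Longrightarrow> x \<in> ob i l \<Longrightarrow> L i j k (L i k l x) = L i j l x"
  and span_quad_RR: "span_quad ob L R i j k l \<Longrightarrow> x \<in> ob i l \<Longrightarrow> R j k l (R i j l x) = R i k l x"
  and span_quad_RL: "span_quad ob L R i j k l \<Longrightarrow> x \<in> ob i l \<Longrightarrow>
        R i j k (L i k l x) = L j k l (R i j l x)"
  and span_quad_ex1: "span_quad ob L R i j k l \<Longrightarrow> x \<in> ob i k \<Longrightarrow> y \<in> ob k l \<Longrightarrow> R i k k x = L k k l y \<Longrightarrow>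
        \<exists>!z. z \<in> ob i l \<and> L i k l z = x \<and> R i k l z = y"
  by (auto simp: span_quad_def)

lemma span_quadI:
  assumes "span_quad ob L R i i k l"
    and "\<And>x. x \<in> ob i l \<Longrightarrow> L i j k (L i k l x) = L i j l x"
    and "\<And>x. x \<in> ob i l \<Longrightarrow> R j k l (R i j l x) = R i k l x"
    and "\<And>x. x \<in> ob i l \<Longrightarrow> R i j k (L i k l x) = L j k l (R i j l x)"
  shows "span_quad ob L R i j k l"
  using assms unfolding span_quad_def by simp

lemma span_quad_eqI:
  assumes q: "span_quad ob L R i k k l" and z: "z \<in> ob i l" "z' \<in> ob i l"
    and e: "L i k l z = L i k l z'" "R i k l z = R i k l z'"
  shows "z = z'"
proof -
  have "\<exists>!w. w \<in> ob i l \<and> L i k l w = L i k l z \<and> R i k l w = R i k l z"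
    by (rule span_quad_ex1[OF q span_quad_L_in[OF q z(1)] span_quad_R_in[OF q z(1)] span_quad_RL[OF q z(1)]])
  then show ?thesis using z e by (metis (no_types))
qed

lemma span_quad_cong:
  assumes q: "span_quad ob L R i j k l" and le: "i \<le> j" "j \<le> k" "k \<le> l"
    and ob: "\<And>p q. i \<le> p \<Longrightarrow> p \<le> q \<Longrightarrow> q \<le> l \<Longrightarrow> {p, q} \<subseteq> {i, j, k, l} \<Longrightarrow> ob' p q = ob p q"
    and LR: "\<And>p q r. i \<le> p \<Longrightarrow> p \<le> q \<Longrightarrow> q \<le> r \<Longrightarrow> r \<le> l \<Longrightarrow> {p, q, r} \<subseteq> {i, j, k, l} \<Longrightarrow>
      L' p q r = L p q r \<and> R' p q r = R p q r"
  shows "span_quad ob' L' R' i j k l"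
proof -
  have o: "ob' i l = ob i l" "ob' i k = ob i k" "ob' k l = ob k l"
    by (rule ob; use le in simp)+
  have lr: "L' i k l = L i k l \<and> R' i k l = R i k l" "L' i l l = L i l l \<and> R' i l l = R i l l"
    "L' i i l = L i i l \<and> R' i i l = R i i l" "L' i j k = L i j k \<and> R' i j k = R i j k"
    "L' i j l = L i j l \<and> R' i j l = R i j l" "L' j k l = L j k l \<and> R' j k l = R j k l"
    "L' i k k = L i k k \<and> R' i k k = R i k k" "L' k k l = L k k l \<and> R' k k l = R k k l"
    by (rule LR; use le in simp)+
  show ?thesis using q unfolding span_quad_def o lr[THEN conjunct1] lr[THEN conjunct2] .
qed

definition partial_span_data :: "nat \<Rightarrow> nat set set \<Rightarrow> (nat \<Rightarrow> nat \<Rightarrow> 'u set)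
    \<Rightarrow> (nat \<Rightarrow> nat \<Rightarrow> nat \<Rightarrow> 'u \<Rightarrow> 'u) \<Rightarrow> (nat \<Rightarrow> nat \<Rightarrow> nat \<Rightarrow> 'u \<Rightarrow> 'u) \<Rightarrow> bool" where
  "partial_span_data n S ob L R \<longleftrightarrow>
     (\<forall>i j k l. i \<le> j \<longrightarrow> j \<le> k \<longrightarrow> k \<le> l \<longrightarrow> l \<le> n \<longrightarrow> {i, j, k, l} \<in> S \<longrightarrow> span_quad ob L R i j k l)"

definition span_data_extend :: "nat \<Rightarrow> nat set set \<Rightarrow> (nat \<Rightarrow> nat \<Rightarrow> 'u set)
    \<Rightarrow> (nat \<Rightarrow> nat \<Rightarrow> nat \<Rightarrow> 'u \<Rightarrow> 'u) \<Rightarrow> (nat \<Rightarrow> nat \<Rightarrow> nat \<Rightarrow> 'u \<Rightarrow> 'u) \<Rightarrow> (nat \<Rightarrow> nat \<Rightarrow> 'u set)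
    \<Rightarrow> (nat \<Rightarrow> nat \<Rightarrow> nat \<Rightarrow> 'u \<Rightarrow> 'u) \<Rightarrow> (nat \<Rightarrow> nat \<Rightarrow> nat \<Rightarrow> 'u \<Rightarrow> 'u) \<Rightarrow> bool" where
  "span_data_extend n S ob L R ob' L' R' \<longleftrightarrow> partial_span_data n UNIV ob' L' R' \<and>
     (\<forall>i j. i \<le> j \<longrightarrow> j \<le> n \<longrightarrow> {i, j} \<in> S \<longrightarrow> ob' i j = ob i j) \<and>
     (\<forall>i j k. i \<le> j \<longrightarrow> j \<le> k \<longrightarrow> k \<le> n \<longrightarrow> {i, j, k} \<in> S \<longrightarrow> L' i j k = L i j k \<and> R' i j k = R i j k)"

definition span_data_extensible :: "nat \<Rightarrow> nat set set \<Rightarrow> (nat \<Rightarrow> nat \<Rightarrow> 'u set)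
    \<Rightarrow> (nat \<Rightarrow> nat \<Rightarrow> nat \<Rightarrow> 'u \<Rightarrow> 'u) \<Rightarrow> (nat \<Rightarrow> nat \<Rightarrow> nat \<Rightarrow> 'u \<Rightarrow> 'u) \<Rightarrow> bool" where
  "span_data_extensible n S ob L R \<longleftrightarrow> (\<exists>ob' L' R'. span_data_extend n S ob L R ob' L' R')"

lemma partial_span_data_quad:
  "partial_span_data n S ob L R \<Longrightarrow> i \<le> j \<Longrightarrow> j \<le> k \<Longrightarrow> k \<le> l \<Longrightarrow> l \<le> n \<Longrightarrow> {i, j, k, l} \<in> S \<Longrightarrow>
     span_quad ob L R i j k l"
  by (simp add: partial_span_data_def)

lemma partial_span_data_UNIV: "partial_span_data n UNIV ob L R \<longleftrightarrow> span_data {..n} ob L R"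
  unfolding partial_span_data_def span_data_def by (auto intro: order_trans)

lemma span_data_extensible_same:
  assumes "\<And>i j k l. i \<le> j \<Longrightarrow> j \<le> k \<Longrightarrow> k \<le> l \<Longrightarrow> l \<le> n \<Longrightarrow> span_quad ob L R i j k l"
  shows "span_data_extensible n S ob L R"
  unfolding span_data_extensible_def span_data_extend_def partial_span_data_def using assms by blast

text \<open>This reduces the problem to fill a map to \<open>Span\<close> to the extension of its data.\<close>

lemma fill_map_to_Span:
  assumes u: "u \<in> smap (sub_simplex n S) Span" and S: "sieve S"
    and e: "span_data_extend n S (map_ob u) (map_left u) (map_right u) ob L R"
  shows "span_diagram n ob L R \<in> simplices Span n"
    and "extends_on (sub_simplex n S) (yoneda_map Span n (span_diagram n ob L R)) u"
proof -
  have D: "span_data {..n} ob L R" using e by (simp add: span_data_extend_def partial_span_data_UNIV)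
  show "span_diagram n ob L R \<in> simplices Span n"
    using span_diagram_simplices[OF D] by (simp add: simplices_Span)
  show "extends_on (sub_simplex n S) (yoneda_map Span n (span_diagram n ob L R)) u"
    by (rule extends_on_span_diagram[OF u S D]) (use e in \<open>simp_all add: span_data_extend_def\<close>)
qed

lemma map_partial_span_data:
  "u \<in> smap (sub_simplex n S) Span \<Longrightarrow> partial_span_data n S (map_ob u) (map_left u) (map_right u)"
  unfolding partial_span_data_def by (auto intro: map_span_quad)

text \<open>Reversing the order of the vertices exchanges the two legs of a span.\<close>

lemma span_quad_reverse:
  assumes "i \<le> j" "j \<le> k" "k \<le> l" "l \<le> n"
    and "span_quad ob L R (n - l) (n - k) (n - j) (n - i)" "span_quad ob L R (n - l) (n - l) (n - k) (n - i)"
  shows "span_quad (\<lambda>i j. ob (n - j) (n - i)) (\<lambda>i j k. R (n - k) (n - j) (n - i)) (\<lambda>i j k. L (n - k) (n - j) (n - i)) i j k l"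
  unfolding span_quad_def
proof (intro conjI ballI impI)
  fix x y assume "x \<in> ob (n - k) (n - i)" "y \<in> ob (n - l) (n - k)"
    "L (n - k) (n - k) (n - i) x = R (n - l) (n - k) (n - k) y"
  then have "\<exists>!z. z \<in> ob (n - l) (n - i) \<and> L (n - l) (n - k) (n - i) z = y \<and> R (n - l) (n - k) (n - i) z = x"
    using span_quad_ex1[OF assms(6)] by metis
  then show "\<exists>!z. z \<in> ob (n - l) (n - i) \<and> R (n - l) (n - k) (n - i) z = x \<and> L (n - l) (n - k) (n - i) z = y"
    by (simp only: conj_commute)
qed (use assms(5,6) in \<open>auto simp: span_quad_def\<close>)

lemma partial_span_data_reverse:
  assumes D: "partial_span_data n S ob L R"
    and S: "\<And>V W. V \<in> S \<Longrightarrow> W \<subseteq> V \<Longrightarrow> W \<in> S"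
  shows "partial_span_data n {V. (\<lambda>i. n - i) ` V \<in> S} (\<lambda>i j. ob (n - j) (n - i))
     (\<lambda>i j k. R (n - k) (n - j) (n - i)) (\<lambda>i j k. L (n - k) (n - j) (n - i))"
  unfolding partial_span_data_def
proof (intro allI impI)
  fix i j k l assume le: "i \<le> j" "j \<le> k" "k \<le> l" "l \<le> n" and "{i, j, k, l} \<in> {V. (\<lambda>i. n - i) ` V \<in> S}"
  then have s: "{n - i, n - j, n - k, n - l} \<in> S" by simp
  show "span_quad (\<lambda>i j. ob (n - j) (n - i)) (\<lambda>i j k. R (n - k) (n - j) (n - i)) (\<lambda>i j k. L (n - k) (n - j) (n - i)) i j k l"
  proof (rule span_quad_reverse[OF le])
    show "span_quad ob L R (n - l) (n - k) (n - j) (n - i)"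
      by (rule partial_span_data_quad[OF D]) (use le in \<open>auto intro: S[OF s]\<close>)
    show "span_quad ob L R (n - l) (n - l) (n - k) (n - i)"
      by (rule partial_span_data_quad[OF D]) (use le in \<open>auto intro: S[OF s]\<close>)
  qed
qed

lemma span_data_extensible_reverse:
  fixes ob :: "nat \<Rightarrow> nat \<Rightarrow> 'u set"
  assumes "span_data_extensible n {V. (\<lambda>i. n - i) ` V \<in> S} (\<lambda>i j. ob (n - j) (n - i))
     (\<lambda>i j k. R (n - k) (n - j) (n - i)) (\<lambda>i j k. L (n - k) (n - j) (n - i))"
  shows "span_data_extensible n S ob L R"
proof -
  obtain ob' L' R' where D: "partial_span_data n UNIV ob' L' R'"
    and o: "\<And>i j. i \<le> j \<Longrightarrow> j \<le> n \<Longrightarrow> {n - i, n - j} \<in> S \<Longrightarrow> ob' i j = ob (n - j) (n - i)"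
    and lr: "\<And>i j k. i \<le> j \<Longrightarrow> j \<le> k \<Longrightarrow> k \<le> n \<Longrightarrow> {n - i, n - j, n - k} \<in> S \<Longrightarrow>
        L' i j k = R (n - k) (n - j) (n - i) \<and> R' i j k = L (n - k) (n - j) (n - i)"
    using assms unfolding span_data_extensible_def span_data_extend_def by auto
  show ?thesis
    unfolding span_data_extensible_def span_data_extend_def
  proof (intro exI conjI allI impI)
    show "partial_span_data n UNIV (\<lambda>i j. ob' (n - j) (n - i))
       (\<lambda>i j k. R' (n - k) (n - j) (n - i)) (\<lambda>i j k. L' (n - k) (n - j) (n - i))"
      using partial_span_data_reverse[OF D] by simp
  next
    fix i j assume "i \<le> j" "j \<le> n" "{i, j} \<in> S"
    then show "ob' (n - j) (n - i) = ob i j"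
      using o[of "n - j" "n - i"] by (simp add: insert_commute)
  next
    fix i j k assume *: "i \<le> j" "j \<le> k" "k \<le> n" "{i, j, k} \<in> S"
    moreover have "{k, j, i} = {i, j, k}" by auto
    ultimately show "R' (n - k) (n - j) (n - i) = L i j k" "L' (n - k) (n - j) (n - i) = R i j k"
      using lr[of "n - k" "n - j" "n - i"] by simp_all
  qed
qed


section \<open>Inner horns in Span\<close>

lemma ex_finite_copy:
  fixes P :: "'a set"
  assumes "finite P"
  shows "\<exists>(Z :: 'u::infinite set) e. finite Z \<and> bij_betw e Z P"
proof -
  obtain Z :: "'u set" where "finite Z" "card Z = card P"
    using infinite_arbitrarily_large[OF infinite_UNIV] by blast
  then show ?thesis using finite_same_card_bij[OF _ assms, of Z] by blast
qed

text \<open>Composing two spans: the new object is a pullback.\<close>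

lemma span_horn_2_1:
  fixes ob :: "nat \<Rightarrow> nat \<Rightarrow> 'u::infinite set"
  assumes D: "partial_span_data 2 S ob L R" and S: "\<And>V. V \<subseteq> {..2} \<Longrightarrow> V \<in> S \<longleftrightarrow> \<not> {0, 2} \<subseteq> V"
  shows "span_data_extensible 2 S ob L R"
proof -
  have q: "span_quad ob L R i j k l" if "i \<le> j" "j \<le> k" "k \<le> l" "l \<le> 2" "\<not> (i = 0 \<and> l = 2)" for i j k l
    using that by (intro partial_span_data_quad[OF D]) (auto simp: S)
  \<comment> \<open>\<open>P\<close> is the pullback, but its elements have the wrong type, so a copy \<open>Z\<close> of it is used.\<close>
  define P where "P = {(x, y). x \<in> ob 0 1 \<and> y \<in> ob 1 2 \<and> R 0 1 1 x = L 1 1 2 y}"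
  have "finite (ob 0 1 \<times> ob 1 2)"
    using span_quad_finite[OF q[of 0 0 0 1]] span_quad_finite[OF q[of 1 1 1 2]] by simp
  then have "finite P" by (rule rev_finite_subset) (auto simp: P_def)
  then obtain Z :: "'u set" and e where Z: "finite Z" and e: "bij_betw e Z P"
    using ex_finite_copy[OF \<open>finite P\<close>] by blast
  have eP: "fst (e z) \<in> ob 0 1" "snd (e z) \<in> ob 1 2" "R 0 1 1 (fst (e z)) = L 1 1 2 (snd (e z))" if "z \<in> Z" for z
    using bij_betwE[OF e] that by (auto simp: P_def)
  have ex: "\<exists>!z. z \<in> Z \<and> fst (e z) = x \<and> snd (e z) = y" if "x \<in> ob 0 1" "y \<in> ob 1 2" "R 0 1 1 x = L 1 1 2 y" for x y
  proof -
    have "(x, y) \<in> P" using that by (simp add: P_def)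
    then have "\<exists>!z. z \<in> Z \<and> e z = (x, y)" using e unfolding bij_betw_def inj_on_def by (auto simp: image_iff)
    then show ?thesis by (simp add: prod_eq_iff)
  qed
  define ob' where "ob' = (\<lambda>i j. if i = 0 \<and> j = (2::nat) then Z else ob i j)"
  define L' where "L' = (\<lambda>i j k. if i = 0 \<and> k = (2::nat) then
     (\<lambda>z\<in>Z. if j = 0 then L 0 0 1 (fst (e z)) else if j = 1 then fst (e z) else z) else L i j k)"
  define R' where "R' = (\<lambda>i j k. if i = 0 \<and> k = (2::nat) then
     (\<lambda>z\<in>Z. if j = 0 then z else if j = 1 then snd (e z) else R 1 2 2 (snd (e z))) else R i j k)"
  note defs = ob'_def L'_def R'_def
  have old: "span_quad ob' L' R' i j k l" if "i \<le> j" "j \<le> k" "k \<le> l" "l \<le> 2" "\<not> (i = 0 \<and> l = 2)" for i j k l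
    by (rule span_quad_cong[OF q[OF that] that(1-3)]) (use that in \<open>auto simp: defs\<close>)
  note q1 = q[of 0 0 0 0] q[of 0 0 0 1] q[of 0 0 1 1] q[of 0 1 1 1]
    and q2 = q[of 2 2 2 2] q[of 1 1 2 2] q[of 1 1 1 2] q[of 1 2 2 2]
  have id1: "L 0 1 1 x = x" "R 0 0 1 x = x" if "x \<in> ob 0 1" for x
    using that span_quad_L_id[OF q[of 0 0 0 1]] span_quad_R_id[OF q[of 0 0 0 1]] by simp_all
  have id2: "L 1 2 2 x = x" "R 1 1 2 x = x" if "x \<in> ob 1 2" for x
    using that span_quad_L_id[OF q[of 1 1 1 2]] span_quad_R_id[OF q[of 1 1 1 2]] by simp_all
  have id0: "L 0 0 0 x = x" "R 0 0 0 x = x" if "x \<in> ob 0 0" for x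
    using that span_quad_L_id[OF q[of 0 0 0 0]] span_quad_R_id[OF q[of 0 0 0 0]] by simp_all
  have id3: "L 2 2 2 x = x" "R 2 2 2 x = x" if "x \<in> ob 2 2" for x
    using that span_quad_L_id[OF q[of 2 2 2 2]] span_quad_R_id[OF q[of 2 2 2 2]] by simp_all
  have t: "L 0 0 1 x \<in> ob 0 0" if "x \<in> ob 0 1" for x using that span_quad_L_in[OF q[of 0 0 0 1]] by simp
  have t': "R 1 2 2 x \<in> ob 2 2" if "x \<in> ob 1 2" for x using that span_quad_R_in[OF q[of 1 1 2 2]] by simp
  have new: "span_quad ob' L' R' 0 j k 2" if "j \<le> k" "k \<le> 2" for j k
  proof -
    have k: "k = 0 \<or> k = 1 \<or> k = 2" using that by linarith
    have base: "span_quad ob' L' R' 0 0 k 2"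
      unfolding span_quad_def
    proof (intro conjI ballI impI)
      fix x y assume xy: "x \<in> ob' 0 k" "y \<in> ob' k 2" "R' 0 k k x = L' k k 2 y"
      show "\<exists>!z. z \<in> ob' 0 2 \<and> L' 0 k 2 z = x \<and> R' 0 k 2 z = y"
        using k
      proof (elim disjE)
        assume [simp]: "k = 0"
        show ?thesis using xy eP id0 by (intro ex1I[of _ y]) (auto simp: defs)
      next
        assume [simp]: "k = 1"
        have "\<exists>!z. z \<in> Z \<and> fst (e z) = x \<and> snd (e z) = y"
          using xy by (intro ex) (auto simp: defs)
        then show ?thesis by (simp add: defs cong: conj_cong)
      next
        assume [simp]: "k = 2"
        show ?thesis using xy eP id3 by (intro ex1I[of _ x]) (auto simp: defs)
      qed
    qed (use k Z eP id0 id1 id2 id3 t t' in \<open>auto simp: defs\<close>)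
    have j: "j = 0 \<or> (j = 1 \<and> k = 1) \<or> (j = 1 \<and> k = 2) \<or> (j = 2 \<and> k = 2)" using that by linarith
    show ?thesis
      by (rule span_quadI[OF base]) (use j k eP t t' id0 id1 id2 id3 in \<open>auto simp: defs\<close>)
  qed
  have "span_quad ob' L' R' i j k l" if "i \<le> j" "j \<le> k" "k \<le> l" "l \<le> 2" for i j k l
    using old[OF that] new[of j k] that by (cases "i = 0 \<and> l = 2") auto
  then have "partial_span_data 2 UNIV ob' L' R'" by (simp add: partial_span_data_def)
  then show ?thesis
    unfolding span_data_extensible_def span_data_extend_def
    by (intro exI[of _ ob'] exI[of _ L'] exI[of _ R']) (auto simp: defs S)
qed

text \<open>Associativity of composition: the missing triangle is determined by the pullback property of the
  given ones.\<close>

lemma span_horn_3_1: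
  assumes D: "partial_span_data 3 S ob L R" and S: "\<And>V. V \<subseteq> {..3} \<Longrightarrow> V \<in> S \<longleftrightarrow> \<not> {0, 2, 3} \<subseteq> V"
  shows "span_data_extensible 3 S ob L R"
proof -
  let ?P = "\<lambda>i j k l. i = 0 \<and> l = 3 \<and> (j = 2 \<or> k = (2::nat))"
  have q: "span_quad ob L R i j k l" if "i \<le> j" "j \<le> k" "k \<le> l" "l \<le> 3" "\<not> ?P i j k l" for i j k l
    using that by (intro partial_span_data_quad[OF D]) (auto simp: S)
  have L: "L i k l x \<in> ob i k" if "i \<le> k" "k \<le> l" "l \<le> 3" "(i, k, l) \<noteq> (0, 2, 3)" "x \<in> ob i l" for i k l x
    by (rule span_quad_L_in[OF q[of i i k l]]) (use that in auto)
  have R: "R i k l x \<in> ob k l" if "i \<le> k" "k \<le> l" "l \<le> 3" "(i, k, l) \<noteq> (0, 2, 3)" "x \<in> ob i l" for i k l x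
    by (rule span_quad_R_in[OF q[of i i k l]]) (use that in auto)
  note LL = span_quad_LL[OF q] and RR = span_quad_RR[OF q] and RL = span_quad_RL[OF q]
    and Lid = span_quad_L_id[OF q] and Rid = span_quad_R_id[OF q] and ex1 = span_quad_ex1[OF q] and eqI = span_quad_eqI[OF q]
  have ex: "\<exists>!z. z \<in> ob 0 2 \<and> L 0 1 2 z = L 0 1 3 x \<and> R 0 1 2 z = L 1 2 3 (R 0 1 3 x)" if x: "x \<in> ob 0 3" for x
    using x RL[of 0 1 1 3 x] LL[of 1 1 2 3 "R 0 1 3 x"] by (intro ex1[of 0 0 1 2]) (auto simp: L R)
  \<comment> \<open>\<open>f\<close> and \<open>g\<close> are the two missing maps from \<open>(0,\<dots>,3)\<close> to \<open>(0,\<dots>,2)\<close> and to \<open>(2,3)\<close>.\<close>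
  define f where "f = (\<lambda>x\<in>ob 0 3. THE z. z \<in> ob 0 2 \<and> L 0 1 2 z = L 0 1 3 x \<and> R 0 1 2 z = L 1 2 3 (R 0 1 3 x))"
  define g where "g = (\<lambda>x\<in>ob 0 3. R 1 2 3 (R 0 1 3 x))"
  have f: "f x \<in> ob 0 2" "L 0 1 2 (f x) = L 0 1 3 x" "R 0 1 2 (f x) = L 1 2 3 (R 0 1 3 x)" if "x \<in> ob 0 3" for x
    using theI'[OF ex[OF that]] that by (simp_all add: f_def)
  have g: "g x \<in> ob 2 3" if "x \<in> ob 0 3" for x using that by (simp add: g_def R)
  define L' where "L' = (\<lambda>i j k. if i = 0 \<and> j = (2::nat) \<and> k = (3::nat) then f else L i j k)"
  define R' where "R' = (\<lambda>i j k. if i = 0 \<and> j = (2::nat) \<and> k = (3::nat) then g else R i j k)"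
  note defs = L'_def R'_def
  have old: "span_quad ob L' R' i j k l" if "i \<le> j" "j \<le> k" "k \<le> l" "l \<le> 3" "\<not> ?P i j k l" for i j k l
    by (rule span_quad_cong[OF q[OF that] that(1-3)]) (use that in \<open>auto simp: defs\<close>)
  have base: "span_quad ob L' R' 0 0 2 3"
    unfolding span_quad_def
  proof (intro conjI ballI impI)
    show "finite (ob 0 3)" using span_quad_finite[OF q[of 0 0 0 3]] by simp
    show "L' 0 2 3 \<in> ob 0 3 \<rightarrow>\<^sub>E ob 0 2" "R' 0 2 3 \<in> ob 0 3 \<rightarrow>\<^sub>E ob 2 3"
      using f g by (auto simp: defs) (simp_all add: f_def g_def)
    fix x assume x: "x \<in> ob 0 3"
    show "L' 0 3 3 x = x" "R' 0 0 3 x = x" "R' 0 2 3 (R' 0 0 3 x) = R' 0 2 3 x"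
      "R' 0 0 2 (L' 0 2 3 x) = L' 0 2 3 (R' 0 0 3 x)"
      using x Lid[of 0 0 0 3 x] Rid[of 0 0 0 3 x] Rid[of 0 0 0 2 "f x"] f by (simp_all add: defs)
    show "L' 0 0 2 (L' 0 2 3 x) = L' 0 0 3 x"
      using x f LL[of 0 0 1 2 "f x"] LL[of 0 0 1 3 x] by (simp add: defs)
  next
    fix x y assume x: "x \<in> ob 0 2" and y: "y \<in> ob 2 3" and "R' 0 2 2 x = L' 2 2 3 y"
    then have e: "R 0 2 2 x = L 2 2 3 y" by (simp add: defs)
    obtain v where v: "v \<in> ob 1 3" "L 1 2 3 v = R 0 1 2 x" "R 1 2 3 v = y"
      using ex1[of 1 1 2 3 "R 0 1 2 x" y] RR[of 0 1 2 2 x] x y e by (auto simp: R)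
    obtain z where z: "z \<in> ob 0 3" "L 0 1 3 z = L 0 1 2 x" "R 0 1 3 z = v"
      using ex1[of 0 0 1 3 "L 0 1 2 x" v] RL[of 0 1 1 2 x] LL[of 1 1 2 3 v] x v by (auto simp: L)
    have fz: "f z = x" by (rule eqI[of 0 1 2]) (use f z x v in auto)
    have gz: "g z = y" using z v by (simp add: g_def)
    have uniq: "z' = z" if z': "z' \<in> ob 0 3" "f z' = x" "g z' = y" for z'
    proof (rule eqI[of 0 1 3])
      have "R 0 1 3 z' = v"
        by (rule eqI[of 1 2 3]) (use f z' v R in \<open>auto simp: g_def\<close>)
      then show "R 0 1 3 z' = R 0 1 3 z" using z by simp
      show "L 0 1 3 z' = L 0 1 3 z" using f z z' by metis
    qed (use z z' in auto)
    have LR: "L' 0 2 3 = f" "R' 0 2 3 = g" by (simp_all add: defs)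
    show "\<exists>!z. z \<in> ob 0 3 \<and> L' 0 2 3 z = x \<and> R' 0 2 3 z = y"
      unfolding LR
    proof (rule ex1I[of _ z])
      show "z' = z" if "z' \<in> ob 0 3 \<and> f z' = x \<and> g z' = y" for z' using that uniq by blast
    qed (use z(1) fz gz in simp)
  qed
  have i123: "span_quad ob L' R' 0 1 2 3"
  proof (rule span_quadI[OF base])
    fix x assume x: "x \<in> ob 0 3"
    show "L' 0 1 2 (L' 0 2 3 x) = L' 0 1 3 x" "R' 0 1 2 (L' 0 2 3 x) = L' 1 2 3 (R' 0 1 3 x)"
      using f[OF x] by (simp_all add: defs)
    show "R' 1 2 3 (R' 0 1 3 x) = R' 0 2 3 x" using x by (simp add: defs g_def)
  qed
  have i223: "span_quad ob L' R' 0 2 2 3"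
  proof (rule span_quadI[OF base])
    fix x assume x: "x \<in> ob 0 3"
    show "L' 0 2 2 (L' 0 2 3 x) = L' 0 2 3 x" using x f Lid[of 0 0 0 2 "f x"] by (simp add: defs)
    show "R' 2 2 3 (R' 0 2 3 x) = R' 0 2 3 x" using x g Rid[of 2 2 2 3 "g x"] by (simp add: defs)
    show "R' 0 2 2 (L' 0 2 3 x) = L' 2 2 3 (R' 0 2 3 x)"
      using x f RR[of 0 1 2 2 "f x"] RL[of 1 2 2 3 "R 0 1 3 x"] by (simp add: defs g_def R)
  qed
  have i233: "span_quad ob L' R' 0 2 3 3"
  proof (rule span_quadI)
    show "span_quad ob L' R' 0 0 3 3" by (rule old) auto
    fix x assume x: "x \<in> ob 0 3"
    show "L' 0 2 3 (L' 0 3 3 x) = L' 0 2 3 x" using x Lid[of 0 0 0 3 x] by (simp add: defs)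
    show "R' 2 3 3 (R' 0 2 3 x) = R' 0 3 3 x"
      using x RR[of 1 2 3 3 "R 0 1 3 x"] RR[of 0 1 3 3 x] by (simp add: defs g_def R)
    show "R' 0 2 3 (L' 0 3 3 x) = L' 2 3 3 (R' 0 2 3 x)"
      using x g Lid[of 0 0 0 3 x] Lid[of 2 2 2 3 "g x"] by (simp add: defs)
  qed
  have "span_quad ob L' R' i j k l" if le: "i \<le> j" "j \<le> k" "k \<le> l" "l \<le> 3" for i j k l
  proof (cases "?P i j k l")
    case True
    then have "(j = 0 \<and> k = 2) \<or> (j = 1 \<and> k = 2) \<or> (j = 2 \<and> k = 2) \<or> (j = 2 \<and> k = 3)" using le by auto
    then show ?thesis using True base i123 i223 i233 by auto
  qed (use old[OF le] in auto)
  then have "partial_span_data 3 UNIV ob L' R'" by (simp add: partial_span_data_def)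
  then show ?thesis
    unfolding span_data_extensible_def span_data_extend_def
    by (intro exI[of _ ob] exI[of _ L'] exI[of _ R']) (auto simp: defs S)
qed

text \<open>In dimension four there is nothing to construct. Both sides of each of the missing equations are
  compared after restriction to shorter intervals, as provided by the four given tetrahedra.\<close>

lemma span_horn_4_1:
  assumes D: "partial_span_data 4 S ob L R" and S: "\<And>V. V \<subseteq> {..4} \<Longrightarrow> V \<in> S \<longleftrightarrow> \<not> {0, 2, 3, 4} \<subseteq> V"
  shows "span_data_extensible 4 S ob L R"
proof -
  have q: "span_quad ob L R i j k l" if "i \<le> j" "j \<le> k" "k \<le> l" "l \<le> 4" "(i, j, k, l) \<noteq> (0, 2, 3, 4)" for i j k l
    using that by (intro partial_span_data_quad[OF D]) (auto simp: S)
  have L: "L i k l x \<in> ob i k" if "i \<le> k" "k \<le> l" "l \<le> 4" "x \<in> ob i l" for i k l x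
    using that span_quad_L_in[OF q[of i i k l]] by auto
  have R: "R i k l x \<in> ob k l" if "i \<le> k" "k \<le> l" "l \<le> 4" "x \<in> ob i l" for i k l x
    using that span_quad_R_in[OF q[of i i k l]] by auto
  note LL = span_quad_LL[OF q] and RR = span_quad_RR[OF q] and RL = span_quad_RL[OF q] and eqI = span_quad_eqI[OF q]
  have "span_quad ob L R 0 2 3 4"
  proof (rule span_quadI)
    show "span_quad ob L R 0 0 3 4" by (rule q) auto
    fix x assume x: "x \<in> ob 0 4"
    have y: "L 0 3 4 x \<in> ob 0 3" and w: "R 0 1 4 x \<in> ob 1 4" using x by (simp_all add: L R)
    show "L 0 2 3 (L 0 3 4 x) = L 0 2 4 x"
    proof (rule eqI[of 0 1 2])
      show "L 0 1 2 (L 0 2 3 (L 0 3 4 x)) = L 0 1 2 (L 0 2 4 x)"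
        using LL[OF _ _ _ _ _ y, of 1 2] LL[OF _ _ _ _ _ x, of 1 3] LL[OF _ _ _ _ _ x, of 1 2] by simp
      show "R 0 1 2 (L 0 2 3 (L 0 3 4 x)) = R 0 1 2 (L 0 2 4 x)"
        using RL[OF _ _ _ _ _ y, of 1 2] RL[OF _ _ _ _ _ x, of 1 3] LL[OF _ _ _ _ _ w, of 2 3]
          RL[OF _ _ _ _ _ x, of 1 2] by simp
    qed (use x y in \<open>auto intro: L\<close>)
    show "R 2 3 4 (R 0 2 4 x) = R 0 3 4 x"
      using RR[OF _ _ _ _ _ x, of 1 2] RR[OF _ _ _ _ _ w, of 2 3] RR[OF _ _ _ _ _ x, of 1 3] by simp
    show "R 0 2 3 (L 0 3 4 x) = L 2 3 4 (R 0 2 4 x)"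
      using RR[OF _ _ _ _ _ y, of 1 2] RL[OF _ _ _ _ _ x, of 1 3] RL[OF _ _ _ _ _ w, of 2 3]
        RR[OF _ _ _ _ _ x, of 1 2] by simp
  qed
  then have "span_quad ob L R i j k l" if "i \<le> j" "j \<le> k" "k \<le> l" "l \<le> 4" for i j k l
    using q[OF that] by (cases "(i, j, k, l) = (0, 2, 3, 4)") auto
  then show ?thesis by (rule span_data_extensible_same)
qed

lemma span_horn_4_2:
  assumes D: "partial_span_data 4 S ob L R" and S: "\<And>V. V \<subseteq> {..4} \<Longrightarrow> V \<in> S \<longleftrightarrow> \<not> {0, 1, 3, 4} \<subseteq> V"
  shows "span_data_extensible 4 S ob L R"
proof -
  have q: "span_quad ob L R i j k l" if "i \<le> j" "j \<le> k" "k \<le> l" "l \<le> 4" "(i, j, k, l) \<noteq> (0, 1, 3, 4)" for i j k l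
    using that by (intro partial_span_data_quad[OF D]) (auto simp: S)
  have L: "L i k l x \<in> ob i k" if "i \<le> k" "k \<le> l" "l \<le> 4" "x \<in> ob i l" for i k l x
    using that span_quad_L_in[OF q[of i i k l]] by auto
  have R: "R i k l x \<in> ob k l" if "i \<le> k" "k \<le> l" "l \<le> 4" "x \<in> ob i l" for i k l x
    using that span_quad_R_in[OF q[of i i k l]] by auto
  note LL = span_quad_LL[OF q] and RR = span_quad_RR[OF q] and RL = span_quad_RL[OF q] and eqI = span_quad_eqI[OF q]
  have "span_quad ob L R 0 1 3 4"
  proof (rule span_quadI)
    show "span_quad ob L R 0 0 3 4" by (rule q) auto
    fix x assume x: "x \<in> ob 0 4"
    have y: "L 0 3 4 x \<in> ob 0 3" and w: "R 0 1 4 x \<in> ob 1 4" using x by (simp_all add: L R)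
    show "L 0 1 3 (L 0 3 4 x) = L 0 1 4 x"
      using LL[OF _ _ _ _ _ y, of 1 2] LL[OF _ _ _ _ _ x, of 2 3] LL[OF _ _ _ _ _ x, of 1 2] by simp
    show "R 1 3 4 (R 0 1 4 x) = R 0 3 4 x"
      using RR[OF _ _ _ _ _ w, of 2 3] RR[OF _ _ _ _ _ x, of 1 2] RR[OF _ _ _ _ _ x, of 2 3] by simp
    show "R 0 1 3 (L 0 3 4 x) = L 1 3 4 (R 0 1 4 x)"
    proof (rule eqI[of 1 2 3])
      show "L 1 2 3 (R 0 1 3 (L 0 3 4 x)) = L 1 2 3 (L 1 3 4 (R 0 1 4 x))"
        using RL[OF _ _ _ _ _ y, of 1 2] LL[OF _ _ _ _ _ x, of 2 3] RL[OF _ _ _ _ _ x, of 1 2]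
          LL[OF _ _ _ _ _ w, of 2 3] by simp
      show "R 1 2 3 (R 0 1 3 (L 0 3 4 x)) = R 1 2 3 (L 1 3 4 (R 0 1 4 x))"
        using RR[OF _ _ _ _ _ y, of 1 2] RL[OF _ _ _ _ _ x, of 2 3] RL[OF _ _ _ _ _ w, of 2 3]
          RR[OF _ _ _ _ _ x, of 1 2] by simp
    qed (use y w in \<open>auto intro: L R\<close>)
  qed
  then have "span_quad ob L R i j k l" if "i \<le> j" "j \<le> k" "k \<le> l" "l \<le> 4" for i j k l
    using q[OF that] by (cases "(i, j, k, l) = (0, 1, 3, 4)") auto
  then show ?thesis by (rule span_data_extensible_same)
qed

lemma reverse_superset_iff:
  fixes n :: nat
  assumes "A \<subseteq> {..n}" "V \<subseteq> {..n}"
  shows "A \<subseteq> (\<lambda>i. n - i) ` V \<longleftrightarrow> (\<lambda>i. n - i) ` A \<subseteq> V"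
proof -
  have "a \<in> (\<lambda>i. n - i) ` V \<longleftrightarrow> n - a \<in> V" if "a \<in> A" for a
  proof -
    have "a \<le> n" using that assms(1) by auto
    then show ?thesis using assms(2) by (force simp: image_iff)
  qed
  then show ?thesis unfolding image_subset_iff subset_eq[of A] by (intro ball_cong refl)
qed

text \<open>The horn contains all faces with four vertices if \<open>n\<close> is at least five. The remaining horns that were
  not treated above are mirror images.\<close>

lemma inner_horn_extensible:
  fixes ob :: "nat \<Rightarrow> nat \<Rightarrow> 'u::infinite set"
  assumes k: "0 < k" "k < n" and D: "partial_span_data n {V. \<not> {..n} - {k} \<subseteq> V} ob L R"
  shows "span_data_extensible n {V. \<not> {..n} - {k} \<subseteq> V} ob L R"
proof (cases "n \<le> 4")
  case False
  have "span_quad ob L R i j l m" if "i \<le> j" "j \<le> l" "l \<le> m" "m \<le> n" for i j l m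
  proof (rule partial_span_data_quad[OF D that])
    have "card {i, j, l, m} \<le> 4" by (simp add: card_insert_if)
    moreover have "card ({..n} - {k}) = n" using k by simp
    ultimately show "{i, j, l, m} \<in> {V. \<not> {..n} - {k} \<subseteq> V}"
      using False card_mono[of "{i, j, l, m}" "{..n} - {k}"] by auto
  qed
  then show ?thesis by (rule span_data_extensible_same)
next
  case True
  let ?S = "{V. \<not> {..n} - {k} \<subseteq> V}"
  let ?rev = "partial_span_data n {V. (\<lambda>i. n - i) ` V \<in> ?S} (\<lambda>i j. ob (n - j) (n - i))
     (\<lambda>i j k. R (n - k) (n - j) (n - i)) (\<lambda>i j k. L (n - k) (n - j) (n - i))"
  have rev: ?rev by (rule partial_span_data_reverse[OF D]) auto
  consider "n = 2" "k = 1" | "n = 3" "k = 1" | "n = 3" "k = 2" | "n = 4" "k = 1" | "n = 4" "k = 2" | "n = 4" "k = 3"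
    using k True by linarith
  then show ?thesis
  proof cases
    case 1
    then have "{..n} - {k} = {0, 2}" by auto
    then show ?thesis using span_horn_2_1[of ?S ob L R] D 1 by simp
  next
    case 2
    then have "{..n} - {k} = {0, 2, 3}" by auto
    then show ?thesis using span_horn_3_1[of ?S ob L R] D 2 by simp
  next
    case 3
    then have e: "{..n} - {k} = {0, 1, 3}" by auto
    have S: "V \<in> {V. (\<lambda>i. 3 - i) ` V \<in> ?S} \<longleftrightarrow> \<not> {0, 2, 3} \<subseteq> V" if "V \<subseteq> {..3}" for V
    proof -
      have "{0, 1, 3} \<subseteq> (\<lambda>i. 3 - i) ` V \<longleftrightarrow> (\<lambda>i. 3 - i) ` {0, 1, 3} \<subseteq> V"
        by (rule reverse_superset_iff) (use that in auto)
      moreover have "(\<lambda>i. 3 - i) ` {0, 1, 3} = ({0, 2, 3} :: nat set)" by auto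
      ultimately show ?thesis by (simp only: mem_Collect_eq e)
    qed
    show ?thesis
      by (rule span_data_extensible_reverse, unfold 3(1), rule span_horn_3_1[OF rev[unfolded 3(1)]])
        (use S 3(1) in simp)
  next
    case 4
    then have "{..n} - {k} = {0, 2, 3, 4}" by auto
    then show ?thesis using span_horn_4_1[of ?S ob L R] D 4 by simp
  next
    case 5
    then have "{..n} - {k} = {0, 1, 3, 4}" by auto
    then show ?thesis using span_horn_4_2[of ?S ob L R] D 5 by simp
  next
    case 6
    then have e: "{..n} - {k} = {0, 1, 2, 4}" by auto
    have S: "V \<in> {V. (\<lambda>i. 4 - i) ` V \<in> ?S} \<longleftrightarrow> \<not> {0, 2, 3, 4} \<subseteq> V" if "V \<subseteq> {..4}" for V
    proof -
      have "{0, 1, 2, 4} \<subseteq> (\<lambda>i. 4 - i) ` V \<longleftrightarrow> (\<lambda>i. 4 - i) ` {0, 1, 2, 4} \<subseteq> V"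
        by (rule reverse_superset_iff) (use that in auto)
      moreover have "(\<lambda>i. 4 - i) ` {0, 1, 2, 4} = ({0, 2, 3, 4} :: nat set)" by auto
      ultimately show ?thesis by (simp only: mem_Collect_eq e)
    qed
    show ?thesis
      by (rule span_data_extensible_reverse, unfold 6(1), rule span_horn_4_1[OF rev[unfolded 6(1)]])
        (use S 6(1) in simp)
  qed
qed

lemma quasicategory_Span: "quasicategory Span"
  unfolding quasicategory_def
proof (intro conjI allI impI ballI)
  fix n k and u :: "nat \<Rightarrow> (nat \<Rightarrow> nat) \<Rightarrow> (nat \<times> nat, 'a::infinite) diagram"
  assume k: "0 < k" "k < n" and "u \<in> smap (horn n k) Span"
  then have u: "u \<in> smap (sub_simplex n {V. \<not> {..n} - {k} \<subseteq> V}) Span" by (simp add: horn_sub_simplex)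
  have S: "sieve {V. \<not> {..n} - {k} \<subseteq> V}" using k by (intro sieve_horn) simp
  obtain ob L R where "span_data_extend n {V. \<not> {..n} - {k} \<subseteq> V} (map_ob u) (map_left u) (map_right u) ob L R"
    using inner_horn_extensible[OF k map_partial_span_data[OF u]] unfolding span_data_extensible_def by blast
  note F = fill_map_to_Span[OF u S this]
  show "\<exists>w\<in>smap (simplex n) Span. extends_on (horn n k) w u"
    unfolding horn_sub_simplex using F(2) yoneda_map_smap[OF simplicial_set_Span F(1)] by blast
qed (rule simplicial_set_Span)

section \<open>The functor from finite sets to spans\<close>

lemma ivl_le_snd: "I \<in> Ivl n \<Longrightarrow> J \<in> Ivl n \<Longrightarrow> ivl_le I J \<Longrightarrow> snd J \<le> snd I"
  by (cases I; cases J) (auto simp: ivl_le_iff)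

lemma Rbar_simplices:
  assumes "X \<in> simplices Fin_op n"
  shows "Rbar n X \<in> simplices Span n"
proof -
  have X: "X \<in> fin_functors {..n} (\<ge>)" using assms by (simp add: simplices_Fin_op)
  let ?F = "precompose (Ivl n) ivl_le snd X"
  have F: "?F \<in> fin_functors (Ivl n) ivl_le"
    by (rule precompose_fin_functors[OF X]) (auto simp: ivl_le_refl intro: ivl_le_trans ivl_le_snd)
  have "fin_pullback (fst ?F (ivl_union I J)) (fst ?F I) (fst ?F J)
      (snd ?F (ivl_union I J) I) (snd ?F (ivl_union I J) J)
      (snd ?F I (ivl_inter I J)) (snd ?F J (ivl_inter I J))"
    if IJ: "I \<in> Ivl n" "J \<in> Ivl n" "ivl_meet I J" for I J
  proof -
    obtain i j k l where e: "I = (i, j)" "J = (k, l)" by (metis surj_pair)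
    have b: "i \<le> j" "j \<le> n" "k \<le> l" "l \<le> n" "i \<le> l" "k \<le> j" using IJ by (auto simp: e ivl_meet_iff)
    have b': "min i k \<le> j" "min i k \<le> l" "max i k \<le> j" "max i k \<le> l" using b by auto
    have pb: "fin_pullback (fst X p) (fst X p) (fst X q) (snd X p p) (snd X p q) (snd X p q) (snd X q q)"
      if "q \<le> p" "p \<le> n" for p q
      by (rule fin_pullback_id[OF X]) (use that in auto)
    show ?thesis
    proof (cases "l \<le> j")
      case True
      then show ?thesis using pb[OF True] b b'
        by (simp add: e ivl_union_def ivl_inter_def precompose_def ivl_leI)
    next
      case False
      then show ?thesis using fin_pullback_swap[OF pb[of j l]] b b'
        by (simp add: e ivl_union_def ivl_inter_def precompose_def ivl_leI)
    qed
  qed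
  then show ?thesis using F assms by (simp add: Rbar_def simplices_Span span_simplices_def)
qed

lemma Rbar_smap: "Rbar \<in> smap Fin_op Span"
proof (rule smapI)
  fix m n \<alpha> and X :: "(nat, 'a::infinite) diagram"
  assume \<alpha>: "\<alpha> \<in> Delta m n" and X: "X \<in> simplices Fin_op n"
  have X': "act Fin_op m n \<alpha> X \<in> simplices Fin_op m"
    by (rule simplicial_set_simplices[OF simplicial_set_Fin_op \<alpha> X])
  have "precompose (Ivl m) ivl_le snd (precompose {..m} (\<ge>) \<alpha> X) = precompose (Ivl m) ivl_le (\<lambda>p. \<alpha> (snd p)) X"
    by (rule precompose_precompose) (auto intro: ivl_le_snd)
  also have "\<dots> = precompose (Ivl m) ivl_le (\<lambda>(i, j). (\<alpha> i, \<alpha> j)) (precompose (Ivl n) ivl_le snd X)"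
  proof (rule precompose_precompose[symmetric])
    show "(case p of (i, j) \<Rightarrow> (\<alpha> i, \<alpha> j)) \<in> Ivl n" if "p \<in> Ivl m" for p
      using that Delta_le[OF \<alpha>] Delta_mono[OF \<alpha>] by (cases p) auto
    show "ivl_le (case p of (i, j) \<Rightarrow> (\<alpha> i, \<alpha> j)) (case q of (i, j) \<Rightarrow> (\<alpha> i, \<alpha> j))"
      if "p \<in> Ivl m" "q \<in> Ivl m" "ivl_le p q" for p q
      using that Delta_mono[OF \<alpha>] by (cases p; cases q) (auto simp: ivl_le_iff)
  qed auto
  finally show "Rbar m (act Fin_op m n \<alpha> X) = act Span m n \<alpha> (Rbar n X)"
    using X X' by (simp add: Rbar_def act_Fin_op act_Span)
next
  show "Rbar n X \<in> simplices Span n" if "X \<in> simplices Fin_op n" for n and X :: "(nat, 'a) diagram"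
    using that by (rule Rbar_simplices)
qed (simp add: Rbar_def)

lemma Rbar_ob: "X \<in> simplices Fin_op n \<Longrightarrow> i \<le> j \<Longrightarrow> j \<le> n \<Longrightarrow> fst (Rbar n X) (i, j) = fst X j"
  by (simp add: Rbar_def precompose_def)

lemma Rbar_Mor: "X \<in> simplices Fin_op n \<Longrightarrow> i \<le> k \<Longrightarrow> k \<le> l \<Longrightarrow> l \<le> j \<Longrightarrow> j \<le> n \<Longrightarrow>
    snd (Rbar n X) (i, j) (k, l) = snd X j l"
  by (simp add: Rbar_def precompose_def ivl_leI)

text \<open>The inverse of an identity edge and the 2-simplices that witness this are degenerate.\<close>

lemma equivalence_identity_edge:
  assumes Y: "simplicial_set Y" and y: "y \<in> simplices Y 0"
  shows "equivalence_edge Y (identity_edge Y y)"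
    and "source Y (identity_edge Y y) = y" "target Y (identity_edge Y y) = y"
proof -
  have act0: "act Y m n \<alpha> (constant_at Y n y) = constant_at Y m y" if "\<alpha> \<in> Delta m n" for m n \<alpha>
    by (rule act_constant_at[OF Y y that])
  have ie: "identity_edge Y y = constant_at Y 1 y" by (simp add: identity_edge_def constant_at_def)
  have cf: "coface n k \<in> Delta n (Suc n)" for n k unfolding coface_def by (rule DeltaI) auto
  have faces: "face Y n k (constant_at Y (Suc n) y) = constant_at Y n y" for n k
    by (simp add: face_def act0[OF cf])
  have in1: "constant_at Y n y \<in> simplices Y n" for n by (rule constant_at_simplices[OF Y y])
  show s: "source Y (identity_edge Y y) = y" and t: "target Y (identity_edge Y y) = y"
    using faces[of 0] constant_at_0[OF Y y] by (simp_all add: source_def target_def ie)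
  have comp: "is_composite Y (constant_at Y 1 y) (constant_at Y 1 y) (constant_at Y 1 y)"
    unfolding is_composite_def using faces[of 1] in1[of 2]
    by (intro bexI[of _ "constant_at Y 2 y"]) (simp_all add: numeral_2_eq_2)
  show "equivalence_edge Y (identity_edge Y y)"
    unfolding equivalence_edge_def s t using in1[of 1] comp
    by (intro conjI bexI[of _ "constant_at Y 1 y"]) (simp_all only: ie)
qed

lemma essentially_surjective_Rbar: "essentially_surjective Fin_op Span Rbar"
  unfolding essentially_surjective_def
proof (intro ballI)
  fix y :: "(nat \<times> nat, 'a::infinite) diagram" assume y: "y \<in> simplices Span 0"
  then have y': "y \<in> fin_functors (Ivl 0) ivl_le" by (simp add: simplices_Span span_simplices_def)
  have I0: "Ivl 0 = {(0, 0)}" by (auto simp: Ivl_def)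
  define X where "X = precompose {..0} (\<ge>) (\<lambda>i. (i, i)) y"
  have X: "X \<in> simplices Fin_op 0"
    unfolding X_def simplices_Fin_op
    by (rule precompose_fin_functors[OF y']) (auto simp: ivl_le_refl)
  have "Rbar 0 X = precompose (Ivl 0) ivl_le (\<lambda>p. (snd p, snd p)) y"
    using X unfolding Rbar_def X_def
    by (simp, intro precompose_precompose) (auto intro: ivl_le_snd)
  also have "\<dots> = y" by (rule precompose_id[OF y']) (auto simp: I0)
  finally have "Rbar 0 X = y" .
  then show "\<exists>x\<in>simplices Fin_op 0. \<exists>e. equivalence_edge Span e \<and> source Span e = Rbar 0 x \<and> target Span e = y"
    using X equivalence_identity_edge[OF simplicial_set_Span y] by blast
qed


section \<open>Product cones in the opposite of finite sets\<close>

lemma cone_solution_boundary: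
  assumes "cone_solution I X n b h y w" "\<beta> \<in> simplices (boundary (Suc n)) k"
  shows "act X k (Suc n) \<beta> y = b k \<beta>"
proof -
  have "yoneda_map X (Suc n) y k \<beta> = b k \<beta>"
    using assms unfolding cone_solution_def extends_on_def by blast
  then show ?thesis using assms(2) yoneda_map_apply[of \<beta> k "Suc n" X y] by (simp add: simplices_boundary)
qed

lemma cone_solution_horn:
  assumes "cone_solution I X n b h y w" "i \<in> I" "\<gamma> \<in> simplices (horn (Suc (Suc n)) (Suc (Suc n))) k"
  shows "act X k (Suc (Suc n)) \<gamma> (w i) = h i k \<gamma>"
proof -
  have "yoneda_map X (Suc (Suc n)) (w i) k \<gamma> = h i k \<gamma>"
    using assms unfolding cone_solution_def extends_on_def by blast
  then show ?thesis using assms(3) yoneda_map_apply[of \<gamma> k "Suc (Suc n)" X "w i"] by (simp add: simplices_horn)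
qed

text \<open>The diagram \<open>(Ob, Mor)\<close> has to be functorial only on the vertex sets in \<open>S\<close>, so this map need not extend
  to the whole simplex.\<close>

definition fin_op_map :: "nat \<Rightarrow> nat set set \<Rightarrow> (nat \<Rightarrow> 'u set) \<Rightarrow> (nat \<Rightarrow> nat \<Rightarrow> 'u \<Rightarrow> 'u)
    \<Rightarrow> nat \<Rightarrow> (nat \<Rightarrow> nat) \<Rightarrow> (nat, 'u) diagram" where
  "fin_op_map n S Ob Mor = (\<lambda>m. \<lambda>\<beta>\<in>simplices (sub_simplex n S) m. precompose {..m} (\<ge>) \<beta> (Ob, Mor))"

lemma fin_op_map_smap:
  assumes S: "sieve S"
    and fin: "\<And>p. p \<le> n \<Longrightarrow> {p} \<in> S \<Longrightarrow> finite (Ob p)"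
    and mor: "\<And>p q. q \<le> p \<Longrightarrow> p \<le> n \<Longrightarrow> {p, q} \<in> S \<Longrightarrow> Mor p q \<in> Ob p \<rightarrow>\<^sub>E Ob q"
    and id: "\<And>p x. p \<le> n \<Longrightarrow> {p} \<in> S \<Longrightarrow> x \<in> Ob p \<Longrightarrow> Mor p p x = x"
    and comp: "\<And>p q r x. r \<le> q \<Longrightarrow> q \<le> p \<Longrightarrow> p \<le> n \<Longrightarrow> {p, q, r} \<in> S \<Longrightarrow> x \<in> Ob p \<Longrightarrow>
        Mor p r x = Mor q r (Mor p q x)"
  shows "fin_op_map n S Ob Mor \<in> smap (sub_simplex n S) Fin_op"
proof (rule smapI)
  fix m \<beta> assume \<beta>: "\<beta> \<in> simplices (sub_simplex n S) m"
  then have \<beta>': "\<beta> \<in> Delta m n" and im: "\<beta> ` {..m} \<in> S" by (auto simp: simplices_sub_simplex)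
  note le = Delta_le[OF \<beta>'] and mono = Delta_mono[OF \<beta>'] and sub = sieveD[OF S im]
  have "precompose {..m} (\<ge>) \<beta> (Ob, Mor) \<in> fin_functors {..m} (\<ge>)"
    unfolding precompose_def
  proof (rule fin_functorsI)
    fix p q assume "p \<in> {..m}" "q \<in> {..m}" "q \<le> p"
    moreover from this have "Mor (\<beta> p) (\<beta> q) \<in> Ob (\<beta> p) \<rightarrow>\<^sub>E Ob (\<beta> q)"
      by (intro mor) (auto intro: mono le sub)
    ultimately show "(if p \<in> {..m} \<and> q \<in> {..m} \<and> q \<le> p then snd (Ob, Mor) (\<beta> p) (\<beta> q) else undefined)
        \<in> (\<lambda>p\<in>{..m}. fst (Ob, Mor) (\<beta> p)) p \<rightarrow>\<^sub>E (\<lambda>p\<in>{..m}. fst (Ob, Mor) (\<beta> p)) q" by simp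
  next
    fix p q r x assume *: "p \<in> {..m}" "q \<in> {..m}" "r \<in> {..m}" "q \<le> p" "r \<le> q"
      "x \<in> (\<lambda>p\<in>{..m}. fst (Ob, Mor) (\<beta> p)) p"
    then have "Mor (\<beta> p) (\<beta> r) x = Mor (\<beta> q) (\<beta> r) (Mor (\<beta> p) (\<beta> q) x)"
      by (intro comp) (auto intro: mono le sub)
    then show "(if p \<in> {..m} \<and> r \<in> {..m} \<and> r \<le> p then snd (Ob, Mor) (\<beta> p) (\<beta> r) else undefined) x =
        (if q \<in> {..m} \<and> r \<in> {..m} \<and> r \<le> q then snd (Ob, Mor) (\<beta> q) (\<beta> r) else undefined)
         ((if p \<in> {..m} \<and> q \<in> {..m} \<and> q \<le> p then snd (Ob, Mor) (\<beta> p) (\<beta> q) else undefined) x)"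
      using * by simp
  next
    fix p assume "p \<in> {..m}"
    then have "finite (Ob (\<beta> p))" by (intro fin) (auto intro: le sub)
    then show "finite ((\<lambda>p\<in>{..m}. fst (Ob, Mor) (\<beta> p)) p)" using \<open>p \<in> {..m}\<close> by simp
  next
    fix p x assume *: "p \<in> {..m}" "x \<in> (\<lambda>p\<in>{..m}. fst (Ob, Mor) (\<beta> p)) p"
    then have "Mor (\<beta> p) (\<beta> p) x = x" by (intro id) (auto intro: le sub)
    then show "(if p \<in> {..m} \<and> p \<in> {..m} \<and> p \<le> p then snd (Ob, Mor) (\<beta> p) (\<beta> p) else undefined) x = x"
      using * by simp
  qed auto
  then show "fin_op_map n S Ob Mor m \<beta> \<in> simplices Fin_op m"
    using \<beta> by (simp add: fin_op_map_def simplices_Fin_op)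
next
  fix m k \<alpha> \<beta> assume \<alpha>: "\<alpha> \<in> Delta m k" and \<beta>: "\<beta> \<in> simplices (sub_simplex n S) k"
  have "act (sub_simplex n S) m k \<alpha> \<beta> \<in> simplices (sub_simplex n S) m"
    by (rule simplicial_set_simplices[OF simplicial_set_sub_simplex[OF S] \<alpha> \<beta>])
  moreover have "precompose {..m} (\<ge>) \<alpha> (precompose {..k} (\<ge>) \<beta> (Ob, Mor))
      = precompose {..m} (\<ge>) (compose {..m} \<beta> \<alpha>) (Ob, Mor)"
    using Delta_le[OF \<alpha>] Delta_mono[OF \<alpha>] by (intro precompose_precompose) (auto simp: compose_eq)
  ultimately show "fin_op_map n S Ob Mor m (act (sub_simplex n S) m k \<alpha> \<beta>) = act Fin_op m k \<alpha> (fin_op_map n S Ob Mor k \<beta>)"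
    using \<beta> by (simp add: fin_op_map_def act_Fin_op)
qed (simp add: fin_op_map_def)

definition cone_apex :: "(nat \<Rightarrow> (nat \<Rightarrow> nat, 'i) join_simplex \<Rightarrow> (nat, 'u) diagram) \<Rightarrow> 'u set" where
  "cone_apex c = fst (c 0 (InL (\<lambda>i\<in>{..0}. i))) 0"

definition cone_edge :: "(nat \<Rightarrow> (nat \<Rightarrow> nat, 'i) join_simplex \<Rightarrow> 'a) \<Rightarrow> 'i \<Rightarrow> 'a" where
  "cone_edge c i = c 1 (Mid 0 0 (\<lambda>i\<in>{..0}. i) i)"

definition cone_leg :: "(nat \<Rightarrow> (nat \<Rightarrow> nat, 'i) join_simplex \<Rightarrow> (nat, 'u) diagram) \<Rightarrow> 'i \<Rightarrow> 'u set" where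
  "cone_leg c i = fst (cone_edge c i) 1"

definition cone_inj :: "(nat \<Rightarrow> (nat \<Rightarrow> nat, 'i) join_simplex \<Rightarrow> (nat, 'u) diagram) \<Rightarrow> 'i \<Rightarrow> 'u \<Rightarrow> 'u" where
  "cone_inj c i = snd (cone_edge c i) 1 0"

context
  fixes I :: "'i set" and c :: "nat \<Rightarrow> (nat \<Rightarrow> nat, 'i) join_simplex \<Rightarrow> (nat, 'u::infinite) diagram"
  assumes c: "c \<in> smap (join (simplex 0) (discrete I)) Fin_op"
begin

lemma cone_apex_simplex: "c 0 (InL (\<lambda>i\<in>{..0}. i)) \<in> fin_functors {..0} (\<ge>)"
  using smap_simplices[OF c, of "InL (\<lambda>i\<in>{..0}. i)" 0] by (simp add: simplices_Fin_op)

lemma cone_edge_simplex: "i \<in> I \<Longrightarrow> cone_edge c i \<in> fin_functors {..1} (\<ge>)"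
  using smap_simplices[OF c, of "Mid 0 0 (\<lambda>i\<in>{..0}. i) i" 1] by (simp add: simplices_Fin_op cone_edge_def)

lemma cone_edge_0:
  assumes i: "i \<in> I"
  shows "fst (cone_edge c i) 0 = cone_apex c"
proof -
  have "(\<lambda>t\<in>{..0}. 0) \<in> Delta 0 1" by simp
  from smap_natural[OF c this, of "Mid 0 0 (\<lambda>i\<in>{..0}. i) i"] i
  have "c 0 (join_act (simplex 0) (discrete I) 0 1 (\<lambda>t\<in>{..0}. 0) (Mid 0 0 (\<lambda>i\<in>{..0}. i) i))
     = act Fin_op 0 1 (\<lambda>t\<in>{..0}. 0) (cone_edge c i)"
    by (simp add: cone_edge_def)
  moreover have "join_act (simplex 0) (discrete I) 0 1 (\<lambda>t\<in>{..0}. 0) (Mid 0 0 (\<lambda>i\<in>{..0}. i) i)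
      = InL (compose {..0} (\<lambda>i\<in>{..0}. i) (\<lambda>t\<in>{..0}. 0))"
    by (subst join_act_Mid_left) auto
  moreover have "compose {..0} (\<lambda>i\<in>{..0}. i) (\<lambda>t\<in>{..0}. 0) = (\<lambda>i\<in>{..0}. i :: nat)"
    by (auto simp: compose_def fun_eq_iff)
  ultimately have "c 0 (InL (\<lambda>i\<in>{..0}. i)) = act Fin_op 0 1 (\<lambda>t\<in>{..0}. 0) (cone_edge c i)" by metis
  then show ?thesis by (simp add: cone_apex_def act_Fin_op precompose_def)
qed

lemma finite_cone_apex: "finite (cone_apex c)"
  using fin_functors_finite[OF cone_apex_simplex, of 0] by (simp add: cone_apex_def)

lemma finite_cone_leg: "i \<in> I \<Longrightarrow> finite (cone_leg c i)"
  using fin_functors_finite[OF cone_edge_simplex, of i 1] by (simp add: cone_leg_def)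

lemma cone_inj_in: "i \<in> I \<Longrightarrow> cone_inj c i \<in> cone_leg c i \<rightarrow>\<^sub>E cone_apex c"
  using fin_functors_Mor[OF cone_edge_simplex, of i 1 0] by (simp add: cone_leg_def cone_inj_def cone_edge_0)

text \<open>The universal property of a product in the opposite category, in terms of maps of finite sets.\<close>

lemma fin_cone_fill:
  assumes lim: "limit_cone (discrete I) Fin_op c"
    and Ob: "\<And>p. p \<le> n \<Longrightarrow> finite (Ob p)" "Ob (Suc n) = cone_apex c"
    and Mor: "\<And>p q. q \<le> p \<Longrightarrow> p \<le> Suc n \<Longrightarrow> \<not> {..Suc n} \<subseteq> {p, q} \<Longrightarrow> Mor p q \<in> Ob p \<rightarrow>\<^sub>E Ob q"
    and id: "\<And>p x. p \<le> Suc n \<Longrightarrow> x \<in> Ob p \<Longrightarrow> Mor p p x = x"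
    and comp: "\<And>p q r x. r \<le> q \<Longrightarrow> q \<le> p \<Longrightarrow> p \<le> Suc n \<Longrightarrow> \<not> {..Suc n} \<subseteq> {p, q, r} \<Longrightarrow> x \<in> Ob p \<Longrightarrow>
        Mor p r x = Mor q r (Mor p q x)"
    and N: "\<And>i q. i \<in> I \<Longrightarrow> q \<le> Suc n \<Longrightarrow> N i q \<in> cone_leg c i \<rightarrow>\<^sub>E Ob q" "\<And>i. i \<in> I \<Longrightarrow> N i (Suc n) = cone_inj c i"
    and Ncomp: "\<And>i q r x. i \<in> I \<Longrightarrow> r \<le> q \<Longrightarrow> q \<le> Suc n \<Longrightarrow> \<not> {..Suc n} \<subseteq> {q, r} \<Longrightarrow> x \<in> cone_leg c i \<Longrightarrow>
        N i r x = Mor q r (N i q x)"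
  shows "\<exists>y\<in>fin_functors {..Suc n} (\<ge>). (\<forall>p\<le>Suc n. fst y p = Ob p) \<and>
     (\<forall>p q. q \<le> p \<longrightarrow> p \<le> Suc n \<longrightarrow> \<not> {..Suc n} \<subseteq> {p, q} \<longrightarrow> snd y p q = Mor p q) \<and>
     (\<forall>i\<in>I. \<forall>q r. r \<le> q \<longrightarrow> q \<le> Suc n \<longrightarrow> (\<forall>x\<in>cone_leg c i. N i r x = snd y q r (N i q x)))"
proof -
  let ?S = "{V. \<not> {..Suc n} \<subseteq> V}" and ?m = "Suc (Suc n)"
  \<comment> \<open>The last vertex of the horn with index \<open>i\<close> is the leg of the cone at \<open>i\<close>.\<close>
  define Obi where "Obi = (\<lambda>i. Ob(?m := cone_leg c i))"
  define Mori where "Mori = (\<lambda>i p q. if p = ?m then if q = ?m then (\<lambda>x\<in>cone_leg c i. x) else N i q else Mor p q)"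
  define b where "b = fin_op_map (Suc n) ?S Ob Mor"
  define h where "h = (\<lambda>i. fin_op_map ?m ?S (Obi i) (Mori i))"
  have finP: "finite (Ob p)" if "p \<le> Suc n" for p
    using that Ob finite_cone_apex by (cases "p = Suc n") auto
  have b: "b \<in> smap (boundary (Suc n)) Fin_op"
    unfolding b_def boundary_sub_simplex
    by (rule fin_op_map_smap) (use finP Mor id comp in auto)
  have "{..?m} - {?m} = {..Suc n}" by auto
  then have H: "horn ?m ?m = sub_simplex ?m ?S" by (simp only: horn_sub_simplex)
  have h: "h i \<in> smap (horn ?m ?m) Fin_op" if i: "i \<in> I" for i
    unfolding h_def H
  proof (rule fin_op_map_smap)
    show "sieve ?S" by simp
    show "finite (Obi i p)" if "p \<le> ?m" for p
      using that finP finite_cone_leg[OF i] by (simp add: Obi_def)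
    show "Mori i p q \<in> Obi i p \<rightarrow>\<^sub>E Obi i q" if "q \<le> p" "p \<le> ?m" "{p, q} \<in> ?S" for p q
      using that N(1)[OF i] Mor by (auto simp: Obi_def Mori_def)
    show "Mori i p p x = x" if "p \<le> ?m" "x \<in> Obi i p" for p x
      using that id by (auto simp: Obi_def Mori_def split: if_splits)
    show "Mori i p r x = Mori i q r (Mori i p q x)"
      if *: "r \<le> q" "q \<le> p" "p \<le> ?m" "{p, q, r} \<in> ?S" "x \<in> Obi i p" for p q r x
    proof (cases "p = ?m")
      case False
      then show ?thesis using * comp[of r q p x] by (simp add: Obi_def Mori_def)
    next
      case True
      show ?thesis
      proof (cases "q = ?m")
        case True
        then show ?thesis using * \<open>p = ?m\<close> by (simp add: Obi_def Mori_def)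
      next
        case False
        then have "\<not> {..Suc n} \<subseteq> {q, r}" using * by blast
        then show ?thesis using * True False Ncomp[OF i, of r q x] by (simp add: Obi_def Mori_def)
      qed
    qed
  qed
  have P: "cone_problem I Fin_op c n b h"
    unfolding cone_problem_def
  proof (intro conjI ballI)
    show "b \<in> smap (boundary (Suc n)) Fin_op" by (rule b)
    have last: "(\<lambda>i\<in>{..0}. Suc n) \<in> simplices (boundary (Suc n)) 0"
      by (auto simp: simplices_boundary)
    show "b 0 (\<lambda>i\<in>{..0}. Suc n) = c 0 (InL (\<lambda>i\<in>{..0}. i))"
    proof (rule fin_functors_eqI[OF _ cone_apex_simplex])
      show "b 0 (\<lambda>i\<in>{..0}. Suc n) \<in> fin_functors {..0} (\<ge>)"
        using smap_simplices[OF b last] by (simp add: simplices_Fin_op)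
      have e: "b 0 (\<lambda>i\<in>{..0}. Suc n) = precompose {..0} (\<ge>) (\<lambda>i\<in>{..0}. Suc n) (Ob, Mor)"
        using last by (simp add: b_def fin_op_map_def boundary_sub_simplex)
      show "fst (b 0 (\<lambda>i\<in>{..0}. Suc n)) p = fst (c 0 (InL (\<lambda>i\<in>{..0}. i))) p" if "p \<in> {..0}" for p
        using that Ob by (simp add: e precompose_def cone_apex_def)
      have "Mor (Suc n) (Suc n) = (\<lambda>x\<in>cone_apex c. x)"
        using Mor[of "Suc n" "Suc n"] id[of "Suc n"] Ob
        by (intro extensionalityI[of _ "cone_apex c"]) (auto simp: PiE_def)
      then show "snd (b 0 (\<lambda>i\<in>{..0}. Suc n)) p q = snd (c 0 (InL (\<lambda>i\<in>{..0}. i))) p q"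
        if "p \<in> {..0}" "q \<in> {..0}" for p q
        using that fin_functors_id[OF cone_apex_simplex, of 0] by (simp add: e precompose_def cone_apex_def)
    qed
  next
    fix i assume i: "i \<in> I"
    show "h i \<in> smap (horn ?m ?m) Fin_op" by (rule h[OF i])
    show "extends_on (boundary (Suc n)) (h i) b"
      unfolding extends_on_def
    proof (intro allI ballI)
      fix k \<beta> assume \<beta>: "\<beta> \<in> simplices (boundary (Suc n)) k"
      then have "\<beta> \<in> Delta k (Suc n)" by (simp add: simplices_boundary)
      from Delta_le[OF this] have "\<beta> t \<noteq> ?m" if "t \<le> k" for t using that by (metis Suc_n_not_le_n)
      then have "precompose {..k} (\<ge>) \<beta> (Obi i, Mori i) = precompose {..k} (\<ge>) \<beta> (Ob, Mor)"
        by (auto simp: precompose_def Obi_def Mori_def fun_eq_iff)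
      then show "h i k \<beta> = b k \<beta>"
        using \<beta> boundary_subset_horn[OF \<beta>] unfolding H
        by (simp add: h_def b_def fin_op_map_def boundary_sub_simplex)
    qed
    show "h i 1 (last_edge (Suc n)) = c 1 (Mid 0 0 (\<lambda>i\<in>{..0}. i) i)"
      unfolding cone_edge_def[symmetric]
    proof (rule fin_functors_eqI[OF _ cone_edge_simplex[OF i]])
      show "h i 1 (last_edge (Suc n)) \<in> fin_functors {..1} (\<ge>)"
        using smap_simplices[OF h[OF i] last_edge_in_horn] by (simp add: simplices_Fin_op)
      have e: "h i 1 (last_edge (Suc n)) = precompose {..1} (\<ge>) (last_edge (Suc n)) (Obi i, Mori i)"
        using last_edge_in_horn[of n] unfolding H h_def fin_op_map_def by (rule restrict_apply')
      have v: "last_edge (Suc n) 0 = Suc n" "last_edge (Suc n) 1 = ?m" by (simp_all add: last_edge_def)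
      have eo: "fst (h i 1 (last_edge (Suc n))) p = Obi i (last_edge (Suc n) p)" if "p \<in> {..1}" for p
        unfolding e using that by (simp add: precompose_def)
      have em: "snd (h i 1 (last_edge (Suc n))) p q = Mori i (last_edge (Suc n) p) (last_edge (Suc n) q)"
        if "p \<in> {..1}" "q \<in> {..1}" "q \<le> p" for p q
        unfolding e using that by (simp add: precompose_def)
      show "fst (h i 1 (last_edge (Suc n))) p = fst (cone_edge c i) p" if p: "p \<in> {..1}" for p
      proof -
        have "p = 0 \<or> p = 1" using that by auto
        then show ?thesis
        proof
          assume p0: "p = 0"
          show ?thesis unfolding eo[OF p] unfolding p0 v using Ob cone_edge_0[OF i] by (simp add: Obi_def)
        next
          assume p1: "p = 1"
          show ?thesis unfolding eo[OF p] unfolding p1 v by (simp add: Obi_def cone_leg_def)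
        qed
      qed
      have M: "Mor (Suc n) (Suc n) = (\<lambda>x\<in>cone_apex c. x)"
        using Mor[of "Suc n" "Suc n"] id[of "Suc n"] Ob
        by (intro extensionalityI[of _ "cone_apex c"]) (auto simp: PiE_def)
      show "snd (h i 1 (last_edge (Suc n))) p q = snd (cone_edge c i) p q"
        if pq: "p \<in> {..1}" "q \<in> {..1}" "q \<le> p" for p q
      proof -
        consider "p = 0" "q = 0" | "p = 1" "q = 0" | "p = 1" "q = 1"
          using pq by (cases "p = 0"; cases "q = 0") (auto simp: le_Suc_eq)
        then show ?thesis
        proof cases
          case 1
          have "snd (cone_edge c i) 0 0 = (\<lambda>x\<in>cone_apex c. x)"
            using fin_functors_id[OF cone_edge_simplex[OF i], of 0] by (simp add: cone_edge_0[OF i])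
          then show ?thesis unfolding em[OF pq] unfolding 1 v by (simp add: Mori_def M)
        next
          case 2
          show ?thesis unfolding em[OF pq] unfolding 2 v by (simp add: Mori_def N(2)[OF i] cone_inj_def)
        next
          case 3
          have "snd (cone_edge c i) 1 1 = (\<lambda>x\<in>cone_leg c i. x)"
            using fin_functors_id[OF cone_edge_simplex[OF i], of 1] by (simp add: cone_leg_def)
          then show ?thesis unfolding em[OF pq] unfolding 3 v by (simp add: Mori_def)
        qed
      qed
    qed
  qed
  obtain y w where sol: "cone_solution I Fin_op n b h y w"
    using limit_coneD[OF simplicial_set_Fin_op lim P] by blast
  have y: "y \<in> fin_functors {..Suc n} (\<ge>)" using sol by (simp add: cone_solution_def simplices_Fin_op)
  have yMor: "snd y p q = Mor p q \<and> fst y p = Ob p" if *: "q \<le> p" "p \<le> Suc n" "\<not> {..Suc n} \<subseteq> {p, q}" for p q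
  proof -
    have E: "edge q p \<in> Delta 1 (Suc n)" by (rule edge_Delta) (use * in auto)
    have "edge q p ` {..1} = {p, q}" by (auto simp: edge_def)
    then have Eb: "edge q p \<in> simplices (boundary (Suc n)) 1"
      using E * by (simp add: boundary_sub_simplex simplices_sub_simplex)
    then have e: "precompose {..1} (\<ge>) (edge q p) y = precompose {..1} (\<ge>) (edge q p) (Ob, Mor)"
      using Eb cone_solution_boundary[OF sol Eb] by (simp add: act_Fin_op b_def fin_op_map_def boundary_sub_simplex)
    show ?thesis
      using arg_cong[OF e, of "\<lambda>F. snd F 1 0"] arg_cong[OF e, of "\<lambda>F. fst F 1"]
      by (simp add: precompose_def edge_def)
  qed
  have yOb: "fst y p = Ob p" if "p \<le> Suc n" for p
  proof -
    have "\<not> {..Suc n} \<subseteq> {p, p}" using subsetD[of "{..Suc n}" "{p, p}" 0] subsetD[of "{..Suc n}" "{p, p}" "Suc n"] by auto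
    then show ?thesis using yMor[of p p] that by simp
  qed
  moreover have "N i r x = snd y q r (N i q x)"
    if i: "i \<in> I" and *: "r \<le> q" "q \<le> Suc n" and x: "x \<in> cone_leg c i" for i q r x
  proof -
    have w: "w i \<in> fin_functors {..?m} (\<ge>)" using sol i by (simp add: cone_solution_def simplices_Fin_op)
    have wN: "snd (w i) ?m p = N i p \<and> fst (w i) ?m = cone_leg c i" if p: "p \<le> Suc n" for p
    proof -
      have E: "edge p ?m \<in> Delta 1 ?m" by (rule edge_Delta) (use p in auto)
      have "edge p ?m ` {..1} = {p, ?m}" by (auto simp: edge_def)
      moreover have "\<not> {..Suc n} \<subseteq> {p, ?m}"
      proof
        assume *: "{..Suc n} \<subseteq> {p, ?m}"
        have "0 \<in> {p, ?m}" "Suc n \<in> {p, ?m}" by (rule subsetD[OF *]; simp)+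
        then show False by auto
      qed
      ultimately have Eb: "edge p ?m \<in> simplices (horn ?m ?m) 1"
        using E unfolding H by (simp add: simplices_sub_simplex)
      then have e: "precompose {..1} (\<ge>) (edge p ?m) (w i) = precompose {..1} (\<ge>) (edge p ?m) (Obi i, Mori i)"
        using Eb cone_solution_horn[OF sol i Eb] unfolding H by (simp add: act_Fin_op h_def fin_op_map_def)
      show ?thesis
        using arg_cong[OF e, of "\<lambda>F. snd F 1 0"] arg_cong[OF e, of "\<lambda>F. fst F 1"] p
        by (simp add: precompose_def edge_def Obi_def Mori_def)
    qed
    have "act Fin_op (Suc n) ?m (\<lambda>t\<in>{..Suc n}. t) (w i) = y" using sol i by (simp add: cone_solution_def)
    then have "snd y q r = snd (w i) q r" using * by (auto simp: act_Fin_op precompose_def)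
    moreover have "snd (w i) ?m r = compose (fst (w i) ?m) (snd (w i) q r) (snd (w i) ?m q)"
      by (rule fin_functors_comp[OF w]) (use * in auto)
    ultimately show ?thesis using wN[of r] wN[of q] * x by (simp add: compose_eq)
  qed
  ultimately show ?thesis using y yMor yOb by (intro bexI[of _ y]) simp_all
qed

end

definition is_coproduct :: "'i set \<Rightarrow> ('i \<Rightarrow> 'u set) \<Rightarrow> ('i \<Rightarrow> 'u \<Rightarrow> 'u) \<Rightarrow> 'u set \<Rightarrow> bool" where
  "is_coproduct I X t Q \<longleftrightarrow> (\<forall>i\<in>I. t i \<in> X i \<rightarrow>\<^sub>E Q) \<and>
     (\<forall>z\<in>Q. \<exists>i\<in>I. \<exists>x\<in>X i. t i x = z) \<and>
     (\<forall>i\<in>I. \<forall>j\<in>I. \<forall>x\<in>X i. \<forall>y\<in>X j. t i x = t j y \<longrightarrow> i = j \<and> x = y)"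

lemma is_coproduct_in: "is_coproduct I X t Q \<Longrightarrow> i \<in> I \<Longrightarrow> t i \<in> X i \<rightarrow>\<^sub>E Q"
  and is_coproduct_surj: "is_coproduct I X t Q \<Longrightarrow> z \<in> Q \<Longrightarrow> \<exists>i\<in>I. \<exists>x\<in>X i. t i x = z"
  and is_coproduct_inj: "is_coproduct I X t Q \<Longrightarrow> i \<in> I \<Longrightarrow> j \<in> I \<Longrightarrow> x \<in> X i \<Longrightarrow> y \<in> X j \<Longrightarrow>
        t i x = t j y \<Longrightarrow> i = j \<and> x = y"
  unfolding is_coproduct_def by blast+

lemma ex_coproduct:
  fixes X :: "'i \<Rightarrow> 'u::infinite set"
  assumes "finite I" "\<And>i. i \<in> I \<Longrightarrow> finite (X i)"
  shows "\<exists>Q t. finite Q \<and> is_coproduct I X t Q"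
proof -
  have "finite (Sigma I X)" using assms by auto
  then obtain Q :: "'u set" and e where Q: "finite Q" and e: "bij_betw e Q (Sigma I X)"
    using ex_finite_copy by blast
  define d where "d = inv_into Q e"
  have d: "bij_betw d (Sigma I X) Q" unfolding d_def by (rule bij_betw_inv_into[OF e])
  have "is_coproduct I X (\<lambda>i. \<lambda>x\<in>X i. d (i, x)) Q"
    unfolding is_coproduct_def
  proof (intro conjI ballI impI)
    fix z assume "z \<in> Q"
    then obtain p where "p \<in> Sigma I X" "d p = z" using d unfolding bij_betw_def by blast
    then show "\<exists>i\<in>I. \<exists>x\<in>X i. (\<lambda>x\<in>X i. d (i, x)) x = z" by (cases p) auto
  next
    fix i j x y assume *: "i \<in> I" "j \<in> I" "x \<in> X i" "y \<in> X j" "(\<lambda>x\<in>X i. d (i, x)) x = (\<lambda>x\<in>X j. d (j, x)) y"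
    then have "d (i, x) = d (j, y)" by simp
    then have "(i, x) = (j, y)" using d * unfolding bij_betw_def by (intro inj_onD[of d "Sigma I X"]) auto
    then show "i = j" "x = y" by auto
  qed (use bij_betwE[OF d] in auto)
  then show ?thesis using Q by blast
qed

lemma is_coproduct_glue:
  assumes C: "is_coproduct I X t Q" and f: "\<And>i x. i \<in> I \<Longrightarrow> x \<in> X i \<Longrightarrow> f i x \<in> B"
  shows "\<exists>g\<in>Q \<rightarrow>\<^sub>E B. \<forall>i\<in>I. \<forall>x\<in>X i. g (t i x) = f i x"
proof -
  have ex: "\<exists>b. \<exists>i\<in>I. \<exists>x\<in>X i. t i x = z \<and> f i x = b" if "z \<in> Q" for z
    using is_coproduct_surj[OF C that] by blast
  define g where "g = (\<lambda>z\<in>Q. SOME b. \<exists>i\<in>I. \<exists>x\<in>X i. t i x = z \<and> f i x = b)"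
  have g: "\<exists>i\<in>I. \<exists>x\<in>X i. t i x = z \<and> f i x = g z" if "z \<in> Q" for z
    using someI_ex[OF ex[OF that]] that by (simp add: g_def)
  have "g \<in> Q \<rightarrow>\<^sub>E B" using g f by (fastforce simp: g_def)
  moreover have "g (t i x) = f i x" if "i \<in> I" "x \<in> X i" for i x
  proof -
    have "t i x \<in> Q" using is_coproduct_in[OF C] that by auto
    from g[OF this] obtain j y where "j \<in> I" "y \<in> X j" "t j y = t i x" "f j y = g (t i x)" by blast
    then show ?thesis using is_coproduct_inj[OF C _ _ _ _ \<open>t j y = t i x\<close>] that by metis
  qed
  ultimately show ?thesis by blast
qed

text \<open>Mapping to a coproduct of the legs shows that the injections are jointly injective. If a point of
  the apex is not hit then two maps to a two-element set differ only there, so they have the same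
  composites with all injections.\<close>

lemma product_cone_Fin_op:
  fixes c :: "nat \<Rightarrow> (nat \<Rightarrow> nat, 'i) join_simplex \<Rightarrow> (nat, 'u::infinite) diagram"
  assumes I: "finite I" and lim: "limit_cone (discrete I) Fin_op c"
  shows "is_coproduct I (cone_leg c) (cone_inj c) (cone_apex c)"
proof -
  have c: "c \<in> smap (join (simplex 0) (discrete I)) Fin_op" using lim by (simp add: limit_cone_def)
  note inj_in = cone_inj_in[OF c] and finite_apex = finite_cone_apex[OF c] and finite_leg = finite_cone_leg[OF c]
  have inj: "i = j \<and> x = y"
    if *: "i \<in> I" "j \<in> I" "x \<in> cone_leg c i" "y \<in> cone_leg c j" "cone_inj c i x = cone_inj c j y" for i j x y
  proof -
    have "\<exists>Q t. finite Q \<and> is_coproduct I (cone_leg c) t Q"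
      by (rule ex_coproduct[OF I finite_leg])
    then obtain Q t where Q: "finite Q" and t: "is_coproduct I (cone_leg c) t Q" by blast
    \<comment> \<open>The only map that is asked for is the one from vertex 1, the apex, to vertex 0.\<close>
    define Ob where "Ob = (\<lambda>p::nat. if p = 0 then Q else cone_apex c)"
    define Mor where "Mor = (\<lambda>p q::nat. \<lambda>x\<in>Ob p. x)"
    define N where "N = (\<lambda>i (q::nat). if q = 0 then t i else cone_inj c i)"
    have "\<exists>y\<in>fin_functors {..Suc 0} (\<ge>). (\<forall>p\<le>Suc 0. fst y p = Ob p) \<and>
     (\<forall>p q. q \<le> p \<longrightarrow> p \<le> Suc 0 \<longrightarrow> \<not> {..Suc 0} \<subseteq> {p, q} \<longrightarrow> snd y p q = Mor p q) \<and>
     (\<forall>i\<in>I. \<forall>q r. r \<le> q \<longrightarrow> q \<le> Suc 0 \<longrightarrow> (\<forall>x\<in>cone_leg c i. N i r x = snd y q r (N i q x)))"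
    proof (rule fin_cone_fill[OF c lim])
      have pq: "p = q" if "q \<le> p" "p \<le> Suc 0" "\<not> {..Suc 0} \<subseteq> V" "p \<in> V" "q \<in> V" for p q V
      proof (rule ccontr)
        assume "p \<noteq> q"
        then have "p = Suc 0" "q = 0" using that by auto
        moreover have "{..Suc 0} = {0, Suc 0}" by auto
        ultimately show False using that by auto
      qed
      show "Mor p q \<in> Ob p \<rightarrow>\<^sub>E Ob q" if "q \<le> p" "p \<le> Suc 0" "\<not> {..Suc 0} \<subseteq> {p, q}" for p q
        using pq[OF that] by (auto simp: Mor_def)
      show "Mor p r x = Mor q r (Mor p q x)" if "r \<le> q" "q \<le> p" "p \<le> Suc 0" "\<not> {..Suc 0} \<subseteq> {p, q, r}" "x \<in> Ob p" for p q r x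
        using pq[of q p "{p, q, r}"] pq[of r p "{p, q, r}"] that by (auto simp: Mor_def)
      show "N i r x = Mor q r (N i q x)" if "i \<in> I" "r \<le> q" "q \<le> Suc 0" "\<not> {..Suc 0} \<subseteq> {q, r}" "x \<in> cone_leg c i" for i q r x
        using pq[of r q "{q, r}"] that inj_in[of i] is_coproduct_in[OF t, of i] by (auto simp: Mor_def N_def Ob_def)
      show "N i q \<in> cone_leg c i \<rightarrow>\<^sub>E Ob q" if "i \<in> I" for i q
        using that inj_in[of i] is_coproduct_in[OF t, of i] by (simp add: N_def Ob_def)
    qed (use Q finite_apex in \<open>simp_all add: Ob_def Mor_def N_def\<close>)
    then obtain y' :: "(nat, 'u) diagram" where y': "\<forall>i\<in>I. \<forall>q r. r \<le> q \<longrightarrow> q \<le> Suc 0 \<longrightarrow> (\<forall>x\<in>cone_leg c i. N i r x = snd y' q r (N i q x))"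
      by (elim bexE conjE) (rule that)
    have "t i x = snd y' (Suc 0) 0 (cone_inj c i x)" if "i \<in> I" "x \<in> cone_leg c i" for i x
      using y'[rule_format, of i 0 "Suc 0" x] that by (simp add: N_def)
    then have "t i x = t j y" using * by metis
    then show ?thesis using is_coproduct_inj[OF t *(1-4)] by blast
  qed
  have surj: "\<exists>i\<in>I. \<exists>x\<in>cone_leg c i. cone_inj c i x = z" if z: "z \<in> cone_apex c" for z
  proof (rule ccontr)
    assume "\<not> ?thesis"
    then have nz: "cone_inj c i x \<noteq> z" if "i \<in> I" "x \<in> cone_leg c i" for i x using that by blast
    obtain a b :: 'u where ab: "a \<noteq> b" using infinite_UNIV[where ?'a = 'u] by (metis finite.simps UNIV_eq_I finite_insert insertCI)
    define Q where "Q = {a, b}"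
    define Ob where "Ob = (\<lambda>p::nat. if p \<le> 1 then Q else cone_apex c)"
    \<comment> \<open>The edges from the apex are the constant map to \<open>a\<close> and the map that differs from it at \<open>z\<close> only.\<close>
    define Mor where "Mor = (\<lambda>p q::nat. \<lambda>x\<in>Ob p. if p \<le> 1 \<or> q = 2 then x else if q = 0 \<and> x = z then b else a)"
    define N where "N = (\<lambda>i (q::nat). if q \<le> 1 then \<lambda>x\<in>cone_leg c i. a else cone_inj c i)"
    have "\<exists>y\<in>fin_functors {..Suc 1} (\<ge>). (\<forall>p\<le>Suc 1. fst y p = Ob p) \<and>
     (\<forall>p q. q \<le> p \<longrightarrow> p \<le> Suc 1 \<longrightarrow> \<not> {..Suc 1} \<subseteq> {p, q} \<longrightarrow> snd y p q = Mor p q) \<and>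
     (\<forall>i\<in>I. \<forall>q r. r \<le> q \<longrightarrow> q \<le> Suc 1 \<longrightarrow> (\<forall>x\<in>cone_leg c i. N i r x = snd y q r (N i q x)))"
    proof (rule fin_cone_fill[OF c lim])
      have cases: "p = 0 \<or> p = 1 \<or> p = 2" if "p \<le> Suc 1" for p :: nat using that by linarith
      have two: "{..Suc 1} = {0, 1, 2 :: nat}" by auto
      show "Mor p p x = x" if "p \<le> Suc 1" "x \<in> Ob p" for p x
        using cases[OF that(1)] that(2) by (auto simp: Mor_def Ob_def)
      show "Mor p q \<in> Ob p \<rightarrow>\<^sub>E Ob q" if "q \<le> p" "p \<le> Suc 1" for p q
        using cases[OF that(2)] that(1) by (auto simp: Mor_def Ob_def Q_def)
      show "Mor p r x = Mor q r (Mor p q x)" if "r \<le> q" "q \<le> p" "p \<le> Suc 1" "\<not> {..Suc 1} \<subseteq> {p, q, r}" "x \<in> Ob p" for p q r x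
      proof -
        have "(p \<le> 1 \<and> q \<le> 1 \<and> r \<le> 1) \<or> (p = 2 \<and> q = 2) \<or> (p = 2 \<and> q = 1 \<and> r = 1) \<or> (p = 2 \<and> q = 0 \<and> r = 0)"
          using that cases[OF that(3)] unfolding two by auto
        then show ?thesis using that(5) by (auto simp: Mor_def Ob_def Q_def)
      qed
      show "N i q \<in> cone_leg c i \<rightarrow>\<^sub>E Ob q" if "i \<in> I" for i q
        using that inj_in[of i] by (simp add: N_def Ob_def Q_def)
      show "N i r x = Mor q r (N i q x)" if "i \<in> I" "r \<le> q" "q \<le> Suc 1" "x \<in> cone_leg c i" for i q r x
        using that cases[OF that(3)] inj_in[OF that(1)] nz[OF that(1,4)] by (auto simp: N_def Mor_def Ob_def Q_def)
    qed (use finite_apex in \<open>simp_all add: Ob_def Mor_def N_def Q_def\<close>)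
    then obtain y where y: "y \<in> fin_functors {..Suc 1} (\<ge>)" and yOb: "\<forall>p\<le>Suc 1. fst y p = Ob p"
      and yMor: "\<forall>p q. q \<le> p \<longrightarrow> p \<le> Suc 1 \<longrightarrow> \<not> {..Suc 1} \<subseteq> {p, q} \<longrightarrow> snd y p q = Mor p q"
      by (elim bexE conjE) (rule that)
    have two: "{..Suc 1} = {0, 1, 2 :: nat}" by auto
    have C: "snd y 2 0 = compose (fst y 2) (snd y 1 0) (snd y 2 1)"
      by (rule fin_functors_comp[OF y]) auto
    have M: "snd y p q = Mor p q" if "(p, q) \<in> {(2, 0), (1, 0), (2, 1)}" for p q
    proof -
      have "\<not> {..Suc 1} \<subseteq> {p, q}" unfolding two using that by auto
      then show ?thesis using yMor[rule_format, of q p] that by auto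
    qed
    moreover have "snd y 2 0 = Mor 2 0" "snd y 1 0 = Mor 1 0" "snd y 2 1 = Mor 2 1"
      using M[of 2 0] M[of 1 0] M[of 2 1] by simp_all
    moreover have "fst y 2 = cone_apex c" using yOb by (simp add: Ob_def)
    ultimately have "Mor 2 0 z = Mor 1 0 (Mor 2 1 z)" using fun_cong[OF C, of z] z by (simp add: compose_eq)
    then show False using z ab by (simp add: Mor_def Ob_def Q_def)
  qed
  show ?thesis
    unfolding is_coproduct_def using inj_in inj surj by blast
qed

section \<open>Coproducts of finite sets give product cones of spans\<close>

abbreviation face_sieve :: "nat \<Rightarrow> nat set set" where
  "face_sieve m \<equiv> {V. \<not> {..m} \<subseteq> V}"

text \<open>The data of a lifting problem for a cone of spans whose last edges are the images of the
  injections of a coproduct. The data with index \<open>i\<close> live on the last horn of the \<open>(m+1)\<close>-simplex,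
  and the data \<open>obB\<close>, \<open>LB\<close>, \<open>RB\<close> on the boundary of its face opposite to the last vertex.\<close>

definition span_cone :: "nat \<Rightarrow> 'i set \<Rightarrow> (nat \<Rightarrow> nat \<Rightarrow> 'u set) \<Rightarrow> (nat \<Rightarrow> nat \<Rightarrow> nat \<Rightarrow> 'u \<Rightarrow> 'u)
    \<Rightarrow> (nat \<Rightarrow> nat \<Rightarrow> nat \<Rightarrow> 'u \<Rightarrow> 'u) \<Rightarrow> ('i \<Rightarrow> nat \<Rightarrow> nat \<Rightarrow> 'u set)
    \<Rightarrow> ('i \<Rightarrow> nat \<Rightarrow> nat \<Rightarrow> nat \<Rightarrow> 'u \<Rightarrow> 'u) \<Rightarrow> ('i \<Rightarrow> nat \<Rightarrow> nat \<Rightarrow> nat \<Rightarrow> 'u \<Rightarrow> 'u) \<Rightarrow> bool" where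
  "span_cone m I obB LB RB ob L R \<longleftrightarrow> partial_span_data m (face_sieve m) obB LB RB \<and>
     (\<forall>i\<in>I. partial_span_data (Suc m) (face_sieve m) (ob i) (L i) (R i) \<and>
        (\<forall>p q. p \<le> q \<longrightarrow> q \<le> m \<longrightarrow> {p, q} \<in> face_sieve m \<longrightarrow> ob i p q = obB p q) \<and>
        (\<forall>p q r. p \<le> q \<longrightarrow> q \<le> r \<longrightarrow> r \<le> m \<longrightarrow> {p, q, r} \<in> face_sieve m \<longrightarrow>
           L i p q r = LB p q r \<and> R i p q r = RB p q r) \<and>
        ob i m (Suc m) = ob i (Suc m) (Suc m) \<and> (\<forall>y\<in>ob i m (Suc m). R i m (Suc m) (Suc m) y = y)) \<and>
     is_coproduct I (\<lambda>i. ob i m (Suc m)) (\<lambda>i. L i m m (Suc m)) (obB m m)"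

definition span_cone_extensible :: "nat \<Rightarrow> 'i set \<Rightarrow> (nat \<Rightarrow> nat \<Rightarrow> 'u set) \<Rightarrow> (nat \<Rightarrow> nat \<Rightarrow> nat \<Rightarrow> 'u \<Rightarrow> 'u)
    \<Rightarrow> (nat \<Rightarrow> nat \<Rightarrow> nat \<Rightarrow> 'u \<Rightarrow> 'u) \<Rightarrow> ('i \<Rightarrow> nat \<Rightarrow> nat \<Rightarrow> 'u set)
    \<Rightarrow> ('i \<Rightarrow> nat \<Rightarrow> nat \<Rightarrow> nat \<Rightarrow> 'u \<Rightarrow> 'u) \<Rightarrow> ('i \<Rightarrow> nat \<Rightarrow> nat \<Rightarrow> nat \<Rightarrow> 'u \<Rightarrow> 'u) \<Rightarrow> bool" where
  "span_cone_extensible m I obB LB RB ob L R \<longleftrightarrow> (\<exists>obY LY RY.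
     span_data_extend m (face_sieve m) obB LB RB obY LY RY \<and>
     (\<forall>i\<in>I. \<exists>obW LW RW. span_data_extend (Suc m) (face_sieve m) (ob i) (L i) (R i) obW LW RW \<and>
        (\<forall>p q. p \<le> q \<longrightarrow> q \<le> m \<longrightarrow> obW p q = obY p q) \<and>
        (\<forall>p q r. p \<le> q \<longrightarrow> q \<le> r \<longrightarrow> r \<le> m \<longrightarrow> LW p q r = LY p q r \<and> RW p q r = RY p q r)))"

context
  fixes m :: nat and I :: "'i set" and obB :: "nat \<Rightarrow> nat \<Rightarrow> 'u set"
    and LB RB :: "nat \<Rightarrow> nat \<Rightarrow> nat \<Rightarrow> 'u \<Rightarrow> 'u" and ob :: "'i \<Rightarrow> nat \<Rightarrow> nat \<Rightarrow> 'u set"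
    and L R :: "'i \<Rightarrow> nat \<Rightarrow> nat \<Rightarrow> nat \<Rightarrow> 'u \<Rightarrow> 'u"
  assumes C: "span_cone m I obB LB RB ob L R"
begin

lemma span_cone_B:
  assumes "p \<le> q" "q \<le> r" "r \<le> s" "s \<le> m" "\<not> {..m} \<subseteq> {p, q, r, s}"
  shows "span_quad obB LB RB p q r s"
proof -
  have "partial_span_data m (face_sieve m) obB LB RB" using C by (simp add: span_cone_def)
  then show ?thesis by (rule partial_span_data_quad) (use assms in auto)
qed

lemma span_cone_quad:
  assumes "i \<in> I" "p \<le> q" "q \<le> r" "r \<le> s" "s \<le> Suc m" "\<not> {..m} \<subseteq> {p, q, r, s}"
  shows "span_quad (ob i) (L i) (R i) p q r s"
proof -
  have "partial_span_data (Suc m) (face_sieve m) (ob i) (L i) (R i)" using C assms(1) by (simp add: span_cone_def)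
  then show ?thesis by (rule partial_span_data_quad) (use assms in auto)
qed

lemma span_cone_agree:
  assumes i: "i \<in> I"
  shows "p \<le> q \<Longrightarrow> q \<le> m \<Longrightarrow> \<not> {..m} \<subseteq> {p, q} \<Longrightarrow> ob i p q = obB p q"
    and "p \<le> q \<Longrightarrow> q \<le> r \<Longrightarrow> r \<le> m \<Longrightarrow> \<not> {..m} \<subseteq> {p, q, r} \<Longrightarrow> L i p q r = LB p q r"
    and "p \<le> q \<Longrightarrow> q \<le> r \<Longrightarrow> r \<le> m \<Longrightarrow> \<not> {..m} \<subseteq> {p, q, r} \<Longrightarrow> R i p q r = RB p q r"
  using C i by (simp_all add: span_cone_def)

lemma span_cone_last:
  assumes i: "i \<in> I"
  shows "ob i m (Suc m) = ob i (Suc m) (Suc m)" "y \<in> ob i m (Suc m) \<Longrightarrow> R i m (Suc m) (Suc m) y = y"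
  using C i by (simp_all add: span_cone_def)

lemma span_cone_coproduct: "is_coproduct I (\<lambda>i. ob i m (Suc m)) (\<lambda>i. L i m m (Suc m)) (obB m m)"
  using C by (simp add: span_cone_def)

text \<open>Coproducts of finite sets are stable under pullback.\<close>

lemma span_cone_cover:
  assumes a: "a \<le> m" "\<not> {..m} \<subseteq> {a, m}"
  shows "is_coproduct I (\<lambda>i. ob i a (Suc m)) (\<lambda>i. L i a m (Suc m)) (obB a m)"
proof -
  have n: "\<not> {..m} \<subseteq> {a, m, Suc m}" using a(2) by auto
  have q: "span_quad (ob i) (L i) (R i) a a m (Suc m)" "span_quad (ob i) (L i) (R i) a m m (Suc m)" if "i \<in> I" for i
    by (rule span_cone_quad[OF that]; use a n in \<open>simp add: insert_commute\<close>)+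
  have ag: "ob i a m = obB a m" "R i a m m = RB a m m" "ob i m m = obB m m" if "i \<in> I" for i
    using span_cone_agree[OF that] a by (auto simp: insert_commute)
  have RL: "L i m m (Suc m) (R i a m (Suc m) x) = RB a m m (L i a m (Suc m) x)"
    if "i \<in> I" "x \<in> ob i a (Suc m)" for i x
    using span_quad_RL[OF q(2)[OF that(1)] that(2)] ag[OF that(1)] by simp
  show ?thesis
    unfolding is_coproduct_def
  proof (intro conjI ballI impI)
    fix i assume i: "i \<in> I"
    show "L i a m (Suc m) \<in> ob i a (Suc m) \<rightarrow>\<^sub>E obB a m" using span_quad_L[OF q(1)[OF i]] ag[OF i] by simp
  next
    fix z assume z: "z \<in> obB a m"
    have "RB a m m z \<in> obB m m"
      using span_quad_R_in[OF span_cone_B[of a a m m] z] a by simp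
    then obtain i u where i: "i \<in> I" and u: "u \<in> ob i m (Suc m)" "L i m m (Suc m) u = RB a m m z"
      using is_coproduct_surj[OF span_cone_coproduct] by blast
    then have "\<exists>!x. x \<in> ob i a (Suc m) \<and> L i a m (Suc m) x = z \<and> R i a m (Suc m) x = u"
      using z ag[OF i] by (intro span_quad_ex1[OF q(1)[OF i]]) simp_all
    then show "\<exists>i\<in>I. \<exists>x\<in>ob i a (Suc m). L i a m (Suc m) x = z" using i by blast
  next
    fix i j x y assume *: "i \<in> I" "j \<in> I" "x \<in> ob i a (Suc m)" "y \<in> ob j a (Suc m)"
      and e: "L i a m (Suc m) x = L j a m (Suc m) y"
    have "i = j \<and> R i a m (Suc m) x = R j a m (Suc m) y"
      using * RL[of i x] RL[of j y] e
      by (intro is_coproduct_inj[OF span_cone_coproduct] span_quad_R_in[OF q(1)]) auto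
    then show "i = j" "x = y"
      using * e span_quad_eqI[OF q(2)[OF *(1)], of x y] by auto
  qed
qed

text \<open>Fillers of the common face together with the data on the horn are data on the \<open>(m+1)\<close>-simplex. Only
  the quadruples that contain all vertices of the common face and the last vertex remain to be checked.\<close>

lemma span_cone_glue:
  fixes obY :: "nat \<Rightarrow> nat \<Rightarrow> 'u set" and LY RY :: "nat \<Rightarrow> nat \<Rightarrow> nat \<Rightarrow> 'u \<Rightarrow> 'u" and i :: 'i
  defines "obW \<equiv> \<lambda>p q. if q \<le> m then obY p q else ob i p q"
    and "LW \<equiv> \<lambda>p q r. if r \<le> m then LY p q r else L i p q r"
    and "RW \<equiv> \<lambda>p q r. if r \<le> m then RY p q r else R i p q r"
  assumes Y: "span_data_extend m (face_sieve m) obB LB RB obY LY RY" and i: "i \<in> I"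
    and new: "\<And>p q r. p \<le> q \<Longrightarrow> q \<le> r \<Longrightarrow> r \<le> Suc m \<Longrightarrow> {..m} \<subseteq> {p, q, r} \<Longrightarrow> span_quad obW LW RW p q r (Suc m)"
  shows "span_data_extend (Suc m) (face_sieve m) (ob i) (L i) (R i) obW LW RW"
proof -
  have Yob: "obY p q = ob i p q" if "p \<le> q" "q \<le> m" "\<not> {..m} \<subseteq> {p, q}" for p q
    using Y that span_cone_agree(1)[OF i that] by (simp add: span_data_extend_def)
  have YLR: "LY p q r = L i p q r \<and> RY p q r = R i p q r"
    if "p \<le> q" "q \<le> r" "r \<le> m" "\<not> {..m} \<subseteq> {p, q, r}" for p q r
    using Y that span_cone_agree(2,3)[OF i that] by (simp add: span_data_extend_def)
  have "span_quad obW LW RW p q r s" if le: "p \<le> q" "q \<le> r" "r \<le> s" "s \<le> Suc m" for p q r s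
  proof (cases "s \<le> m")
    case True
    have "span_quad obY LY RY p q r s"
      using Y le True by (simp add: span_data_extend_def partial_span_data_def)
    then show ?thesis
      by (rule span_quad_cong[OF _ le(1-3)]) (use True in \<open>simp_all add: obW_def LW_def RW_def\<close>)
  next
    case False
    then have s: "s = Suc m" using le by simp
    show ?thesis
    proof (cases "{..m} \<subseteq> {p, q, r}")
      case True
      then show ?thesis using new[of p q r] le s by simp
    next
      case F: False
      then have n: "\<not> {..m} \<subseteq> {p, q, r, s}" using s by auto
      show ?thesis
      proof (rule span_quad_cong[OF span_cone_quad[OF i le n] le(1-3)])
        show "obW a b = ob i a b" if "a \<le> b" "{a, b} \<subseteq> {p, q, r, s}" for a b
        proof -
          have "\<not> {..m} \<subseteq> {a, b}" using n that(2) by (meson subset_trans)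
          then show ?thesis using Yob[of a b] that(1) by (simp add: obW_def)
        qed
        show "LW a b c = L i a b c \<and> RW a b c = R i a b c"
          if "a \<le> b" "b \<le> c" "{a, b, c} \<subseteq> {p, q, r, s}" for a b c
        proof -
          have "\<not> {..m} \<subseteq> {a, b, c}" using n that(3) by (meson subset_trans)
          then show ?thesis using YLR[of a b c] that(1,2) by (simp add: LW_def RW_def)
        qed
      qed
    qed
  qed
  then show ?thesis
    unfolding span_data_extend_def partial_span_data_def
    using Yob YLR by (simp add: obW_def LW_def RW_def)
qed

lemma span_cone_extensibleI:
  assumes Y: "span_data_extend m (face_sieve m) obB LB RB obY LY RY"
    and new: "\<And>i p q r. i \<in> I \<Longrightarrow> p \<le> q \<Longrightarrow> q \<le> r \<Longrightarrow> r \<le> Suc m \<Longrightarrow> {..m} \<subseteq> {p, q, r} \<Longrightarrow>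
      span_quad (\<lambda>p q. if q \<le> m then obY p q else ob i p q) (\<lambda>p q r. if r \<le> m then LY p q r else L i p q r)
        (\<lambda>p q r. if r \<le> m then RY p q r else R i p q r) p q r (Suc m)"
  shows "span_cone_extensible m I obB LB RB ob L R"
  unfolding span_cone_extensible_def
proof (intro exI conjI ballI)
  show "span_data_extend m (face_sieve m) obB LB RB obY LY RY" by (rule Y)
  fix i assume i: "i \<in> I"
  show "span_data_extend (Suc m) (face_sieve m) (ob i) (L i) (R i)
      (\<lambda>p q. if q \<le> m then obY p q else ob i p q) (\<lambda>p q r. if r \<le> m then LY p q r else L i p q r)
      (\<lambda>p q r. if r \<le> m then RY p q r else R i p q r)"
    by (rule span_cone_glue[OF Y i new[OF i]])
qed simp_all

end

text \<open>All quadruples of vertices lie in the given subcomplexes.\<close>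

lemma span_cone_fill_ge_4:
  assumes C: "span_cone m I obB LB RB ob L R" and m: "4 \<le> m"
  shows "span_cone_extensible m I obB LB RB ob L R"
proof (rule span_cone_extensibleI[OF C])
  have c: "\<not> {..m} \<subseteq> {p, q, r, s}" for p q r s
  proof
    assume "{..m} \<subseteq> {p, q, r, s}"
    then have "card {..m} \<le> card {p, q, r, s}" by (intro card_mono) auto
    moreover have "card {p, q, r, s} \<le> 4" by (simp add: card_insert_if)
    ultimately show False using m by simp
  qed
  show "span_data_extend m (face_sieve m) obB LB RB obB LB RB"
    unfolding span_data_extend_def partial_span_data_def using span_cone_B[OF C _ _ _ _ c] by simp
  fix p q r assume "{..m} \<subseteq> {p, q, r}"
  then show "span_quad X Y Z p q r (Suc m)" for X Y Z using c[of p q r r] by simp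
qed

text \<open>For \<open>m = 3\<close> the missing equations hold because they hold after restriction along the jointly
  surjective maps from the given tetrahedra.\<close>

lemma span_cone_fill_3:
  assumes C: "span_cone 3 I obB LB RB ob L R"
  shows "span_cone_extensible 3 I obB LB RB ob L R"
proof (rule span_cone_extensibleI[OF C])
  have three: "{..3} = {0, 1, 2, 3 :: nat}" by auto
  have B: "span_quad obB LB RB p q r s" if "p \<le> q" "q \<le> r" "r \<le> s" "s \<le> 3" "(p, q, r, s) \<noteq> (0, 1, 2, 3)" for p q r s
    by (rule span_cone_B[OF C that(1-4)]) (use that in \<open>auto simp: three\<close>)
  have "span_quad obB LB RB 0 1 2 3"
  proof (rule span_quadI)
    show "span_quad obB LB RB 0 0 2 3" by (rule B) auto
    fix z assume "z \<in> obB 0 3"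
    moreover have cov: "is_coproduct I (\<lambda>i. ob i 0 (Suc 3)) (\<lambda>i. L i 0 3 (Suc 3)) (obB 0 3)"
      by (rule span_cone_cover[OF C]) (auto simp: three)
    ultimately obtain i x where i: "i \<in> I" and x: "x \<in> ob i 0 4" and z: "L i 0 3 4 x = z"
      using is_coproduct_surj[OF cov, of z] by auto
    have q: "span_quad (ob i) (L i) (R i) p q r s"
      if "p \<le> q" "q \<le> r" "r \<le> s" "s \<le> 4" "\<not> {0, 1, 2, 3} \<subseteq> {p, q, r, s}" for p q r s
      by (rule span_cone_quad[OF C i that(1-3)]) (use that in \<open>simp_all only: three, simp\<close>)
    note LL = span_quad_LL[OF q] and RR = span_quad_RR[OF q] and RL = span_quad_RL[OF q]
    have w: "R i 0 1 4 x \<in> ob i 1 4" by (rule span_quad_R_in[OF q[of 0 0 1 4] x]) auto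
    have ag: "L i p q r = LB p q r" "R i p q r = RB p q r"
      if "p \<le> q" "q \<le> r" "r \<le> 3" for p q r
    proof -
      have "card {p, q, r} < card {..3::nat}" by (simp add: card_insert_if)
      then have "\<not> {..3} \<subseteq> {p, q, r}" using card_mono[of "{p, q, r}" "{..3}"] by auto
      then show "L i p q r = LB p q r" "R i p q r = RB p q r"
        using span_cone_agree(2,3)[OF C i that] by simp_all
    qed
    have e: "L i 0 2 3 z = L i 0 2 4 x" "L i 0 1 3 z = L i 0 1 4 x"
      "R i 0 1 3 z = L i 1 3 4 (R i 0 1 4 x)" "R i 0 2 3 z = L i 2 3 4 (R i 0 2 4 x)"
      using LL[OF _ _ _ _ _ x, of 2 3] LL[OF _ _ _ _ _ x, of 1 3] RL[OF _ _ _ _ _ x, of 1 3]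
        RL[OF _ _ _ _ _ x, of 2 3] by (simp_all add: z)
    have "L i 0 1 2 (L i 0 2 3 z) = L i 0 1 3 z"
      using e LL[OF _ _ _ _ _ x, of 1 2] by simp
    then show "LB 0 1 2 (LB 0 2 3 z) = LB 0 1 3 z" by (simp add: ag)
    have "R i 1 2 3 (R i 0 1 3 z) = R i 0 2 3 z"
      using e RL[OF _ _ _ _ _ w, of 2 3] RR[OF _ _ _ _ _ x, of 1 2] by simp
    then show "RB 1 2 3 (RB 0 1 3 z) = RB 0 2 3 z" by (simp add: ag)
    have "R i 0 1 2 (L i 0 2 3 z) = L i 1 2 3 (R i 0 1 3 z)"
      using e RL[OF _ _ _ _ _ x, of 1 2] LL[OF _ _ _ _ _ w, of 2 3] by simp
    then show "RB 0 1 2 (LB 0 2 3 z) = LB 1 2 3 (RB 0 1 3 z)" by (simp add: ag)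
  qed
  then have "span_quad obB LB RB p q r s" if "p \<le> q" "q \<le> r" "r \<le> s" "s \<le> 3" for p q r s
    using B[OF that] by (cases "(p, q, r, s) = (0, 1, 2, 3)") auto
  then show "span_data_extend 3 (face_sieve 3) obB LB RB obB LB RB"
    by (simp add: span_data_extend_def partial_span_data_def)
  fix p q r :: nat assume "{..3} \<subseteq> {p, q, r}"
  then have "card {..3::nat} \<le> card {p, q, r}" by (intro card_mono) auto
  moreover have "card {p, q, r} \<le> 3" by (simp add: card_insert_if)
  ultimately show "span_quad X Y Z p q r (Suc 3)" for X Y Z by simp
qed

text \<open>For \<open>m = 2\<close> the map from the coproduct \<open>obB 0 2\<close> is given by its components.\<close>

lemma span_cone_fill_2:
  assumes C: "span_cone 2 I obB LB RB ob L R"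
  shows "span_cone_extensible 2 I obB LB RB ob L R"
proof -
  have two: "{..2} = {0, 1, 2 :: nat}" by auto
  have s3: "Suc 2 = 3" by simp
  have B: "span_quad obB LB RB p q r s"
    if "p \<le> q" "q \<le> r" "r \<le> s" "s \<le> 2" "\<not> {0, 1, 2} \<subseteq> {p, q, r, s}" for p q r s
    using that by (intro span_cone_B[OF C]) (simp_all only: two not_False_eq_True)
  have q: "span_quad (ob i) (L i) (R i) p q r s"
    if "i \<in> I" "p \<le> q" "q \<le> r" "r \<le> s" "s \<le> 3" "\<not> {0, 1, 2} \<subseteq> {p, q, r, s}" for i p q r s
    using that by (intro span_cone_quad[OF C]) (simp_all only: two s3 not_False_eq_True)
  have ob: "ob i p q = obB p q" if "i \<in> I" "p \<le> q" "q \<le> 2" for i p q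
  proof -
    have "\<not> {..2} \<subseteq> {p, q}" unfolding two by auto
    then show ?thesis using span_cone_agree(1)[OF C that] by simp
  qed
  have LR: "L i p q r = LB p q r" "R i p q r = RB p q r"
    if "i \<in> I" "p \<le> q" "q \<le> r" "r \<le> 2" "\<not> {0, 1, 2} \<subseteq> {p, q, r}" for i p q r
    using span_cone_agree(2,3)[OF C that(1-4)] that(5) by (simp_all only: two not_False_eq_True simp_thms)
  have cov0: "is_coproduct I (\<lambda>i. ob i 0 3) (\<lambda>i. L i 0 2 3) (obB 0 2)"
    using span_cone_cover[OF C, of 0] unfolding two s3 by simp
  have cov1: "is_coproduct I (\<lambda>i. ob i 1 3) (\<lambda>i. L i 1 2 3) (obB 1 2)"
    using span_cone_cover[OF C, of 1] unfolding two s3 by simp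
  have L_in: "L i p r s x \<in> ob i p r" and R_in: "R i p r s x \<in> ob i r s"
    if "i \<in> I" "p \<le> r" "r \<le> s" "s \<le> 3" "(p, r, s) \<noteq> (0, 1, 2)" "x \<in> ob i p s" for i p r s x
  proof -
    have "\<not> {0, 1, 2} \<subseteq> {p, p, r, s}" using that by auto
    then have "span_quad (ob i) (L i) (R i) p p r s" using that by (intro q) auto
    then show "L i p r s x \<in> ob i p r" "R i p r s x \<in> ob i r s"
      using that(6) span_quad_L_in span_quad_R_in by fast+
  qed
  note LL = span_quad_LL[OF q] and RR = span_quad_RR[OF q] and RL = span_quad_RL[OF q] and ex1 = span_quad_ex1[OF q]
  \<comment> \<open>The tetrahedron is not given, but the last edge is the span \<open>P \<leftarrow> X\<^sub>i = X\<^sub>i\<close>, so maps to its middle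
    object can be compared at the last vertex.\<close>
  have last: "R i 1 2 3 (R i 0 1 3 x) = R i 0 2 3 x" if i: "i \<in> I" and x: "x \<in> ob i 0 3" for i x
  proof -
    have w: "R i 0 1 3 x \<in> ob i 1 3" using R_in[OF i, of 0 1 3 x] x by simp
    have id: "R i 2 3 3 y = y" if "y \<in> ob i 2 3" for y
      using span_cone_last(2)[OF C i] that unfolding s3 .
    have "R i 1 2 3 (R i 0 1 3 x) = R i 2 3 3 (R i 1 2 3 (R i 0 1 3 x))"
      using w R_in[OF i, of 1 2 3] by (simp add: id)
    also have "\<dots> = R i 0 3 3 x"
      using RR[OF i _ _ _ _ _ w, of 2 3] RR[OF i _ _ _ _ _ x, of 1 3] by simp
    also have "\<dots> = R i 2 3 3 (R i 0 2 3 x)" using RR[OF i _ _ _ _ _ x, of 2 3] by simp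
    also have "\<dots> = R i 0 2 3 x" using x R_in[OF i, of 0 2 3] by (simp add: id)
    finally show ?thesis .
  qed
  have "\<exists>f\<in>obB 0 2 \<rightarrow>\<^sub>E obB 0 1. \<forall>i\<in>I. \<forall>x\<in>ob i 0 3. f (L i 0 2 3 x) = L i 0 1 3 x"
    by (rule is_coproduct_glue[OF cov0]) (use L_in[of _ 0 1 3] ob[of _ 0 1] in simp)
  then obtain f where f: "f \<in> obB 0 2 \<rightarrow>\<^sub>E obB 0 1"
    and f_eq: "\<And>i x. i \<in> I \<Longrightarrow> x \<in> ob i 0 3 \<Longrightarrow> f (L i 0 2 3 x) = L i 0 1 3 x" by auto
  have "\<exists>g\<in>obB 0 2 \<rightarrow>\<^sub>E obB 1 2. \<forall>i\<in>I. \<forall>x\<in>ob i 0 3. g (L i 0 2 3 x) = L i 1 2 3 (R i 0 1 3 x)"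
    by (rule is_coproduct_glue[OF cov0]) (use L_in[of _ 1 2 3] R_in[of _ 0 1 3] ob[of _ 1 2] in simp)
  then obtain g where g: "g \<in> obB 0 2 \<rightarrow>\<^sub>E obB 1 2"
    and g_eq: "\<And>i x. i \<in> I \<Longrightarrow> x \<in> ob i 0 3 \<Longrightarrow> g (L i 0 2 3 x) = L i 1 2 3 (R i 0 1 3 x)" by auto
  define LY where "LY = (\<lambda>p q r. if p = 0 \<and> q = 1 \<and> r = (2::nat) then f else LB p q r)"
  define RY where "RY = (\<lambda>p q r. if p = 0 \<and> q = 1 \<and> r = (2::nat) then g else RB p q r)"
  note defs = LY_def RY_def
  have old: "span_quad obB LY RY p q r s"
    if "p \<le> q" "q \<le> r" "r \<le> s" "s \<le> 2" "\<not> {0, 1, 2} \<subseteq> {p, q, r, s}" for p q r s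
  proof (rule span_quad_cong[OF B[OF that] that(1-3)])
    show "LY a b c = LB a b c \<and> RY a b c = RB a b c" if "{a, b, c} \<subseteq> {p, q, r, s}" for a b c
      using that \<open>\<not> {0, 1, 2} \<subseteq> {p, q, r, s}\<close> by (auto simp: defs)
  qed simp
  have cover: "\<exists>i\<in>I. \<exists>x\<in>ob i 0 3. L i 0 2 3 x = z" if "z \<in> obB 0 2" for z
    by (rule is_coproduct_surj[OF cov0 that])
  have idB: "LB 0 2 2 z = z" "RB 0 0 2 z = z" if "z \<in> obB 0 2" for z
    using that span_quad_L_id[OF B[of 0 0 0 2]] span_quad_R_id[OF B[of 0 0 0 2]] by simp_all
  have base: "span_quad obB LY RY 0 0 1 2"
    unfolding span_quad_def
  proof (intro conjI ballI impI)
    show "finite (obB 0 2)" using span_quad_finite[OF B[of 0 0 0 2]] by simp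
    show "LY 0 1 2 \<in> obB 0 2 \<rightarrow>\<^sub>E obB 0 1" "RY 0 1 2 \<in> obB 0 2 \<rightarrow>\<^sub>E obB 1 2"
      using f g by (simp_all add: defs)
    fix z assume z: "z \<in> obB 0 2"
    then obtain i x where i: "i \<in> I" and x: "x \<in> ob i 0 3" and zx: "L i 0 2 3 x = z" using cover by blast
    show "LY 0 2 2 z = z" "RY 0 0 2 z = z" "RY 0 1 2 (RY 0 0 2 z) = RY 0 1 2 z"
      using idB[OF z] by (simp_all add: defs)
    have fz: "f z \<in> obB 0 1" using f z by auto
    show "RY 0 0 1 (LY 0 1 2 z) = LY 0 1 2 (RY 0 0 2 z)"
      using idB[OF z] span_quad_R_id[OF B[of 0 0 0 1], of "f z"] fz by (simp add: defs)
    have "LB 0 0 1 (f z) = LB 0 0 2 z"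
      using LL[OF i _ _ _ _ _ x, of 0 1] LL[OF i _ _ _ _ _ x, of 0 2] LR(1)[OF i, of 0 0 1] LR(1)[OF i, of 0 0 2]
        f_eq[OF i x] zx by simp
    then show "LY 0 0 1 (LY 0 1 2 z) = LY 0 0 2 z" by (simp add: defs)
  next
    fix x1 y assume x1: "x1 \<in> obB 0 1" and y: "y \<in> obB 1 2" and "RY 0 1 1 x1 = LY 1 1 2 y"
    then have e: "RB 0 1 1 x1 = LB 1 1 2 y" by (simp add: defs)
    obtain i v where i: "i \<in> I" and v: "v \<in> ob i 1 3" "L i 1 2 3 v = y"
      using is_coproduct_surj[OF cov1 y] by blast
    have "R i 0 1 1 x1 = L i 1 1 3 v"
      using LL[OF i _ _ _ _ _ v(1), of 1 2] v(2) e LR(2)[OF i, of 0 1 1] LR(1)[OF i, of 1 1 2] by simp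
    then have E: "\<exists>!x. x \<in> ob i 0 3 \<and> L i 0 1 3 x = x1 \<and> R i 0 1 3 x = v" (is "\<exists>!x. ?Q x")
      using x1 v ob[OF i, of 0 1] by (intro ex1[OF i, of 0 0 1 3]) auto
    define x where "x = (THE x. ?Q x)"
    have x: "x \<in> ob i 0 3" "L i 0 1 3 x = x1" "R i 0 1 3 x = v"
      using theI'[OF E] by (simp_all add: x_def)
    have uniq: "x' = x" if "x' \<in> ob i 0 3" "L i 0 1 3 x' = x1" "R i 0 1 3 x' = v" for x'
      unfolding x_def by (rule the1_equality[OF E, symmetric]) (intro conjI that)
    have z_in: "L i 0 2 3 x \<in> obB 0 2" using is_coproduct_in[OF cov0 i] x(1) by auto
    have fg: "f (L i 0 2 3 x) = x1" "g (L i 0 2 3 x) = y" using f_eq[OF i x(1)] g_eq[OF i x(1)] x v by simp_all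
    have z_uniq: "z = L i 0 2 3 x" if z: "z \<in> obB 0 2" "f z = x1" "g z = y" for z
    proof -
      obtain j x' where j: "j \<in> I" and x': "x' \<in> ob j 0 3" and zx: "L j 0 2 3 x' = z" using cover[OF z(1)] by blast
      have "L j 1 2 3 (R j 0 1 3 x') = L i 1 2 3 v" using g_eq[OF j x'] zx z v by simp
      then have "j = i \<and> R j 0 1 3 x' = v"
        using R_in[OF j, of 0 1 3 x'] x' by (intro is_coproduct_inj[OF cov1 j i _ v(1)]) auto
      moreover have "L j 0 1 3 x' = x1" using f_eq[OF j x'] zx z by simp
      ultimately show ?thesis using uniq x' zx by blast
    qed
    have fg': "LY 0 1 2 = f" "RY 0 1 2 = g" by (simp_all add: defs)
    show "\<exists>!z. z \<in> obB 0 2 \<and> LY 0 1 2 z = x1 \<and> RY 0 1 2 z = y"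
      unfolding fg' by (rule ex1I[of _ "L i 0 2 3 x"]) (use z_in fg z_uniq in blast)+
  qed
  have new1: "span_quad obB LY RY 0 1 1 2"
  proof (rule span_quadI[OF base])
    fix z assume z: "z \<in> obB 0 2"
    then obtain i x where i: "i \<in> I" and x: "x \<in> ob i 0 3" and zx: "L i 0 2 3 x = z" using cover by blast
    have fz: "f z \<in> obB 0 1" "g z \<in> obB 1 2" using f g z by auto
    have w: "R i 0 1 3 x \<in> ob i 1 3" using R_in[OF i, of 0 1 3 x] x by simp
    show "LY 0 1 1 (LY 0 1 2 z) = LY 0 1 2 z" "RY 1 1 2 (RY 0 1 2 z) = RY 0 1 2 z"
      using fz span_quad_L_id[OF B[of 0 0 0 1], of "f z"] span_quad_R_id[OF B[of 1 1 1 2], of "g z"]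
      by (simp_all add: defs)
    have "RB 0 1 1 (f z) = LB 1 1 2 (g z)"
      using RL[OF i _ _ _ _ _ x, of 1 1] LL[OF i _ _ _ _ _ w, of 1 2] LR(2)[OF i, of 0 1 1] LR(1)[OF i, of 1 1 2]
        f_eq[OF i x] g_eq[OF i x] zx by simp
    then show "RY 0 1 1 (LY 0 1 2 z) = LY 1 1 2 (RY 0 1 2 z)" by (simp add: defs)
  qed
  have new2: "span_quad obB LY RY 0 1 2 2"
  proof (rule span_quadI)
    show "span_quad obB LY RY 0 0 2 2" by (rule old) auto
    fix z assume z: "z \<in> obB 0 2"
    then obtain i x where i: "i \<in> I" and x: "x \<in> ob i 0 3" and zx: "L i 0 2 3 x = z" using cover by blast
    have fz: "g z \<in> obB 1 2" using g z by auto
    have w: "R i 0 1 3 x \<in> ob i 1 3" using R_in[OF i, of 0 1 3 x] x by simp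
    show "LY 0 1 2 (LY 0 2 2 z) = LY 0 1 2 z" using idB[OF z] by (simp add: defs)
    show "RY 0 1 2 (LY 0 2 2 z) = LY 1 2 2 (RY 0 1 2 z)"
      using idB[OF z] fz span_quad_L_id[OF B[of 1 1 1 2], of "g z"] by (simp add: defs)
    have "RB 1 2 2 (g z) = RB 0 2 2 z"
      using RL[OF i _ _ _ _ _ w, of 2 2] RL[OF i _ _ _ _ _ x, of 2 2] LR(2)[OF i, of 1 2 2] LR(2)[OF i, of 0 2 2]
        g_eq[OF i x] last[OF i x] zx by simp
    then show "RY 1 2 2 (RY 0 1 2 z) = RY 0 2 2 z" by (simp add: defs)
  qed
  have "span_quad obB LY RY p q r s" if le: "p \<le> q" "q \<le> r" "r \<le> s" "s \<le> 2" for p q r s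
  proof (cases "{0, 1, 2} \<subseteq> {p, q, r, s}")
    case True
    then have "p = 0" "s = 2" using le by auto
    then have "(q = 0 \<and> r = 1) \<or> (q = 1 \<and> r = 1) \<or> (q = 1 \<and> r = 2)" using True le by auto
    then show ?thesis using \<open>p = 0\<close> \<open>s = 2\<close> base new1 new2 by blast
  qed (use old[OF le] in auto)
  then have Y: "span_data_extend 2 (face_sieve 2) obB LB RB obB LY RY"
    by (auto simp: span_data_extend_def partial_span_data_def two defs)
  show ?thesis
  proof (rule span_cone_extensibleI[OF C Y])
    fix i p q' r assume i: "i \<in> I" and le: "p \<le> q'" "q' \<le> r" "r \<le> Suc 2" and "{..2} \<subseteq> {p, q', r}"
    then have s: "{0, 1, 2} \<subseteq> {p, q', r}" by (simp only: two)
    have pqr: "p = 0" "q' = 1" "r = 2" using s le by auto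
    let ?ob = "\<lambda>p q. if q \<le> 2 then obB p q else ob i p q"
      and ?L = "\<lambda>p q r. if r \<le> 2 then LY p q r else L i p q r" and ?R = "\<lambda>p q r. if r \<le> 2 then RY p q r else R i p q r"
    have "span_quad ?ob ?L ?R 0 1 2 3"
    proof (rule span_quadI)
      show "span_quad ?ob ?L ?R 0 0 2 3"
      proof (rule span_quad_cong[OF q[OF i, of 0 0 2 3]])
        show "?ob a b = ob i a b" if "a \<le> b" for a b using that ob[OF i, of a b] by simp
        show "?L a b c = L i a b c \<and> ?R a b c = R i a b c"
          if "a \<le> b" "b \<le> c" "{a, b, c} \<subseteq> {0, 0, 2, 3}" for a b c
        proof -
          have n: "a \<noteq> 1" "b \<noteq> 1" "c \<noteq> 1" using that(3) by auto
          then have "\<not> {0, 1, 2} \<subseteq> {a, b, c}" by auto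
          then show ?thesis using LR[OF i that(1,2)] n by (simp add: defs)
        qed
      qed auto
      fix x assume "x \<in> ?ob 0 3"
      then have x: "x \<in> ob i 0 3" by simp
      show "?L 0 1 2 (?L 0 2 3 x) = ?L 0 1 3 x" using f_eq[OF i x] by (simp add: defs)
      show "?R 1 2 3 (?R 0 1 3 x) = ?R 0 2 3 x" using last[OF i x] by simp
      show "?R 0 1 2 (?L 0 2 3 x) = ?L 1 2 3 (?R 0 1 3 x)" using g_eq[OF i x] by (simp add: defs)
    qed
    then show "span_quad ?ob ?L ?R p q' r (Suc 2)" by (simp only: pqr s3)
  qed
qed

text \<open>For \<open>m = 1\<close> the object of the missing edge is a coproduct.\<close>

lemma span_cone_fill_1:
  fixes obB :: "nat \<Rightarrow> nat \<Rightarrow> 'u::infinite set"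
  assumes C: "span_cone 1 I obB LB RB ob L R" and I: "finite I"
  shows "span_cone_extensible 1 I obB LB RB ob L R"
proof -
  have one: "{..1} = {0, 1 :: nat}" by auto
  have B: "span_quad obB LB RB p p p p" if "p \<le> 1" for p
    using that by (intro span_cone_B[OF C]) (auto simp: one)
  have q: "span_quad (ob i) (L i) (R i) p q r s"
    if "i \<in> I" "p \<le> q" "q \<le> r" "r \<le> s" "s \<le> 2" "\<not> {0, 1} \<subseteq> {p, q, r, s}" for i p q r s
    using that by (intro span_cone_quad[OF C]) (simp_all only: one Suc_1 not_False_eq_True)
  have ag: "ob i p p = obB p p" "L i p p p = LB p p p" "R i p p p = RB p p p" if "i \<in> I" "p \<le> 1" for i p
  proof -
    have n: "\<not> {..1} \<subseteq> {p, p}" "\<not> {..1} \<subseteq> {p, p, p}" unfolding one by auto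
    show "ob i p p = obB p p" "L i p p p = LB p p p" "R i p p p = RB p p p"
      using span_cone_agree(1)[OF C that(1) order_refl that(2) n(1)]
        span_cone_agree(2,3)[OF C that(1) order_refl order_refl that(2) n(2)] .
  qed
  have cov: "is_coproduct I (\<lambda>i. ob i 1 2) (\<lambda>i. L i 1 1 2) (obB 1 1)"
    using span_cone_coproduct[OF C] by (simp only: Suc_1)
  have o12: "ob i 1 2 = ob i 2 2" and R122: "y \<in> ob i 1 2 \<Longrightarrow> R i 1 2 2 y = y" if "i \<in> I" for i y
    using span_cone_last[OF C that] by (simp_all only: Suc_1)
  have fin: "finite (ob i 0 2)" if "i \<in> I" for i using span_quad_finite[OF q[OF that, of 0 0 0 2]] by simp
  have "\<exists>Z t. finite Z \<and> is_coproduct I (\<lambda>i. ob i 0 2) t Z" by (rule ex_coproduct[OF I fin])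
  then obtain Z t where Z: "finite Z" and t: "is_coproduct I (\<lambda>i. ob i 0 2) t Z" by blast
  have q1: "span_quad (ob i) (L i) (R i) 0 0 0 2" "span_quad (ob i) (L i) (R i) 0 0 2 2"
    "span_quad (ob i) (L i) (R i) 1 1 1 2" "span_quad (ob i) (L i) (R i) 1 1 2 2" if "i \<in> I" for i
    using q[OF that] by simp_all
  have ty: "L i 0 0 2 x \<in> obB 0 0" "R i 0 2 2 x \<in> ob i 1 2" "L i 1 1 2 (R i 0 2 2 x) \<in> obB 1 1"
    if "i \<in> I" "x \<in> ob i 0 2" for i x
  proof -
    show "L i 0 0 2 x \<in> obB 0 0" using span_quad_L_in[OF q1(1)[OF that(1)] that(2)] ag(1)[OF that(1), of 0] by simp
    show w: "R i 0 2 2 x \<in> ob i 1 2" using span_quad_R_in[OF q1(2)[OF that(1)] that(2)] o12[OF that(1)] by simp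
    show "L i 1 1 2 (R i 0 2 2 x) \<in> obB 1 1" using is_coproduct_in[OF cov that(1)] w by auto
  qed
  have "\<exists>f\<in>Z \<rightarrow>\<^sub>E obB 0 0. \<forall>i\<in>I. \<forall>x\<in>ob i 0 2. f (t i x) = L i 0 0 2 x"
    by (rule is_coproduct_glue[OF t]) (rule ty)
  then obtain f where f: "f \<in> Z \<rightarrow>\<^sub>E obB 0 0"
    and f_eq: "\<And>i x. i \<in> I \<Longrightarrow> x \<in> ob i 0 2 \<Longrightarrow> f (t i x) = L i 0 0 2 x" by auto
  have "\<exists>g\<in>Z \<rightarrow>\<^sub>E obB 1 1. \<forall>i\<in>I. \<forall>x\<in>ob i 0 2. g (t i x) = L i 1 1 2 (R i 0 2 2 x)"
    by (rule is_coproduct_glue[OF t]) (rule ty)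
  then obtain g where g: "g \<in> Z \<rightarrow>\<^sub>E obB 1 1"
    and g_eq: "\<And>i x. i \<in> I \<Longrightarrow> x \<in> ob i 0 2 \<Longrightarrow> g (t i x) = L i 1 1 2 (R i 0 2 2 x)" by auto
  have f_in: "f z \<in> obB 0 0" and g_in: "g z \<in> obB 1 1" if "z \<in> Z" for z using f g that by auto
  define idZ where "idZ = (\<lambda>z\<in>Z. z)"
  have idZ: "idZ \<in> Z \<rightarrow>\<^sub>E Z" "\<And>z. z \<in> Z \<Longrightarrow> idZ z = z" by (auto simp: idZ_def)
  define obY where "obY = (\<lambda>p q. if p = 0 \<and> q = (1::nat) then Z else obB p q)"
  define LY where "LY = (\<lambda>p q r. if p = 0 \<and> r = (1::nat) then if q = 0 then f else idZ else LB p q r)"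
  define RY where "RY = (\<lambda>p q r. if p = 0 \<and> r = (1::nat) then if q = 0 then idZ else g else RB p q r)"
  have Y1: "obY 0 1 = Z" "obY 0 0 = obB 0 0" "obY 1 1 = obB 1 1"
    "LY 0 0 1 = f" "LY 0 1 1 = idZ" "LY 0 0 0 = LB 0 0 0" "LY 1 1 1 = LB 1 1 1"
    "RY 0 0 1 = idZ" "RY 0 1 1 = g" "RY 0 0 0 = RB 0 0 0" "RY 1 1 1 = RB 1 1 1"
    by (simp_all add: obY_def LY_def RY_def)
  have B0: "LB 0 0 0 x = x" "RB 0 0 0 x = x" if "x \<in> obB 0 0" for x
    using span_quad_L_id[OF B[of 0] that] span_quad_R_id[OF B[of 0] that] by simp_all
  have B1: "LB 1 1 1 x = x" "RB 1 1 1 x = x" if "x \<in> obB 1 1" for x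
    using span_quad_L_id[OF B[of 1] that] span_quad_R_id[OF B[of 1] that] by simp_all
  have Yc: "span_quad obY LY RY p p p p" if "p \<le> 1" for p
    by (rule span_quad_cong[OF B[OF that]]) (use that in \<open>auto simp: obY_def LY_def RY_def\<close>)
  have Y001: "span_quad obY LY RY 0 0 0 1"
    unfolding span_quad_def Y1
  proof (intro conjI ballI impI)
    fix x y assume x: "x \<in> obB 0 0" and y: "y \<in> Z" and e: "RB 0 0 0 x = f y"
    have "f y = x" using e B0(2)[OF x] by simp
    then have "y \<in> Z \<and> f y = x \<and> idZ y = y" using y idZ(2)[OF y] by simp
    then show "\<exists>!z. z \<in> Z \<and> f z = x \<and> idZ z = y"
    proof (rule ex1I)
      fix z assume "z \<in> Z \<and> f z = x \<and> idZ z = y"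
      then show "z = y" using idZ(2)[of z] by simp
    qed
  qed (use Z f f_in idZ B0 in simp_all)
  have Y011: "span_quad obY LY RY 0 0 1 1"
    unfolding span_quad_def Y1
  proof (intro conjI ballI impI)
    fix x y assume x: "x \<in> Z" and y: "y \<in> obB 1 1" and e: "g x = LB 1 1 1 y"
    have "g x = y" using e B1(1)[OF y] by simp
    then have "x \<in> Z \<and> idZ x = x \<and> g x = y" using x idZ(2)[OF x] by simp
    then show "\<exists>!z. z \<in> Z \<and> idZ z = x \<and> g z = y"
    proof (rule ex1I)
      fix z assume "z \<in> Z \<and> idZ z = x \<and> g z = y"
      then show "z = x" using idZ(2)[of z] by simp
    qed
  qed (use Z f g f_in g_in idZ B0 B1 in simp_all)
  have Y111: "span_quad obY LY RY 0 1 1 1"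
    by (rule span_quadI[OF Y011]) (use idZ g_in B1 in \<open>simp_all only: Y1\<close>)
  have Yq: "span_quad obY LY RY p q r s" if le: "p \<le> q" "q \<le> r" "r \<le> s" "s \<le> 1" for p q r s
  proof -
    consider "p = s" | "p = 0" "q = 0" "r = 0" "s = 1" | "p = 0" "q = 0" "r = 1" "s = 1" | "p = 0" "q = 1" "r = 1" "s = 1"
      using le by linarith
    then show ?thesis
    proof cases
      case 1
      then have "q = p" "r = p" "s = p" "p \<le> 1" using le by auto
      then show ?thesis using Yc by simp
    qed (use Y001 Y011 Y111 in simp_all)
  qed
  have Y: "span_data_extend 1 (face_sieve 1) obB LB RB obY LY RY"
    unfolding span_data_extend_def partial_span_data_def
  proof (intro conjI allI impI)
    show "obY p q = obB p q" if "{p, q} \<in> face_sieve 1" for p q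
    proof -
      have "\<not> {0, 1} \<subseteq> {p, q}" using that by (simp only: one mem_Collect_eq not_False_eq_True)
      then have "\<not> (p = 0 \<and> q = 1)" by auto
      then show ?thesis by (auto simp: obY_def)
    qed
    show "LY p q r = LB p q r" "RY p q r = RB p q r" if "{p, q, r} \<in> face_sieve 1" for p q r
    proof -
      have "\<not> {0, 1} \<subseteq> {p, q, r}" using that by (simp only: one mem_Collect_eq not_False_eq_True)
      then have "\<not> (p = 0 \<and> r = 1)" by auto
      then show "LY p q r = LB p q r" "RY p q r = RB p q r" by (auto simp: LY_def RY_def)
    qed
  qed (rule Yq)
  have "\<exists>obW LW RW. span_data_extend (Suc 1) (face_sieve 1) (ob i) (L i) (R i) obW LW RW \<and>
        (\<forall>p q. p \<le> q \<longrightarrow> q \<le> 1 \<longrightarrow> obW p q = obY p q) \<and>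
        (\<forall>p q r. p \<le> q \<longrightarrow> q \<le> r \<longrightarrow> r \<le> 1 \<longrightarrow> LW p q r = LY p q r \<and> RW p q r = RY p q r)" if i: "i \<in> I" for i
  proof -
    \<comment> \<open>The given span from vertex 0 to vertex 2 becomes the composite of the new edge and the last edge.\<close>
    define obW where "obW = (\<lambda>p q. if q \<le> 1 then obY p q else ob i p q)"
    define LW where "LW = (\<lambda>p q r. if r \<le> 1 then LY p q r else if p = 0 \<and> q = 1 then t i else L i p q r)"
    define RW where "RW = (\<lambda>p q r. if r \<le> 1 then RY p q r else if p = 0 \<and> q = 1 then R i 0 2 2 else R i p q r)"
    note defs = obW_def LW_def RW_def
    have W: "obW 0 2 = ob i 0 2" "obW 0 1 = Z" "obW 1 2 = ob i 1 2" "LW 0 1 2 = t i" "RW 0 1 2 = R i 0 2 2"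
      "LW 0 2 2 = L i 0 2 2" "RW 0 0 2 = R i 0 0 2" "LW 0 0 1 = f" "LW 0 0 2 = L i 0 0 2" "RW 0 0 1 = idZ"
      "RW 0 1 1 = g" "LW 1 1 2 = L i 1 1 2" "LW 0 1 1 = idZ" "RW 1 1 2 = R i 1 1 2" "RW 1 2 2 = R i 1 2 2"
      "LW 1 2 2 = L i 1 2 2" "RW 0 2 2 = R i 0 2 2"
      by (simp_all add: defs Y1[unfolded One_nat_def])
    have t_in: "t i \<in> ob i 0 2 \<rightarrow>\<^sub>E Z" by (rule is_coproduct_in[OF t i])
    have tx: "t i x \<in> Z" if "x \<in> ob i 0 2" for x using t_in that by auto
    have id: "L i 0 2 2 x = x" "R i 0 0 2 x = x" if "x \<in> ob i 0 2" for x
      using span_quad_L_id[OF q1(1)[OF i] that] span_quad_R_id[OF q1(1)[OF i] that] by simp_all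
    have id12: "L i 1 2 2 y = y" "R i 1 1 2 y = y" if "y \<in> ob i 1 2" for y
      using span_quad_L_id[OF q1(3)[OF i] that] span_quad_R_id[OF q1(3)[OF i] that] by simp_all
    have W0: "span_quad obW LW RW 0 0 1 2"
      unfolding span_quad_def W
    proof (intro conjI ballI impI)
      show "R i 0 2 2 \<in> ob i 0 2 \<rightarrow>\<^sub>E ob i 1 2" using span_quad_R[OF q1(2)[OF i]] o12[OF i] by simp
      fix z y assume z: "z \<in> Z" and y: "y \<in> ob i 1 2" and e: "g z = L i 1 1 2 y"
      obtain j x where j: "j \<in> I" and x: "x \<in> ob j 0 2" "t j x = z" using is_coproduct_surj[OF t z] by blast
      have "j = i \<and> R j 0 2 2 x = y"
        using g_eq[OF j x(1)] x(2) e by (intro is_coproduct_inj[OF cov j i ty(2)[OF j x(1)] y]) simp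
      moreover have "x' = x" if "x' \<in> ob i 0 2" "t i x' = z" for x'
        using is_coproduct_inj[OF t i j that(1) x(1)] that(2) x(2) by simp
      ultimately show "\<exists>!x. x \<in> ob i 0 2 \<and> t i x = z \<and> R i 0 2 2 x = y" using x by blast
    qed (use fin[OF i] t_in id tx idZ f_eq[OF i] in simp_all)
    have W1: "span_quad obW LW RW 0 1 1 2"
    proof (rule span_quadI[OF W0], unfold W)
      fix x assume x: "x \<in> ob i 0 2"
      show "idZ (t i x) = t i x" using idZ tx x by simp
      show "R i 1 1 2 (R i 0 2 2 x) = R i 0 2 2 x" using id12 ty(2)[OF i x] by simp
      show "g (t i x) = L i 1 1 2 (R i 0 2 2 x)" by (rule g_eq[OF i x])
    qed
    have Wold: "span_quad obW LW RW p q' r 2" if le: "p \<le> q'" "q' \<le> r" "r \<le> 2" and n: "\<not> {0, 1} \<subseteq> {p, q', r, 2}" for p q' r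
    proof (rule span_quad_cong[OF q[OF i le order_refl n] le])
      show "obW a b = ob i a b" if "a \<le> b" "{a, b} \<subseteq> {p, q', r, 2}" for a b
      proof (cases "b \<le> 1")
        case True
        have "\<not> {0, 1} \<subseteq> {a, b}" using n that(2) by (meson subset_trans)
        then have "a = b" using True that(1) by auto
        then show ?thesis using ag(1)[OF i, of a] True by (auto simp: obW_def obY_def)
      qed (simp add: obW_def)
      show "LW a b c = L i a b c \<and> RW a b c = R i a b c"
        if "a \<le> b" "b \<le> c" "{a, b, c} \<subseteq> {p, q', r, 2}" for a b c
      proof -
        have nn: "\<not> {0, 1} \<subseteq> {a, b, c}" using n that(3) by (meson subset_trans)
        show ?thesis
        proof (cases "c \<le> 1")
          case True
          then have "a = b" "b = c" using nn that by auto
          then show ?thesis using ag(2,3)[OF i, of a] True by (auto simp: LW_def RW_def LY_def RY_def)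
        next
          case False
          then have "\<not> (a = 0 \<and> b = 1)" using nn by auto
          then show ?thesis using False by (auto simp: LW_def RW_def)
        qed
      qed
    qed
    have W2: "span_quad obW LW RW 0 1 2 2"
    proof (rule span_quadI, goal_cases)
      case 1 show ?case by (rule Wold) auto
    next
      case (2 x) then show ?case unfolding W using id by simp
    next
      case (3 x) then show ?case unfolding W using R122[OF i ty(2)[OF i]] by simp
    next
      case (4 x) then show ?case unfolding W using id id12 ty(2)[OF i] by simp
    qed
    have "span_quad obW LW RW p q' r s" if le: "p \<le> q'" "q' \<le> r" "r \<le> s" "s \<le> 2" for p q' r s
    proof (cases "s = 2")
      case False
      then have "s \<le> 1" using le by simp
      then show ?thesis
        by (intro span_quad_cong[OF Yq[OF le(1-3)] le(1-3)]) (auto simp: defs)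
    next
      case s: True
      show ?thesis
      proof (cases "{0, 1} \<subseteq> {p, q', r, 2}")
        case False
        then show ?thesis using Wold le s by simp
      next
        case True
        then have "p = 0" using le by auto
        then have "(q' = 0 \<and> r = 1) \<or> (q' = 1 \<and> r = 1) \<or> (q' = 1 \<and> r = 2)" using True le s by auto
        then show ?thesis using \<open>p = 0\<close> s W0 W1 W2 by blast
      qed
    qed
    then have "partial_span_data (Suc 1) UNIV obW LW RW" unfolding Suc_1 by (simp add: partial_span_data_def)
    moreover have "obW p q' = ob i p q'" if "p \<le> q'" "{p, q'} \<in> face_sieve 1" for p q'
    proof (cases "q' \<le> 1")
      case True
      have "\<not> {0, 1} \<subseteq> {p, q'}" using that(2) by (simp only: one mem_Collect_eq not_False_eq_True)
      then have "p = q'" using True that(1) by auto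
      then show ?thesis using ag(1)[OF i, of p] True by (auto simp: obW_def obY_def)
    qed (simp add: obW_def)
    moreover have "LW p q' r = L i p q' r \<and> RW p q' r = R i p q' r"
      if "p \<le> q'" "q' \<le> r" "{p, q', r} \<in> face_sieve 1" for p q' r
    proof -
      have nn: "\<not> {0, 1} \<subseteq> {p, q', r}" using that(3) by (simp only: one mem_Collect_eq not_False_eq_True)
      show ?thesis
      proof (cases "r \<le> 1")
        case True
        then have "p = q'" "q' = r" using nn that by auto
        then show ?thesis using ag(2,3)[OF i, of p] True by (auto simp: LW_def RW_def LY_def RY_def)
      next
        case False
        then have "\<not> (p = 0 \<and> q' = 1)" using nn by auto
        then show ?thesis using False by (auto simp: LW_def RW_def)
      qed
    qed
    ultimately have "span_data_extend (Suc 1) (face_sieve 1) (ob i) (L i) (R i) obW LW RW"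
      unfolding span_data_extend_def by blast
    moreover have "\<forall>p q. p \<le> q \<longrightarrow> q \<le> 1 \<longrightarrow> obW p q = obY p q"
      "\<forall>p q r. p \<le> q \<longrightarrow> q \<le> r \<longrightarrow> r \<le> 1 \<longrightarrow> LW p q r = LY p q r \<and> RW p q r = RY p q r"
      by (simp_all add: defs)
    ultimately show ?thesis by blast
  qed
  then show ?thesis unfolding span_cone_extensible_def using Y by blast
qed

lemma span_cone_fill:
  fixes obB :: "nat \<Rightarrow> nat \<Rightarrow> 'u::infinite set"
  assumes C: "span_cone m I obB LB RB ob L R" and I: "finite I" and m: "0 < m"
  shows "span_cone_extensible m I obB LB RB ob L R"
proof -
  consider "m = 1" | "m = 2" | "m = 3" | "4 \<le> m" using m by linarith
  then show ?thesis
  proof cases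
    case 1 show ?thesis unfolding 1 by (rule span_cone_fill_1[OF C[unfolded 1] I])
  next
    case 2 show ?thesis unfolding 2 by (rule span_cone_fill_2[OF C[unfolded 2]])
  next
    case 3 show ?thesis unfolding 3 by (rule span_cone_fill_3[OF C[unfolded 3]])
  next
    case 4 show ?thesis by (rule span_cone_fill_ge_4[OF C 4])
  qed
qed

lemma horn_face_sieve: "horn (Suc m) (Suc m) = sub_simplex (Suc m) (face_sieve m)"
proof -
  have "{..Suc m} - {Suc m} = {..m}" by auto
  then show ?thesis by (simp only: horn_sub_simplex)
qed

lemma is_coproduct_cong:
  assumes "is_coproduct I X t Q" "\<And>i. i \<in> I \<Longrightarrow> X' i = X i" "\<And>i. i \<in> I \<Longrightarrow> t' i = t i" "Q' = Q"
  shows "is_coproduct I X' t' Q'"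
  using assms(1) unfolding is_coproduct_def by (simp add: assms(2-4))

lemma smap_scomp:
  assumes f: "f \<in> smap X Y" and g: "g \<in> smap Y Z" and X: "simplicial_set X"
  shows "scomp X g f \<in> smap X Z"
proof (rule smapI)
  fix m n \<alpha> x assume *: "\<alpha> \<in> Delta m n" "x \<in> simplices X n"
  then show "scomp X g f m (act X m n \<alpha> x) = act Z m n \<alpha> (scomp X g f n x)"
    using simplicial_set_simplices[OF X *] smap_natural[OF f *] smap_natural[OF g *(1) smap_simplices[OF f *(2)]]
    by (simp add: scomp_def compose_eq)
qed (use smap_simplices[OF f] smap_simplices[OF g] in \<open>simp_all add: scomp_def compose_eq\<close>)

text \<open>The last edges of the horns are the images of the projections under \<open>Rbar\<close>, which turns the maps of
  finite sets \<open>cone_inj c i\<close> into left legs of spans with identities as right legs.\<close>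

lemma span_cone_of_problem:
  fixes c :: "nat \<Rightarrow> (nat \<Rightarrow> nat, 'i) join_simplex \<Rightarrow> (nat, 'u::infinite) diagram"
  assumes c: "c \<in> smap (join (simplex 0) (discrete I)) Fin_op"
    and cop: "is_coproduct I (cone_leg c) (cone_inj c) (cone_apex c)"
    and P: "cone_problem I Span (scomp (join (simplex 0) (discrete I)) Rbar c) n b h"
  shows "span_cone (Suc n) I (map_ob b) (map_left b) (map_right b)
    (\<lambda>i. map_ob (h i)) (\<lambda>i. map_left (h i)) (\<lambda>i. map_right (h i))"
proof -
  let ?m = "Suc n" and ?c = "scomp (join (simplex 0) (discrete I)) Rbar c"
  have b: "b \<in> smap (sub_simplex ?m (face_sieve ?m)) Span"
    and bc: "b 0 (\<lambda>i\<in>{..0}. ?m) = Rbar 0 (c 0 (InL (\<lambda>i\<in>{..0}. i)))"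
    using P by (simp_all add: cone_problem_def boundary_sub_simplex scomp_def compose_eq)
  have h: "h i \<in> smap (sub_simplex (Suc ?m) (face_sieve ?m)) Span"
    and hb: "\<And>k \<beta>. \<beta> \<in> simplices (sub_simplex ?m (face_sieve ?m)) k \<Longrightarrow> h i k \<beta> = b k \<beta>"
    and hc: "h i 1 (last_edge ?m) = Rbar 1 (cone_edge c i)" if "i \<in> I" for i
    using P that unfolding cone_problem_def boundary_sub_simplex horn_face_sieve extends_on_def
    by (simp_all add: scomp_def compose_eq cone_edge_def)
  have ce: "cone_edge c i \<in> simplices Fin_op 1" if "i \<in> I" for i
    using cone_edge_simplex[OF c that] by (simp add: simplices_Fin_op)
  have ca: "c 0 (InL (\<lambda>i\<in>{..0}. i)) \<in> simplices Fin_op 0"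
    using cone_apex_simplex[OF c] by (simp add: simplices_Fin_op)
  have le: "last_edge ?m \<in> simplices (sub_simplex (Suc ?m) (face_sieve ?m)) 1"
    using last_edge_in_horn[of n] unfolding horn_face_sieve .
  have lv: "last_edge ?m 0 = ?m" "last_edge ?m 1 = Suc ?m" by (simp_all add: last_edge_def)
  have leg: "map_ob (h i) ?m (Suc ?m) = cone_leg c i" "map_ob (h i) (Suc ?m) (Suc ?m) = cone_leg c i"
    "map_left (h i) ?m ?m (Suc ?m) = cone_inj c i" "map_right (h i) ?m (Suc ?m) (Suc ?m) = (\<lambda>x\<in>cone_leg c i. x)"
    if i: "i \<in> I" for i
  proof -
    note D = map_data_of_simplex[OF h[OF i] le, unfolded hc[OF i]]
    note R = Rbar_ob[OF ce[OF i]] Rbar_Mor[OF ce[OF i]]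
    show "map_ob (h i) ?m (Suc ?m) = cone_leg c i"
      using D(1)[of 0 1] R(1)[of 0 1] by (simp only: lv span_ob_def cone_leg_def; simp)
    show "map_ob (h i) (Suc ?m) (Suc ?m) = cone_leg c i"
      using D(1)[of 1 1] R(1)[of 1 1] by (simp only: lv span_ob_def cone_leg_def; simp)
    show "map_left (h i) ?m ?m (Suc ?m) = cone_inj c i"
      using D(2)[of 0 0 1] R(2)[of 0 0 0 1] by (simp only: lv span_left_def cone_inj_def; simp)
    have "snd (cone_edge c i) 1 1 = (\<lambda>x\<in>cone_leg c i. x)"
      using fin_functors_id[OF cone_edge_simplex[OF c i], of 1] by (simp add: cone_leg_def)
    then show "map_right (h i) ?m (Suc ?m) (Suc ?m) = (\<lambda>x\<in>cone_leg c i. x)"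
      using D(3)[of 0 1 1] R(2)[of 0 1 1 1] by (simp only: lv span_right_def; simp)
  qed
  have last: "(\<lambda>i\<in>{..0}. ?m) \<in> simplices (sub_simplex ?m (face_sieve ?m)) 0"
  proof -
    have "0 \<notin> (\<lambda>i\<in>{..0}. ?m) ` {..0}" by auto
    then show ?thesis by (auto simp: simplices_sub_simplex)
  qed
  have apex: "map_ob b ?m ?m = cone_apex c"
    using map_data_of_simplex(1)[OF b last, of 0 0, unfolded bc] Rbar_ob[OF ca, of 0 0]
    by (simp add: span_ob_def cone_apex_def)
  have agree: "map_ob (h i) p q = map_ob b p q" if i: "i \<in> I" and "p \<le> q" "q \<le> ?m" "{p, q} \<in> face_sieve ?m" for i p q
  proof -
    have "edge p q ` {..1} = {p, q}" by (auto simp: edge_def)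
    then have "edge p q \<in> simplices (sub_simplex ?m (face_sieve ?m)) 1"
      using that edge_Delta[of p q ?m] by (simp add: simplices_sub_simplex)
    then show ?thesis by (simp add: map_ob_def hb[OF i])
  qed
  have agree3: "map_left (h i) p q r = map_left b p q r" "map_right (h i) p q r = map_right b p q r"
    if i: "i \<in> I" and "p \<le> q" "q \<le> r" "r \<le> ?m" "{p, q, r} \<in> face_sieve ?m" for i p q r
  proof -
    have "triangle p q r ` {..2} \<subseteq> {p, q, r}" by (auto simp: triangle_def)
    then have "triangle p q r ` {..2} \<in> face_sieve ?m" using that(5) by blast
    then have "triangle p q r \<in> simplices (sub_simplex ?m (face_sieve ?m)) 2"
      using that triangle_Delta[of p q r ?m] by (simp add: simplices_sub_simplex)
    then show "map_left (h i) p q r = map_left b p q r" "map_right (h i) p q r = map_right b p q r"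
      by (simp_all add: map_left_def map_right_def hb[OF i])
  qed
  show ?thesis
    unfolding span_cone_def
  proof (intro conjI ballI allI impI)
    show "partial_span_data ?m (face_sieve ?m) (map_ob b) (map_left b) (map_right b)"
      by (rule map_partial_span_data[OF b])
    show "partial_span_data (Suc ?m) (face_sieve ?m) (map_ob (h i)) (map_left (h i)) (map_right (h i))"
      if "i \<in> I" for i by (rule map_partial_span_data[OF h[OF that]])
    show "is_coproduct I (\<lambda>i. map_ob (h i) ?m (Suc ?m)) (\<lambda>i. map_left (h i) ?m ?m (Suc ?m)) (map_ob b ?m ?m)"
      by (rule is_coproduct_cong[OF cop]) (simp_all add: leg apex)
  qed (use agree agree3 leg in \<open>simp_all\<close>)
qed

lemma Rbar_preserves_products: "preserves_finite_products Fin_op Span Rbar"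
  unfolding preserves_finite_products_def product_diagram_def
proof (intro allI impI)
  fix I :: "nat set" and c :: "nat \<Rightarrow> (nat \<Rightarrow> nat, nat) join_simplex \<Rightarrow> (nat, 'u::infinite) diagram"
  assume I: "finite I" and lim: "limit_cone (discrete I) Fin_op c"
  let ?J = "join (simplex 0) (discrete I)"
  have c: "c \<in> smap ?J Fin_op" using lim by (simp add: limit_cone_def)
  have cop: "is_coproduct I (cone_leg c) (cone_inj c) (cone_apex c)" by (rule product_cone_Fin_op[OF I lim])
  show "limit_cone (discrete I) Span (scomp ?J Rbar c)"
  proof (rule limit_coneI[OF simplicial_set_Span])
    show "scomp ?J Rbar c \<in> smap ?J Span"
      by (rule smap_scomp[OF c Rbar_smap]) (simp add: simplicial_set_join)
    fix n b h assume P: "cone_problem I Span (scomp ?J Rbar c) n b h"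
    have S: "sieve (face_sieve k)" for k by simp
    have b: "b \<in> smap (sub_simplex (Suc n) (face_sieve (Suc n))) Span"
      using P by (simp add: cone_problem_def boundary_sub_simplex)
    have h: "h i \<in> smap (sub_simplex (Suc (Suc n)) (face_sieve (Suc n))) Span" if "i \<in> I" for i
      using P that by (simp add: cone_problem_def horn_face_sieve)
    obtain obY LY RY where
      Y: "span_data_extend (Suc n) (face_sieve (Suc n)) (map_ob b) (map_left b) (map_right b) obY LY RY"
      and WY: "\<forall>i\<in>I. \<exists>obW LW RW. span_data_extend (Suc (Suc n)) (face_sieve (Suc n))
          (map_ob (h i)) (map_left (h i)) (map_right (h i)) obW LW RW \<and>
        (\<forall>p q. p \<le> q \<longrightarrow> q \<le> Suc n \<longrightarrow> obW p q = obY p q) \<and>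
        (\<forall>p q r. p \<le> q \<longrightarrow> q \<le> r \<longrightarrow> r \<le> Suc n \<longrightarrow> LW p q r = LY p q r \<and> RW p q r = RY p q r)"
      using span_cone_fill[OF span_cone_of_problem[OF c cop P] I zero_less_Suc]
      unfolding span_cone_extensible_def by (elim exE conjE) (rule that)
    define y where "y = span_diagram (Suc n) obY LY RY"
    have Yd: "span_data {..Suc n} obY LY RY" using Y by (simp add: span_data_extend_def partial_span_data_UNIV)
    have yF: "y \<in> simplices Span (Suc n)" "extends_on (sub_simplex (Suc n) (face_sieve (Suc n))) (yoneda_map Span (Suc n) y) b"
      unfolding y_def by (rule fill_map_to_Span[OF b S Y])+
    let ?filler = "\<lambda>i v. v \<in> simplices Span (Suc (Suc n)) \<and>
      extends_on (sub_simplex (Suc (Suc n)) (face_sieve (Suc n))) (yoneda_map Span (Suc (Suc n)) v) (h i) \<and>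
      act Span (Suc n) (Suc (Suc n)) (\<lambda>t\<in>{..Suc n}. t) v = y"
    have ex: "\<exists>v. ?filler i v" if i: "i \<in> I" for i
    proof -
      obtain obW LW RW where
        W: "span_data_extend (Suc (Suc n)) (face_sieve (Suc n)) (map_ob (h i)) (map_left (h i)) (map_right (h i)) obW LW RW"
        and Wob: "\<forall>p q. p \<le> q \<longrightarrow> q \<le> Suc n \<longrightarrow> obW p q = obY p q"
        and WLR: "\<forall>p q r. p \<le> q \<longrightarrow> q \<le> r \<longrightarrow> r \<le> Suc n \<longrightarrow> LW p q r = LY p q r \<and> RW p q r = RY p q r"
        using bspec[OF WY i] by (elim exE conjE) (rule that)
      have Wd: "span_data {..Suc (Suc n)} obW LW RW"
        using W by (simp add: span_data_extend_def partial_span_data_UNIV)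
      let ?w = "span_diagram (Suc (Suc n)) obW LW RW"
      note wF = fill_map_to_Span[OF h[OF i] S W]
      have "act Span (Suc n) (Suc (Suc n)) (\<lambda>t\<in>{..Suc n}. t) ?w = y"
      proof (rule span_simplex_eqI[of _ "Suc n"])
        have "(\<lambda>t\<in>{..Suc n}. t) \<in> Delta (Suc n) (Suc (Suc n))" by (rule DeltaI) auto
        then show "act Span (Suc n) (Suc (Suc n)) (\<lambda>t\<in>{..Suc n}. t) ?w \<in> span_simplices (Suc n)"
          using simplicial_set_simplices[OF simplicial_set_Span _ wF(1)] by (simp add: simplices_Span)
        show "y \<in> span_simplices (Suc n)" using yF(1) by (simp add: simplices_Span)
      qed (simp_all add: span_act_ob span_act_left span_act_right y_def span_diagram_ob Wob WLR
          span_diagram_left[OF Wd] span_diagram_right[OF Wd] span_diagram_left[OF Yd] span_diagram_right[OF Yd])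
      then show ?thesis using wF by blast
    qed
    define w where "w = (\<lambda>i. SOME v. ?filler i v)"
    have "?filler i (w i)" if "i \<in> I" for i
      unfolding w_def by (rule someI_ex[OF ex[OF that]])
    then have "cone_solution I Span n b h y w"
      using yF by (simp add: cone_solution_def boundary_sub_simplex horn_face_sieve)
    then show "\<exists>y w. cone_solution I Span n b h y w" by blast
  qed
qed


section \<open>Spans form an algebraic theory\<close>

theorem proposition4p9:
  shows "(\<forall>X \<in> simplices (Fin_op :: (nat, 'u::infinite) diagram sset) 0.
            fst (Rbar 0 X) (0, 0) = fst X 0) \<and>
         (\<forall>f \<in> simplices (Fin_op :: (nat, 'u) diagram sset) 1.
            fst (Rbar 1 f) (0, 0) = fst f 0 \<and>
            fst (Rbar 1 f) (0, 1) = fst f 1 \<and>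
            fst (Rbar 1 f) (1, 1) = fst f 1 \<and>
            snd (Rbar 1 f) (0, 1) (0, 0) = snd f 1 0 \<and>
            snd (Rbar 1 f) (0, 1) (1, 1) = (\<lambda>x\<in>fst f 1. x)) \<and>
         algebraic_theory (Span :: (nat \<times> nat, 'u) diagram sset) Rbar"
proof (intro conjI ballI)
  fix f :: "(nat, 'u) diagram" assume f: "f \<in> simplices Fin_op 1"
  then have "snd f 1 1 = (\<lambda>x\<in>fst f 1. x)" by (auto simp: simplices_Fin_op intro: fin_functors_id)
  moreover have "snd (Rbar 1 f) (0, 1) (1, 1) = snd f 1 1" by (rule Rbar_Mor[OF f]) auto
  ultimately show "snd (Rbar 1 f) (0, 1) (1, 1) = (\<lambda>x\<in>fst f 1. x)" by (simp only:)
next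
  show "algebraic_theory (Span :: (nat \<times> nat, 'u) diagram sset) Rbar"
    unfolding algebraic_theory_def
    using quasicategory_Span Rbar_smap essentially_surjective_Rbar Rbar_preserves_products by blast
qed (auto simp: Rbar_ob Rbar_Mor)

end
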